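(* Let $\bar\mu_n=\mathbb{E}\mu_n$ be the mean empirical spectral distribution of the $n\times n$ Ginibre ensemble and let $\mu_\infty$ be the uniform distribution on the unit disc. Then $$D(\bar\mu_n,\mu_\infty)\sim\frac{1}{\sqrt{2\pi n}}\qquad\text{as } n\to\infty,$$ i.e. the ratio of both sides tends to $1$. Moreover, there is an absolute constant $C>0$ such that for all $n\in\mathbb{N}$ and all $\epsilon>0$, $$\sup\ \bigl|\bar\mu_n(B_R(z_0))-\mu_\infty(B_R(z_0))\bigr|\le C e^{-n\epsilon^2},$$ where the supremum is over all $z_0\in\mathbb{C}$, $R>0$ such that $B_R(z_0)\subseteq\mathbb{C}\setminus B_{1+\epsilon}(0)$ or $B_R(z_0)\subseteq B_{1-\epsilon}(0)$.
   Context: $B_R(z_0)=\{z\in\mathbb{C}:|z-z_0|<R\}$, with $B_R(z_0)=\emptyset$ for $R\le 0$. The Ginibre ensemble is the random matrix $X=(X_{ij})_{1\le i,j\le n}$ with i.i.d. standard complex Gaussian entries $X_{ij}\sim\mathcal{N}_{\mathbb{C}}(0,1)$ (mean zero, real and imaginary parts independent, $\mathbb{E}|X_{ij}|^2=1$, real and imaginary parts each of variance $1/2$). Its empirical spectral distribution is $\mu_n=\frac1n\sum_{j=1}^n\delta_{\lambda_j(X/\sqrt n)}$, where $\lambda_j(X/\sqrt n)$ are the eigenvalues of $X/\sqrt n$ counted with multiplicity, and $\bar\mu_n(A)=\mathbb{E}[\mu_n(A)]$ for Borel $A\subseteq\mathbb{C}$. The measure $\mu_\infty$ has Lebesgue density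 $\frac1\pi\mathbf{1}_{B_1(0)}(z)$ on $\mathbb{C}$. For measures $\mu,\nu$ on $\mathbb{C}$, $D(\mu,\nu)=\sup_{z_0\in\mathbb{C},R>0}|\mu(B_R(z_0))-\nu(B_R(z_0))|$. *)

theory Defs
  imports
    "HOL-Probability.Probability"
    "HOL-Library.Landau_Symbols"
    "Jordan_Normal_Form.Char_Poly"
begin

text \<open>Standard complex Gaussian. The second argument of \<^const>\<open>normal_density\<close> is the
  standard deviation, so real and imaginary parts have variance \<open>1/2\<close>.\<close>

definition real_gauss_half :: "real measure" where
  "real_gauss_half = density lborel (\<lambda>x. ennreal (normal_density 0 (sqrt (1 / 2)) x))"

definition complex_gauss :: "complex measure" where
  "complex_gauss =
     distr (real_gauss_half \<Otimes>\<^sub>M real_gauss_half) borel (\<lambda>(x, y). Complex x y)"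

definition ginibre :: "nat \<Rightarrow> (nat \<times> nat \<Rightarrow> complex) measure" where
  "ginibre n = PiM ({..<n} \<times> {..<n}) (\<lambda>_. complex_gauss)"

definition matrix_of :: "nat \<Rightarrow> (nat \<times> nat \<Rightarrow> complex) \<Rightarrow> complex mat" where
  "matrix_of n X = Matrix.mat n n X"

text \<open>\<^term>\<open>proots (char_poly A)\<close> is the multiset of eigenvalues, counted with algebraic
  multiplicity.\<close>

definition esd :: "complex mat \<Rightarrow> complex measure" where
  "esd A = measure_of UNIV (sets borel)
     (\<lambda>B. (\<Sum>z\<in>#proots (char_poly A). indicator B z) / of_nat (dim_row A))"

definition ginibre_esd :: "nat \<Rightarrow> (nat \<times> nat \<Rightarrow> complex) \<Rightarrow> complex measure" where
  "ginibre_esd n X = esd (complex_of_real (1 / sqrt (real n)) \<cdot>\<^sub>m matrix_of n X)"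

definition mean_esd :: "nat \<Rightarrow> complex measure" where
  "mean_esd n = measure_of UNIV (sets borel)
     (\<lambda>B. \<integral>\<^sup>+ X. emeasure (ginibre_esd n X) B \<partial>ginibre n)"

definition unif_disc :: "complex measure" where
  "unif_disc = density lborel (\<lambda>z. ennreal (1 / pi * indicator (ball 0 1) z))"

text \<open>The supremum is a real one; it is bounded for finite measures.\<close>

definition ball_discrepancy ::
    "(complex \<times> real) set \<Rightarrow> complex measure \<Rightarrow> complex measure \<Rightarrow> real" where
  "ball_discrepancy S \<mu> \<nu> =
     (SUP (z0, R)\<in>S. \<bar>measure \<mu> (ball z0 R) - measure \<nu> (ball z0 R)\<bar>)"

definition D :: "complex measure \<Rightarrow> complex measure \<Rightarrow> real" where
  "D \<mu> \<nu> = ball_discrepancy {(z0, R). R > 0} \<mu> \<nu>"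

lemma sets_esd [simp]: "sets (esd A) = sets borel"
  and space_esd [simp]: "space (esd A) = UNIV"
  by (simp_all add: esd_def space_borel[symmetric] del: space_borel)

lemma emeasure_esd:
  assumes B: "B \<in> sets borel"
  shows "emeasure (esd A) B =
           (\<Sum>z\<in>#proots (char_poly A). indicator B z) / of_nat (dim_row A)"
proof (rule emeasure_measure_of[OF esd_def])
  have "(\<Sum>i. \<Sum>z\<in>#M. indicator (F i) z) = (\<Sum>z\<in>#M. indicator (\<Union>i. F i) z :: ennreal)"
    if "disjoint_family F" for F :: "nat \<Rightarrow> complex set" and M
    by (induction M) (simp_all add: suminf_add[symmetric] suminf_indicator[OF that])
  then show "countably_additive (sets (esd A))
      (\<lambda>B. (\<Sum>z\<in>#proots (char_poly A). indicator B z) / of_nat (dim_row A))"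
    by (auto simp: countably_additive_def divide_ennreal_def)
qed (use B in \<open>auto simp: positive_def\<close>)

lemma emeasure_mean_esd:
  assumes meas: "\<And>B. B \<in> sets borel \<Longrightarrow>
             (\<lambda>X. emeasure (ginibre_esd n X) B) \<in> borel_measurable (ginibre n)"
    and B: "B \<in> sets borel"
  shows "emeasure (mean_esd n) B = (\<integral>\<^sup>+ X. emeasure (ginibre_esd n X) B \<partial>ginibre n)"
proof (rule emeasure_measure_of[OF mean_esd_def])
  have sets: "sets (mean_esd n) = sets borel"
    by (simp add: mean_esd_def space_borel[symmetric] del: space_borel)
  show "countably_additive (sets (mean_esd n))
      (\<lambda>B. \<integral>\<^sup>+ X. emeasure (ginibre_esd n X) B \<partial>ginibre n)"
  proof (rule countably_additiveI)
    fix F :: "nat \<Rightarrow> complex set"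
    assume F: "range F \<subseteq> sets (mean_esd n)" "disjoint_family F"
    then have "(\<Sum>i. \<integral>\<^sup>+ X. emeasure (ginibre_esd n X) (F i) \<partial>ginibre n) =
        (\<integral>\<^sup>+ X. (\<Sum>i. emeasure (ginibre_esd n X) (F i)) \<partial>ginibre n)"
      by (intro nn_integral_suminf[symmetric] meas) (auto simp: sets)
    also have "\<dots> = (\<integral>\<^sup>+ X. emeasure (ginibre_esd n X) (\<Union>i. F i) \<partial>ginibre n)"
      using F by (subst suminf_emeasure) (auto simp: sets ginibre_esd_def)
    finally show "(\<Sum>i. \<integral>\<^sup>+ X. emeasure (ginibre_esd n X) (F i) \<partial>ginibre n) =
        (\<integral>\<^sup>+ X. emeasure (ginibre_esd n X) (\<Union>i. F i) \<partial>ginibre n)" .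
  qed
  show "B \<in> sets (mean_esd n)" using B by (simp add: sets)
qed (auto simp: positive_def)

end

theory Submission
  imports Defs "HOL-Complex_Analysis.Complex_Analysis" "Jordan_Normal_Form.Schur_Decomposition"
    "Subresultants.Subresultant_Gcd" "HOL-Real_Asymp.Real_Asymp" "HOL-Computational_Algebra.Field_as_Ring"
begin

text \<open>
  The mean spectral distribution of the Ginibre ensemble, scaled by \<open>1 / sqrt n\<close>, has the density
  \<open>p\<^sub>n (n * |z|\<^sup>2) / pi\<close>, where \<open>p\<^sub>n x\<close> is the probability that a Poisson variable of mean \<open>x\<close>
  is less than \<open>n\<close> (lemma \<open>emeasure_mean_esd_density\<close>). As \<open>p\<^sub>n\<close> takes values between 0 and 1, this
  density lies below that of the uniform law inside the unit disc and above it outside. Hence no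
  Borel set has a larger discrepancy than the unit disc itself, and the supremum over balls is
  attained there. The function \<open>x * p\<^sub>n x + n * (1 - p\<^sub>n\<^sub>+\<^sub>1 x)\<close> is an antiderivative of \<open>p\<^sub>n\<close>, so the
  mass outside the unit disc is exactly \<open>exp (- n) * n ^ n / n!\<close> (lemma \<open>D_mean_esd\<close>), and Stirling's
  formula gives the first claim. The same antiderivative bounds the mass outside radius \<open>1 + \<epsilon>\<close> and
  the deficit inside radius \<open>1 - \<epsilon>\<close> by \<open>exp (- n * s) * (n * s) ^ n / n!\<close> with \<open>s = (1 \<plusminus> \<epsilon>)\<^sup>2\<close>; since
  \<open>n ^ n / n!\<close> is at most \<open>exp n\<close>, this is at most \<open>exp (- n * \<epsilon>\<^sup>2)\<close>, and the second claim holds with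
  \<open>C = 1\<close>.

  The density is obtained without the joint law of all eigenvalues. Write the matrix of size \<open>m + 1\<close>
  with corner entry \<open>a\<close>, leading minor \<open>D\<close>, last column \<open>b\<close> and last row \<open>c\<close>. Its characteristic
  polynomial is \<open>N - a q\<close>, where \<open>q\<close> is that of \<open>D\<close> and neither polynomial depends on \<open>a\<close>, and almost
  surely \<open>N\<close> and \<open>q\<close> have no common root. Integrating the number of eigenvalues in a set over \<open>a\<close> is
  therefore a change of variables \<open>a = N z / q z\<close> in one complex dimension (lemma \<open>eig_count_slices\<close>).
  For a given eigenvalue \<open>z\<close> the linear substitution \<open>b = (z I - D) w\<close> introduces the eigenvector
  \<open>(w, 1)\<close>, and the two Jacobians combine into the squared modulus of a determinant without poles
  (lemma \<open>slice_density_glue\<close>). A Householder reflection then rotates the eigenvector to a basis vector;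
  as it preserves the Gaussian weight, what remains is \<open>exp (- t * |z|\<^sup>2)\<close> times the second moment of
  \<open>det (z I - Z)\<close> for a Gaussian matrix \<open>Z\<close> of size \<open>m\<close> (lemma \<open>incidence_weight_deflation\<close>). By
  independence of the entries that moment is a multiple of \<open>\<Sum>k\<le>m. (t * |z|\<^sup>2) ^ k / k!\<close> (lemma
  \<open>nn_integral_det_gauss\<close>).

  Factors that do not depend on \<open>z\<close> are never evaluated: the Jacobian of an additive bijection of a
  product of complex lines is some constant, by uniqueness of Haar measure
  (lemma \<open>nn_integral_additive_bijection\<close>), and the normalisation follows at the end because the
  mean spectral distribution has total mass 1. The substitution \<open>b = (z I - D) w\<close> is the exception,
  as its Jacobian depends on \<open>z\<close> and \<open>D\<close>; it is the squared modulus of the determinant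
  (lemma \<open>nn_integral_linear_substitution\<close>).
\<close>

section \<open>Measurability of root counts\<close>

lemma poly_eval_measurable:
  assumes P: "\<And>k. (\<lambda>x. coeff (P x) k :: complex) \<in> borel_measurable M" and d: "\<And>x. degree (P x) \<le> d"
    and g: "g \<in> borel_measurable M"
  shows "(\<lambda>x. poly (P x) (g x)) \<in> borel_measurable M"
proof -
  have "poly (P x) (g x) = (\<Sum>k\<le>d. coeff (P x) k * g x ^ k)" for x
  proof -
    have "poly (P x) (g x) = (\<Sum>k\<le>degree (P x). coeff (P x) k * g x ^ k)" by (rule poly_altdef)
    also have "\<dots> = (\<Sum>k\<le>d. coeff (P x) k * g x ^ k)"
      using d[of x] by (intro sum.mono_neutral_left) (auto simp: coeff_eq_0)
    finally show ?thesis .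
  qed
  then show ?thesis using P g by simp
qed

lemma poly_pderiv_linear_mult:
  "poly (pderiv ([:- z, 1:] * q)) w = (w - z) * poly (pderiv q) w + poly q (w :: complex)"
  unfolding pderiv_mult by (simp add: pderiv_pCons algebra_simps)

text \<open>The product rule turns the logarithmic derivative of a product into a sum; stated for
  a multiset of roots, so that multiplicities need no separate treatment.\<close>

lemma logarithmic_derivative_prod_linear:
  fixes M :: "complex multiset"
  assumes "\<And>z. z \<in># M \<Longrightarrow> w \<noteq> z"
  shows "poly (pderiv (\<Prod>z\<in>#M. [:- z, 1:])) w / poly (\<Prod>z\<in>#M. [:- z, 1:]) w = (\<Sum>z\<in>#M. 1 / (w - z))"
  using assms
proof (induction M)
  case (add z M)
  let ?q = "\<Prod>z\<in>#M. [:- z, 1:]"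
  have nz: "poly ?q w \<noteq> 0"
    using add.prems by (induction M) auto
  have wz: "w - z \<noteq> 0" using add.prems by auto
  have IH: "poly (pderiv ?q) w / poly ?q w = (\<Sum>z\<in>#M. 1 / (w - z))" using add.IH add.prems by auto
  have "poly ([:- z, 1:] * ?q) w = (w - z) * poly ?q w" by (simp add: algebra_simps)
  then have "poly (pderiv ([:- z, 1:] * ?q)) w / poly ([:- z, 1:] * ?q) w = ((w - z) * poly (pderiv ?q) w + poly ?q w) / ((w - z) * poly ?q w)"
    by (simp only: poly_pderiv_linear_mult)
  also have "\<dots> = poly (pderiv ?q) w / poly ?q w + 1 / (w - z)"
    using nz wz by (simp add: field_simps)
  finally have "poly (pderiv ([:- z, 1:] * ?q)) w / poly ([:- z, 1:] * ?q) w = (\<Sum>z\<in>#M. 1 / (w - z)) + 1 / (w - z)"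
    by (simp only: IH)
  then show ?case by (simp only: image_mset_add_mset prod_mset.add_mset sum_mset.add_mset add.commute)
qed auto

lemma logarithmic_derivative_poly:
  fixes p :: "complex poly"
  assumes "p \<noteq> 0" "poly p w \<noteq> 0"
  shows "poly (pderiv p) w / poly p w = (\<Sum>z\<in>#proots p. 1 / (w - z))"
proof -
  let ?q = "\<Prod>z\<in>#proots p. [:- z, 1:]"
  have p: "p = Polynomial.smult (lead_coeff p) ?q" by (rule complex_poly_decompose_multiset[symmetric])
  have "poly (pderiv p) w / poly p w = poly (pderiv (Polynomial.smult (lead_coeff p) ?q)) w / poly (Polynomial.smult (lead_coeff p) ?q) w"
    using p by simp
  also have "\<dots> = poly (pderiv ?q) w / poly ?q w" using assms by (simp add: pderiv_smult)
  also have "\<dots> = (\<Sum>z\<in>#proots p. 1 / (w - z))"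
    using assms by (intro logarithmic_derivative_prod_linear) auto
  finally show ?thesis .
qed

lemma has_contour_integral_sum_mset_poles:
  assumes "valid_path \<gamma>" "\<And>z. z \<in># M \<Longrightarrow> z \<notin> path_image \<gamma>"
  shows "((\<lambda>w. \<Sum>z\<in>#M. 1 / (w - z)) has_contour_integral (2 * pi * \<i> * (\<Sum>z\<in>#M. winding_number \<gamma> z))) \<gamma>"
  using assms(2)
proof (induction M)
  case empty
  then show ?case using has_contour_integral_0 by simp
next
  case (add z M)
  have "((\<lambda>w. 1 / (w - z)) has_contour_integral (2 * pi * \<i> * winding_number \<gamma> z)) \<gamma>"
    using assms(1) add.prems by (intro has_contour_integral_winding_number) auto
  from has_contour_integral_add[OF this add.IH] add.prems show ?case by (simp add: distrib_left)
qed

text \<open>A contour integral along a segment, written as a Lebesgue integral: parameter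
  integrals of this kind are measurable in the parameter even where they diverge.\<close>

definition segment_integral :: "(complex \<Rightarrow> complex) \<Rightarrow> complex \<Rightarrow> complex \<Rightarrow> complex" where
  "segment_integral f a b = (LINT t:{0..1}|lborel. f (linepath a b t) * (b - a))"

lemma has_contour_integral_segment:
  assumes "continuous_on (closed_segment a b) f"
  shows "(f has_contour_integral segment_integral f a b) (linepath a b)"
proof -
  have "continuous_on {0..1} (\<lambda>t. f (linepath a b t) * (b - a))"
    by (intro continuous_on_mult continuous_on_const continuous_on_compose2[OF assms] continuous_on_linepath)
       (auto simp: linepath_in_path)
  then have i: "set_integrable lborel {0..1} (\<lambda>t. f (linepath a b t) * (b - a))"
    by (rule borel_integrable_atLeastAtMost')
  show ?thesis
    unfolding has_contour_integral_linepath segment_integral_def set_borel_integral_eq_integral(2)[OF i]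
    by (rule integrable_integral[OF set_borel_integral_eq_integral(1)[OF i]])
qed

text \<open>The argument principle for the rectangle with corners \<open>a\<close> and
  \<open>b\<close>, unfolded into its four sides. The value is meaningless when a root lies on the
  boundary.\<close>

definition box_count :: "complex poly \<Rightarrow> complex \<Rightarrow> complex \<Rightarrow> real" where
  "box_count p a b = (let f = (\<lambda>w. poly (pderiv p) w / poly p w); a' = Complex (Re b) (Im a); b' = Complex (Re a) (Im b)
     in Re ((segment_integral f a a' + (segment_integral f a' b + (segment_integral f b b' + segment_integral f b' a))) / (2 * pi * \<i>)))"

text \<open>The logarithmic derivative of a polynomial is the sum of \<open>1 / (w - z)\<close>
  over the roots \<open>z\<close>, so its contour integral adds up the winding numbers of the
  rectangle around the roots.\<close>

lemma box_count_eq: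
  assumes p: "p \<noteq> 0" and ab: "Re a < Re b" "Im a < Im b"
    and bd: "\<And>z. poly p z = 0 \<Longrightarrow> z \<in> box a b \<or> z \<notin> cbox a b"
  shows "box_count p a b = (\<Sum>z\<in>#proots p. indicator (box a b) z)"
proof -
  define f where "f = (\<lambda>w. poly (pderiv p) w / poly p w)"
  let ?a' = "Complex (Re b) (Im a)" and ?b' = "Complex (Re a) (Im b)"
  let ?\<gamma> = "rectpath a b"
  have pim: "path_image ?\<gamma> = cbox a b - box a b" using ab by (intro path_image_rectpath_cbox_minus_box) auto
  have nz: "poly p w \<noteq> 0" if "w \<in> path_image ?\<gamma>" for w using bd[of w] that pim by auto
  have cont: "continuous_on (path_image ?\<gamma>) f"
    unfolding f_def using nz by (intro continuous_intros) auto
  have pim': "path_image ?\<gamma> = closed_segment a ?a' \<union> (closed_segment ?a' b \<union> (closed_segment b ?b' \<union> closed_segment ?b' a))"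
    by (simp add: rectpath_def Let_def path_image_join)
  have I: "(f has_contour_integral (segment_integral f a ?a' + (segment_integral f ?a' b + (segment_integral f b ?b' + segment_integral f ?b' a)))) ?\<gamma>"
    unfolding rectpath_def Let_def
    by (intro has_contour_integral_join has_contour_integral_segment continuous_on_subset[OF cont] valid_path_join)
       (auto simp: pim')
  have "((\<lambda>w. \<Sum>z\<in>#proots p. 1 / (w - z)) has_contour_integral (2 * pi * \<i> * (\<Sum>z\<in>#proots p. winding_number ?\<gamma> z))) ?\<gamma>"
    using nz p by (intro has_contour_integral_sum_mset_poles) auto
  then have "(f has_contour_integral (2 * pi * \<i> * (\<Sum>z\<in>#proots p. winding_number ?\<gamma> z))) ?\<gamma>"
    by (rule has_contour_integral_eq) (auto simp: f_def logarithmic_derivative_poly[OF p nz])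
  note e = has_contour_integral_unique[OF I this]
  have "box_count p a b = Re (\<Sum>z\<in>#proots p. winding_number ?\<gamma> z)"
    unfolding box_count_def Let_def f_def[symmetric] e by (subst nonzero_mult_div_cancel_left) simp_all
  also have "(\<Sum>z\<in>#proots p. winding_number ?\<gamma> z) = (\<Sum>z\<in>#proots p. of_real (indicator (box a b) z))"
  proof (rule arg_cong[where f = sum_mset], rule image_mset_cong)
    fix z assume "z \<in># proots p"
    then have "poly p z = 0" using p by simp
    from bd[OF this] show "winding_number ?\<gamma> z = of_real (indicator (box a b) z)"
    proof
      assume "z \<in> box a b"
      then show ?thesis by (simp add: winding_number_rectpath)
    next
      assume z: "z \<notin> cbox a b"
      then have "z \<notin> box a b" using box_subset_cbox by auto
      then show ?thesis using z ab by (simp add: winding_number_rectpath_outside)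
    qed
  qed
  also have "Re (\<Sum>z\<in>#N. of_real (indicator (box a b) z)) = (\<Sum>z\<in>#N. indicator (box a b) z)" for N
    by (induction N) auto
  finally show ?thesis .
qed

lemma box_count_measurable:
  assumes P: "\<And>k. (\<lambda>x. coeff (P x) k :: complex) \<in> borel_measurable M" and d: "\<And>x. degree (P x) \<le> d"
  shows "(\<lambda>x. box_count (P x) a b) \<in> borel_measurable M"
proof -
  have seg: "(\<lambda>x. segment_integral (\<lambda>w. poly (pderiv (P x)) w / poly (P x) w) a b) \<in> borel_measurable M" for a b
    unfolding segment_integral_def set_lebesgue_integral_def
  proof (rule lborel.borel_measurable_lebesgue_integral)
    have lp: "(\<lambda>y. linepath a b (snd y)) \<in> borel_measurable (M \<Otimes>\<^sub>M lborel)"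
      unfolding linepath_def by measurable
    have c1: "(\<lambda>y. coeff (P (fst y)) k) \<in> borel_measurable (M \<Otimes>\<^sub>M lborel)" for k
      by (rule measurable_compose[OF measurable_fst P])
    have c2: "(\<lambda>y. coeff (pderiv (P (fst y))) k) \<in> borel_measurable (M \<Otimes>\<^sub>M lborel)" for k
      unfolding coeff_pderiv using c1 by measurable
    have "(\<lambda>y. poly (P (fst y)) (linepath a b (snd y))) \<in> borel_measurable (M \<Otimes>\<^sub>M lborel)"
      by (rule poly_eval_measurable[OF c1 d lp])
    moreover have "(\<lambda>y. poly (pderiv (P (fst y))) (linepath a b (snd y))) \<in> borel_measurable (M \<Otimes>\<^sub>M lborel)"
      by (rule poly_eval_measurable[OF c2 _ lp, of d]) (use d in \<open>auto simp: degree_pderiv intro: le_trans[OF diff_le_self]\<close>)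
    moreover have "(\<lambda>y. indicat_real {0..1::real} (snd y)) \<in> borel_measurable (M \<Otimes>\<^sub>M lborel)"
      by (rule measurable_compose[OF measurable_snd]) simp
    ultimately show "(\<lambda>(x, t). indicat_real {0..1} t *\<^sub>R (poly (pderiv (P x)) (linepath a b t) / poly (P x) (linepath a b t) * (b - a)))
      \<in> borel_measurable (M \<Otimes>\<^sub>M lborel)"
      unfolding split_beta
      by (intro borel_measurable_scaleR borel_measurable_times borel_measurable_divide borel_measurable_const)
  qed
  have Re: "Re \<in> borel_measurable borel"
    by (intro borel_measurable_continuous_onI continuous_intros)
  show ?thesis unfolding box_count_def Let_def
    by (intro measurable_compose[OF _ Re] borel_measurable_divide borel_measurable_add seg borel_measurable_const)
qed

text \<open>The number of roots in a Borel set is a measurable function of the coefficients. For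
  an open rectangle it is the limit of the counts given by the argument principle on slightly
  smaller rectangles: a given polynomial has only finitely many roots, so all but finitely many of
  the smaller boundaries avoid them. Open rectangles form an intersection-stable generator, and
  the class of good sets is closed under complements because the total number of roots is the
  degree.\<close>

lemma root_count_measurable:
  fixes P :: "'a \<Rightarrow> complex poly"
  assumes P: "\<And>k. (\<lambda>x. coeff (P x) k) \<in> borel_measurable M" and d: "\<And>x. degree (P x) = d" and nz: "\<And>x. P x \<noteq> 0"
    and B: "B \<in> sets borel"
  shows "(\<lambda>x. \<Sum>z\<in>#proots (P x). indicator B z :: ennreal) \<in> borel_measurable M"
proof -
  define c where "c B x = (\<Sum>z\<in>#proots (P x). indicator B z :: ennreal)" for B x
  have c_empty: "c {} = (\<lambda>_. 0)"
  proof
    have "(\<Sum>z\<in>#N. indicator {} z :: ennreal) = 0" for N :: "complex multiset" by (induction N) auto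
    then show "c {} x = 0" for x by (simp only: c_def)
  qed
  have box: "c (box a b) \<in> borel_measurable M" for a b
  proof (cases "Re a < Re b \<and> Im a < Im b")
    case False
    then have "box a b = {}" by (auto simp: in_box_complex_iff)
    then show ?thesis by (simp add: c_empty)
  next
    case True
    (* The margins \<delta> / (k + 1) tend to 0 and leave every smaller box nondegenerate. *)
    define \<delta> where "\<delta> = min (Re b - Re a) (Im b - Im a) / 3"
    have \<delta>: "\<delta> > 0" "3 * \<delta> \<le> Re b - Re a" "3 * \<delta> \<le> Im b - Im a" using True by (auto simp: \<delta>_def)
    define e where "e k = \<delta> / real (Suc k)" for k
    have e: "e k > 0" "e k \<le> \<delta>" for k using \<delta> by (auto simp: e_def field_simps)
    have e0: "e \<longlonglongrightarrow> 0" unfolding e_def[abs_def] by real_asymp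
    define a' where "a' k = a + Complex (e k) (e k)" for k
    define b' where "b' k = b - Complex (e k) (e k)" for k
    have sub: "cbox (a' k) (b' k) \<subseteq> box a b" for k
      using e[of k] by (auto simp: in_box_complex_iff in_cbox_complex_iff a'_def b'_def)
    have lim: "(\<lambda>k. box_count (P x) (a' k) (b' k)) \<longlonglongrightarrow> (\<Sum>z\<in>#proots (P x). indicator (box a b) z)" for x
    proof (rule tendsto_eventually)
      have fin: "finite {z. poly (P x) z = 0}" using nz by (rule poly_roots_finite)
      have "eventually (\<lambda>k. z \<in> box a b \<longrightarrow> z \<in> box (a' k) (b' k)) sequentially" for z
      proof (cases "z \<in> box a b")
        case True
        then have "min (min (Re z - Re a) (Re b - Re z)) (min (Im z - Im a) (Im b - Im z)) > 0"
          by (auto simp: in_box_complex_iff)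
        from order_tendstoD(2)[OF e0 this] show ?thesis
          by eventually_elim (auto simp: in_box_complex_iff a'_def b'_def)
      qed auto
      then have "eventually (\<lambda>k. \<forall>z\<in>{z. poly (P x) z = 0}. z \<in> box a b \<longrightarrow> z \<in> box (a' k) (b' k)) sequentially"
        using fin by (intro eventually_ball_finite) auto
      then show "eventually (\<lambda>k. box_count (P x) (a' k) (b' k) = (\<Sum>z\<in>#proots (P x). indicator (box a b) z)) sequentially"
      proof eventually_elim
        fix k assume k: "\<forall>z\<in>{z. poly (P x) z = 0}. z \<in> box a b \<longrightarrow> z \<in> box (a' k) (b' k)"
        have "box_count (P x) (a' k) (b' k) = (\<Sum>z\<in>#proots (P x). indicator (box (a' k) (b' k)) z)"
          using k sub[of k] e[of k] \<delta> nz[of x] by (intro box_count_eq) (auto simp: a'_def b'_def)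
        also have "\<dots> = (\<Sum>z\<in>#proots (P x). indicator (box a b) z)"
        proof (rule arg_cong[where f = sum_mset], rule image_mset_cong)
          fix z assume "z \<in># proots (P x)"
          then have "poly (P x) z = 0" using nz by simp
          then show "indicat_real (box (a' k) (b' k)) z = indicator (box a b) z"
            using k sub[of k] box_subset_cbox[of "a' k" "b' k"] by (auto simp: indicator_def)
        qed
        finally show "box_count (P x) (a' k) (b' k) = (\<Sum>z\<in>#proots (P x). indicator (box a b) z)" .
      qed
    qed
    have "(\<lambda>x. \<Sum>z\<in>#proots (P x). indicat_real (box a b) z) \<in> borel_measurable M"
      using d by (intro borel_measurable_LIMSEQ_real[OF lim] box_count_measurable P) auto
    moreover have "c (box a b) x = ennreal (\<Sum>z\<in>#proots (P x). indicat_real (box a b) z)" for x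
    proof -
      have "(\<Sum>z\<in>#N. indicator (box a b) z :: ennreal) = ennreal (\<Sum>z\<in>#N. indicat_real (box a b) z) \<and> (\<Sum>z\<in>#N. indicat_real (box a b) z) \<ge> 0" for N
        by (induction N) (auto simp: indicator_def)
      then show ?thesis by (simp add: c_def)
    qed
    ultimately show ?thesis by (simp add: fun_eq_iff[symmetric] cong: measurable_cong)
  qed
  have B': "B \<in> sigma_sets UNIV (range (\<lambda>(a, b). box a b :: complex set))"
    using B by (simp add: borel_eq_box)
  have IS: "Int_stable (range (\<lambda>(a, b). box a b :: complex set))"
  proof (rule Int_stableI)
    fix X Y assume "X \<in> range (\<lambda>(a, b). box a b :: complex set)" "Y \<in> range (\<lambda>(a, b). box a b :: complex set)"
    then obtain a b a' b' where XY: "X = box a b" "Y = box a' b'" by auto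
    have "X \<inter> Y = box (Complex (max (Re a) (Re a')) (max (Im a) (Im a'))) (Complex (min (Re b) (Re b')) (min (Im b) (Im b')))"
      unfolding XY by (auto simp: in_box_complex_iff)
    then show "X \<inter> Y \<in> range (\<lambda>(a, b). box a b :: complex set)" by (auto intro: image_eqI)
  qed
  have "c B \<in> borel_measurable M"
    using IS subset_UNIV[of "range (\<lambda>(a, b). box a b :: complex set)", folded Pow_UNIV] B'
  proof (induct rule: sigma_sets_induct_disjoint)
    case (basic A)
    then show ?case using box by auto
  next
    case empty
    then show ?case by (simp add: c_empty)
  next
    case (compl A)
    have "c (UNIV - A) x = of_nat d - c A x" for x
    proof -
      have "(\<Sum>z\<in>#N. indicator A z :: ennreal) + (\<Sum>z\<in>#N. indicator (UNIV - A) z) = of_nat (size N) \<and>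
          (\<Sum>z\<in>#N. indicator A z :: ennreal) \<noteq> \<top>" for N
        by (induction N) (auto simp: indicator_def add_ac ennreal_add_eq_top)
      from this[of "proots (P x)"] have e: "c A x + c (UNIV - A) x = of_nat d" "c A x \<noteq> \<top>"
        by (simp_all add: c_def size_proots_complex d)
      then show ?thesis using ennreal_add_diff_cancel_left[of "c A x" "c (UNIV - A) x"] by simp
    qed
    then have "c (UNIV - A) = (\<lambda>x. of_nat d - c A x)" by auto
    then show ?case using compl by simp
  next
    case (union A)
    have s: "(\<Sum>z\<in>#N. indicator (\<Union>i. A i) z :: ennreal) = (\<Sum>i. \<Sum>z\<in>#N. indicator (A i) z)" for N
      by (induction N) (simp_all add: suminf_add[symmetric] suminf_indicator[OF union(1)])
    have "c (\<Union>i. A i) = (\<lambda>x. \<Sum>i. c (A i) x)" unfolding c_def s ..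
    then show ?case using union by simp
  qed
  then show ?thesis by (simp add: c_def[abs_def])
qed

section \<open>Change of variables along a holomorphic map\<close>

text \<open>The change of variables theorem is about \<open>real^2\<close>; these two maps carry
  it to the complex plane.\<close>

definition vec_of_complex :: "complex \<Rightarrow> real^2" where
  "vec_of_complex z = (\<chi> i. if i = 1 then Re z else Im z)"

definition complex_of_vec :: "real^2 \<Rightarrow> complex" where
  "complex_of_vec x = Complex (x $ 1) (x $ 2)"

lemma complex_of_vec_inverse [simp]: "vec_of_complex (complex_of_vec x) = x"
  by (simp add: vec_of_complex_def complex_of_vec_def Finite_Cartesian_Product.vec_eq_iff forall_2)

lemma vec_of_complex_inverse [simp]: "complex_of_vec (vec_of_complex z) = z"
  by (simp add: vec_of_complex_def complex_of_vec_def)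

lemma bounded_linear_vec_of_complex: "bounded_linear vec_of_complex"
proof -
  have "linear vec_of_complex"
    by (rule linearI) (simp_all add: vec_of_complex_def Finite_Cartesian_Product.vec_eq_iff)
  then show ?thesis by (rule linear_conv_bounded_linear[THEN iffD1])
qed

lemma bounded_linear_complex_of_vec: "bounded_linear complex_of_vec"
proof -
  have "linear complex_of_vec"
    by (rule linearI) (simp_all add: complex_of_vec_def complex_eq_iff)
  then show ?thesis by (rule linear_conv_bounded_linear[THEN iffD1])
qed

lemma measurable_vec_of_complex [measurable]: "vec_of_complex \<in> borel \<rightarrow>\<^sub>M borel"
  by (intro borel_measurable_continuous_onI linear_continuous_on bounded_linear_vec_of_complex)

lemma measurable_complex_of_vec [measurable]: "complex_of_vec \<in> borel \<rightarrow>\<^sub>M borel"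
  by (intro borel_measurable_continuous_onI linear_continuous_on bounded_linear_complex_of_vec)

lemma distr_lborel_vec_of_complex: "distr lborel borel vec_of_complex = (lborel :: (real^2) measure)"
proof (rule lborel_eqI[symmetric])
  fix l u :: "real^2"
  assume le: "\<And>b. b \<in> Basis \<Longrightarrow> l \<bullet> b \<le> u \<bullet> b"
  have le': "l $ 1 \<le> u $ 1" "l $ 2 \<le> u $ 2"
    using le[of "axis 1 1"] le[of "axis 2 1"] by (simp_all add: axis_in_Basis_iff inner_axis)
  have eq: "vec_of_complex -` box l u = box (complex_of_vec l) (complex_of_vec u)"
    by (auto simp: mem_box_cart forall_2 in_box_complex_iff vec_of_complex_def complex_of_vec_def)
  have B2: "(Basis :: (real^2) set) = {axis 1 1, axis 2 1}"
    by (auto simp: Basis_vec_def UNIV_2)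
  have ne: "(axis 1 1 :: real^2) \<noteq> axis 2 1" by (simp add: axis_eq_axis)
  have "emeasure (distr lborel borel vec_of_complex) (box l u) =
        emeasure lborel (box (complex_of_vec l) (complex_of_vec u))"
    by (subst emeasure_distr) (simp_all add: eq)
  also have "\<dots> = ennreal ((u $ 1 - l $ 1) * (u $ 2 - l $ 2))"
    using le' by (subst emeasure_lborel_box_eq) (simp add: Basis_complex_def complex_of_vec_def)
  also have "(u $ 1 - l $ 1) * (u $ 2 - l $ 2) = prod ((\<bullet>) (u - l)) Basis"
    using ne by (simp add: B2 inner_axis)
  finally show "emeasure (distr lborel borel vec_of_complex) (box l u) = ennreal (prod ((\<bullet>) (u - l)) Basis)" .
qed simp

text \<open>Multiplication by \<open>c\<close> is a rotation followed by a dilation by \<open>norm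
  c\<close>, which explains the squared modulus in every complex Jacobian below.\<close>

lemma det_complex_mult:
  "Determinants.det (matrix (\<lambda>h. vec_of_complex (c * complex_of_vec h))) = (norm c)\<^sup>2"
  unfolding Determinants.det_2
  by (simp add: matrix_def vec_of_complex_def complex_of_vec_def axis_def cmod_power2 flip: power2_eq_square)

lemma emeasure_lborel_complex_conv_vec:
  assumes "A \<in> sets borel"
  shows "emeasure lborel (complex_of_vec -` A) = emeasure lborel A"
proof -
  have "complex_of_vec -` A \<in> sets borel" 
    using measurable_sets[OF measurable_complex_of_vec assms] by simp
  then have "emeasure lborel (complex_of_vec -` A) = emeasure lborel (vec_of_complex -` complex_of_vec -` A)"
    by (subst distr_lborel_vec_of_complex[symmetric], subst emeasure_distr) simp_all
  also have "vec_of_complex -` complex_of_vec -` A = A" by auto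
  finally show ?thesis .
qed

text \<open>An injective holomorphic map is open, so its inverse is continuous and pulls Borel
  sets back to Borel sets.\<close>

lemma borel_image_inj_holomorphic:
  fixes g :: "complex \<Rightarrow> complex"
  assumes U: "open U" and g: "g holomorphic_on U" "inj_on g U"
    and S: "S \<in> sets borel" "S \<subseteq> U"
  shows "g ` S \<in> sets borel"
proof -
  obtain h where h: "h holomorphic_on (g ` U)" "\<And>z. z \<in> U \<Longrightarrow> deriv g z * deriv h (g z) = 1"
      "\<And>z. z \<in> U \<Longrightarrow> h (g z) = z"
    using holomorphic_has_inverse[OF g(1) U g(2)] by metis
  have op: "open (g ` U)" using open_mapping_thm3[OF g(1) U g(2)] .
  have "(\<lambda>w. if w \<in> g ` U then h w else 0) \<in> borel \<rightarrow>\<^sub>M borel"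
    by (intro borel_measurable_continuous_on_if continuous_on_const
        holomorphic_on_imp_continuous_on h) (use op in auto)
  then have "g ` U \<inter> (\<lambda>w. if w \<in> g ` U then h w else 0) -` S \<in> sets borel"
    using op S measurable_sets[of _ borel borel S] by (intro sets.Int) auto
  also have "g ` U \<inter> (\<lambda>w. if w \<in> g ` U then h w else 0) -` S = g ` S"
    using S h(3) by auto
  finally show ?thesis .
qed

text \<open>The bounds on \<open>S\<close> and on the derivative make the Jacobian integrable, as
  the underlying theorem for \<open>real^2\<close> requires; countable covers remove them
  later.\<close>

lemma emeasure_image_inj_holomorphic:
  fixes g :: "complex \<Rightarrow> complex"
  assumes U: "open U" and g: "g holomorphic_on U" "inj_on g U"
    and S: "S \<in> sets borel" "S \<subseteq> U" "bounded S" and M: "\<And>z. z \<in> S \<Longrightarrow> norm (deriv g z) \<le> M"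
  shows "emeasure lborel (g ` S) = (\<integral>\<^sup>+z. ennreal ((norm (deriv g z))\<^sup>2) * indicator S z \<partial>lborel)"
proof -
  define d where "d = (\<lambda>z. (norm (if z \<in> U then deriv g z else 0))\<^sup>2 * indicator S z)"
  have dS: "d z = (norm (deriv g z))\<^sup>2 * indicator S z" for z
    using S by (auto simp: d_def indicator_def)
  have dm: "d \<in> borel_measurable borel"
  proof -
    have "(\<lambda>z. if z \<in> U then deriv g z else 0) \<in> borel_measurable borel"
      by (intro borel_measurable_continuous_on_if continuous_on_const
          holomorphic_on_imp_continuous_on holomorphic_deriv g) (use U in auto)
    then show ?thesis unfolding d_def using S by measurable
  qed
  define S' where "S' = complex_of_vec -` S"
  define G where "G = vec_of_complex \<circ> g \<circ> complex_of_vec"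
  have S'b: "S' \<in> sets borel" 
    using measurable_sets[OF measurable_complex_of_vec S(1)] by (simp add: S'_def)
  have "(\<integral>\<^sup>+z. ennreal (d z) \<partial>lborel) \<le> (\<integral>\<^sup>+z. ennreal (M\<^sup>2) * indicator S z \<partial>lborel)"
    using M by (intro nn_integral_mono) (auto simp: dS indicator_def intro!: ennreal_leI power_mono)
  also have "\<dots> = ennreal (M\<^sup>2) * emeasure lborel S" using S by (simp add: nn_integral_cmult_indicator)
  also have "\<dots> < \<infinity>" using emeasure_bounded_finite[OF S(3)] by (simp add: ennreal_mult_less_top)
  finally obtain r where r: "r \<ge> 0" "(\<integral>\<^sup>+z. ennreal (d z) \<partial>lborel) = ennreal r"
    by (cases "\<integral>\<^sup>+z. ennreal (d z) \<partial>lborel") auto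
  have r': "(\<integral>\<^sup>+x. ennreal (d (complex_of_vec x)) \<partial>lborel) = ennreal r"
    unfolding r(2)[symmetric] using dm
    by (subst distr_lborel_vec_of_complex[symmetric], subst nn_integral_distr) simp_all
  have hi: "((\<lambda>x. d (complex_of_vec x)) has_integral r) UNIV"
    using r r' measurable_compose[OF measurable_complex_of_vec dm]
    by (intro nn_integral_has_integral) (auto simp: dS)
  have "((\<lambda>x. if x \<in> S' then (norm (deriv g (complex_of_vec x)))\<^sup>2 else 0) has_integral r) UNIV"
    by (rule has_integral_eq[OF _ hi]) (auto simp: dS S'_def)
  then have hi: "((\<lambda>x. (norm (deriv g (complex_of_vec x)))\<^sup>2) has_integral r) S'"
    by (simp only: has_integral_restrict_UNIV)
  have "(G has_derivative (\<lambda>h. vec_of_complex (deriv g (complex_of_vec x) * complex_of_vec h))) (at x within S')"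
    if "x \<in> S'" for x
  proof -
    have "(g has_field_derivative deriv g (complex_of_vec x)) (at (complex_of_vec x))"
      using that S U g by (auto simp: S'_def intro!: holomorphic_derivI)
    then have "(g has_derivative (*) (deriv g (complex_of_vec x))) (at (complex_of_vec x))"
      by (simp add: has_field_derivative_def)
    from has_derivative_compose[OF bounded_linear_imp_has_derivative[OF bounded_linear_complex_of_vec, of "at x within S'"] this]
    have "((\<lambda>x. g (complex_of_vec x)) has_derivative (\<lambda>h. deriv g (complex_of_vec x) * complex_of_vec h)) (at x within S')" .
    from has_derivative_compose[OF this bounded_linear_imp_has_derivative[OF bounded_linear_vec_of_complex]]
    show ?thesis unfolding G_def o_def .
  qed
  moreover have "inj_on G S'"
  proof (rule inj_onI)
    fix x y assume xy: "x \<in> S'" "y \<in> S'" "G x = G y"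
    then have "g (complex_of_vec x) = g (complex_of_vec y)"
      unfolding G_def o_def by (metis vec_of_complex_inverse)
    with xy g S have "complex_of_vec x = complex_of_vec y" by (auto simp: S'_def dest: inj_onD)
    then show "x = y" by (metis complex_of_vec_inverse)
  qed
  moreover have "((\<lambda>x. \<bar>Determinants.det (matrix (\<lambda>h. vec_of_complex (deriv g (complex_of_vec x) * complex_of_vec h)))\<bar>) has_integral r) S'"
    using hi unfolding det_complex_mult by simp
  moreover have "S' \<in> sets lebesgue" using S'b by simp
  ultimately have "G ` S' \<in> lmeasurable \<and> measure lebesgue (G ` S') = r"
    by (subst has_measure_differentiable_image) auto
  then have "emeasure lebesgue (G ` S') = ennreal r"
    by (auto simp: emeasure_eq_measure2)
  moreover have "G ` S' = complex_of_vec -` (g ` S)"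
  proof (intro equalityI subsetI)
    fix x assume "x \<in> complex_of_vec -` (g ` S)"
    then obtain z where z: "z \<in> S" "complex_of_vec x = g z" by auto
    then have "x = G (vec_of_complex z)" unfolding G_def by (metis comp_apply complex_of_vec_inverse vec_of_complex_inverse)
    then show "x \<in> G ` S'" using z by (auto simp: S'_def)
  qed (auto simp: G_def S'_def)
  moreover have gS: "g ` S \<in> sets borel" by (rule borel_image_inj_holomorphic[OF U g S(1,2)])
  ultimately have "emeasure lebesgue (complex_of_vec -` (g ` S)) = ennreal r" by simp
  moreover have "complex_of_vec -` (g ` S) \<in> sets borel"
    using measurable_sets[OF measurable_complex_of_vec gS] by simp
  ultimately have "emeasure lborel (g ` S) = ennreal r"
    using emeasure_lborel_complex_conv_vec[OF gS] by (simp add: emeasure_completion)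
  also have "\<dots> = (\<integral>\<^sup>+z. ennreal ((norm (deriv g z))\<^sup>2) * indicator S z \<partial>lborel)"
    unfolding r(2)[symmetric] by (intro nn_integral_cong) (simp add: dS indicator_def)
  finally show ?thesis .
qed

lemma nn_integral_image_inj_holomorphic:
  fixes g :: "complex \<Rightarrow> complex"
  assumes U: "open U" and g: "g holomorphic_on U" "inj_on g U"
    and S: "S \<in> sets borel" "S \<subseteq> U" "bounded S" and M: "\<And>z. z \<in> S \<Longrightarrow> norm (deriv g z) \<le> M"
    and f: "f \<in> borel_measurable borel"
  shows "(\<integral>\<^sup>+a. f a * indicator (g ` S) a \<partial>lborel) =
    (\<integral>\<^sup>+z. f (g z) * (ennreal ((norm (deriv g z))\<^sup>2) * indicator S z) \<partial>lborel)"
proof -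
  define g' where "g' = (\<lambda>z. if z \<in> U then g z else 0)"
  define d where "d = (\<lambda>z. ennreal ((norm (if z \<in> U then deriv g z else 0))\<^sup>2) * indicator S z)"
  have dS: "d z = ennreal ((norm (deriv g z))\<^sup>2) * indicator S z" for z
    using S by (auto simp: d_def indicator_def)
  have g'm [measurable]: "g' \<in> borel_measurable borel" unfolding g'_def
    by (intro borel_measurable_continuous_on_if continuous_on_const
        holomorphic_on_imp_continuous_on g) (use U in auto)
  have dm [measurable]: "d \<in> borel_measurable borel"
  proof -
    have "(\<lambda>z. if z \<in> U then deriv g z else 0) \<in> borel_measurable borel"
      by (intro borel_measurable_continuous_on_if continuous_on_const
          holomorphic_on_imp_continuous_on holomorphic_deriv g) (use U in auto)
    then show ?thesis unfolding d_def using S by measurable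
  qed
  have gS: "g ` S \<in> sets borel" by (rule borel_image_inj_holomorphic[OF U g S(1,2)])
  have "density lborel (indicator (g ` S)) = distr (density lborel d) borel g'"
  proof (rule measure_eqI)
    fix E assume "E \<in> sets (density lborel (indicator (g ` S)))"
    then have E [measurable]: "E \<in> sets borel" by simp
    let ?T = "S \<inter> g' -` E"
    have Tb: "?T \<in> sets borel" using S measurable_sets[OF g'm E] by auto
    have img: "g ` ?T = g ` S \<inter> E" using S by (auto simp: g'_def split: if_splits)
    have "emeasure (density lborel (indicator (g ` S))) E = emeasure lborel (g ` ?T)"
      using gS by (subst emeasure_density) (simp_all add: img indicator_inter_arith[symmetric])
    also have "\<dots> = (\<integral>\<^sup>+z. ennreal ((norm (deriv g z))\<^sup>2) * indicator ?T z \<partial>lborel)"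
      using S M by (intro emeasure_image_inj_holomorphic[OF U g Tb]) (auto intro: bounded_subset)
    also have "\<dots> = (\<integral>\<^sup>+z. d z * indicator (g' -` E) z \<partial>lborel)"
      by (intro nn_integral_cong) (auto simp: dS indicator_def)
    also have "\<dots> = emeasure (distr (density lborel d) borel g') E"
      using measurable_sets[OF g'm E] by (simp add: emeasure_distr emeasure_density)
    finally show "emeasure (density lborel (indicator (g ` S))) E = emeasure (distr (density lborel d) borel g') E" .
  qed simp
  then have "nn_integral (density lborel (indicator (g ` S))) f = nn_integral (distr (density lborel d) borel g') f"
    by simp
  also have "\<dots> = (\<integral>\<^sup>+z. d z * f (g' z) \<partial>lborel)"
    using f by (subst nn_integral_distr) (simp_all add: nn_integral_density)
  also have "\<dots> = (\<integral>\<^sup>+z. f (g z) * (ennreal ((norm (deriv g z))\<^sup>2) * indicator S z) \<partial>lborel)"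
    using S by (intro nn_integral_cong) (auto simp: dS g'_def indicator_def mult_ac)
  finally show ?thesis
    using f gS by (simp add: nn_integral_density mult_ac)
qed

lemma borel_measurable_poly [measurable]: "poly (p :: complex poly) \<in> borel_measurable borel"
  by (intro borel_measurable_continuous_onI continuous_on_poly continuous_on_id)

text \<open>For a value \<open>a\<close>, the roots of \<open>N - a q\<close> are the solutions of
  \<open>N / q = a\<close>, so averaging over \<open>a\<close> a count of these roots is a change
  of variables along the rational map \<open>N / q\<close>. Away from its critical points the map
  is locally injective, and countably many small open sets reduce the claim to the injective case.
  Multiple roots occur only for critical values, of which there are finitely many. The polynomial
  \<open>W\<close> is the numerator of the derivative; poles contribute nothing on the right
  because division by zero yields zero.\<close>

lemma nn_integral_roots_pencil:
  fixes N q :: "complex poly"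
  assumes deg: "degree q < degree N" and cop: "\<And>z. poly q z = 0 \<Longrightarrow> poly N z \<noteq> 0"
    and W: "W = pderiv N * q - N * pderiv q"
    and f [measurable]: "f \<in> borel_measurable borel" and B [measurable]: "B \<in> sets borel"
  shows "(\<integral>\<^sup>+a. f a * (\<Sum>z\<in>#proots (N - Polynomial.smult a q). indicator B z) \<partial>lborel) =
    (\<integral>\<^sup>+z. f (poly N z / poly q z) * (ennreal ((norm (poly W z / (poly q z)\<^sup>2))\<^sup>2) * indicator B z) \<partial>lborel)"
proof -
  define g where "g = (\<lambda>z. poly N z / poly q z)"
  define \<Omega> where "\<Omega> = {z. poly q z \<noteq> 0 \<and> poly W z \<noteq> 0}"
  have op: "open \<Omega>" unfolding \<Omega>_def by (intro open_Collect_conj open_Collect_neq continuous_intros)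
  have dg: "(g has_field_derivative poly W z / (poly q z)\<^sup>2) (at z)" if "poly q z \<noteq> 0" for z
    unfolding g_def using that
    by (auto intro!: derivative_eq_intros simp: W power2_eq_square mult_ac)
  have hol: "g holomorphic_on \<Omega>"
    unfolding g_def \<Omega>_def by (intro holomorphic_intros) auto
  have deriv_g: "deriv g z = poly W z / (poly q z)\<^sup>2" if "z \<in> \<Omega>" for z
    using that dg by (auto simp: \<Omega>_def intro!: DERIV_imp_deriv)
  (* Otherwise N divides N' q, hence N', which has smaller degree. *)
  have "W \<noteq> 0"
  proof
    assume "W = 0"
    then have eq: "pderiv N * q = N * pderiv q" by (simp add: W)
    have q0: "q \<noteq> 0"
    proof
      assume "q = 0"
      then have "poly N z \<noteq> 0" for z using cop by simp
      then have "constant (poly N)" using Fundamental_Theorem_Algebra.fundamental_theorem_of_algebra[of N] by (rule_tac ccontr) auto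
      then show False using deg \<open>q = 0\<close> by (simp add: constant_degree)
    qed
    have cN: "coprime N q"
    proof (rule ccontr)
      assume "\<not> coprime N q"
      then obtain d where d: "d dvd N" "d dvd q" "\<not> is_unit d" by (auto simp: coprime_def)
      with q0 have "degree d \<noteq> 0" by (metis is_unit_iff_degree dvd_0_left)
      then obtain z where "poly d z = 0"
        by (metis Fundamental_Theorem_Algebra.fundamental_theorem_of_algebra constant_degree)
      with d cop show False by (metis dvdE mult_zero_left poly_mult)
    qed
    have "N dvd pderiv N * q" using eq by simp
    then have "N dvd pderiv N" by (rule coprime_dvd_mult_left_iff[OF cN, THEN iffD1])
    moreover have "pderiv N \<noteq> 0" using deg by (auto simp: pderiv_eq_0_iff)
    ultimately have "degree N \<le> degree (pderiv N)" by (rule dvd_imp_degree_le)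
    then show False using deg by (simp add: degree_pderiv)
  qed
  (* Near a noncritical point the map is injective with bounded derivative on a small ball. *)
  have loc: "\<exists>V. z \<in> V \<and> open V \<and> V \<subseteq> \<Omega> \<and> inj_on g V \<and> bounded V \<and> (\<exists>M. \<forall>x\<in>V. norm (deriv g x) \<le> M)"
    if z: "z \<in> \<Omega>" for z
  proof -
    have "deriv g z \<noteq> 0" using z deriv_g by (auto simp: \<Omega>_def)
    then obtain r where r: "r > 0" "ball z r \<subseteq> \<Omega>" "inj_on g (ball z r)"
      using has_complex_derivative_locally_injective[OF hol z op] by metis
    have "cball z (r/2) \<subseteq> ball z r" using r by auto
    then have "continuous_on (cball z (r/2)) (deriv g)"
      using r by (intro holomorphic_on_imp_continuous_on holomorphic_on_subset[OF holomorphic_deriv[OF hol op]]) auto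
    then have "bounded (deriv g ` cball z (r/2))"
      by (intro compact_imp_bounded compact_continuous_image) auto
    then obtain M where "\<forall>x\<in>cball z (r/2). norm (deriv g x) \<le> M" unfolding bounded_iff by auto
    then have "\<forall>x\<in>ball z (r/2). norm (deriv g x) \<le> M" using ball_subset_cball by blast
    moreover have "ball z (r/2) \<subseteq> ball z r" using r by auto
    ultimately show ?thesis using r
      by (intro exI[of _ "ball z (r/2)"]) (auto intro: inj_on_subset)
  qed
  define F where "F = {V. open V \<and> V \<subseteq> \<Omega> \<and> inj_on g V \<and> bounded V \<and> (\<exists>M. \<forall>x\<in>V. norm (deriv g x) \<le> M)}"
  have UF: "\<Union>F = \<Omega>"
  proof (intro equalityI subsetI)
    fix z assume "z \<in> \<Omega>"
    from loc[OF this] obtain V where "z \<in> V" "V \<in> F" unfolding F_def by blast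
    then show "z \<in> \<Union>F" by blast
  qed (auto simp: F_def)
  have oF: "\<And>S. S \<in> F \<Longrightarrow> open S" by (simp add: F_def)
  obtain F' where F': "F' \<subseteq> F" "countable F'" "\<Union>F' = \<Union>F"
    using Lindelof[OF oF] by metis
  (* Adding the empty set makes the enumeration total even if the cover is finite or empty. *)
  define V where "V = from_nat_into (insert {} F')"
  have V: "V k \<in> F" for k
  proof -
    have "V k \<in> insert {} F'" unfolding V_def by (rule from_nat_into) simp
    moreover have "{} \<in> F" by (simp add: F_def)
    ultimately show ?thesis using F'(1) by auto
  qed
  have UV: "(\<Union>k. V k) = \<Omega>"
    using F' UF range_from_nat_into[of "insert {} F'"] by (auto simp: V_def)
  have Vm: "V k \<in> sets borel" for k using V[of k] by (auto simp: F_def)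
  define A where "A k = B \<inter> disjointed V k" for k
  have AV: "A k \<subseteq> V k" for k using disjointed_subset[of V k] by (auto simp: A_def)
  have Am [measurable]: "A k \<in> sets borel" for k
  proof -
    have "range V \<subseteq> sets borel" using Vm by blast
    then have "disjointed V k \<in> sets borel" using sets.range_disjointed_sets[of V borel] by blast
    then show ?thesis by (simp add: A_def)
  qed
  have disj: "disjoint_family A"
    using disjoint_family_disjointed[of V] by (auto simp: A_def disjoint_family_on_def)
  have UA: "(\<Union>k. A k) = B \<inter> \<Omega>" using UN_disjointed_eq[of V] UV by (auto simp: A_def)
  define G where "G z = f (g z) * ennreal ((norm (poly W z / (poly q z)\<^sup>2))\<^sup>2)" for z
  have gm [measurable]: "g \<in> borel_measurable borel" unfolding g_def by measurable
  have Gm [measurable]: "G \<in> borel_measurable borel" unfolding G_def by measurable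
  have "(\<integral>\<^sup>+z. f (poly N z / poly q z) * (ennreal ((norm (poly W z / (poly q z)\<^sup>2))\<^sup>2) * indicator B z) \<partial>lborel) =
    (\<integral>\<^sup>+z. G z * indicator (\<Union>k. A k) z \<partial>lborel)"
    unfolding UA by (intro nn_integral_cong) (auto simp: G_def g_def \<Omega>_def indicator_def)
  also have "\<dots> = (\<Sum>k. \<integral>\<^sup>+z. G z * indicator (A k) z \<partial>lborel)"
    by (subst nn_integral_suminf[symmetric])
       (auto intro!: nn_integral_cong simp: suminf_indicator[OF disj, symmetric] simp del: suminf_indicator)
  also have "\<dots> = (\<Sum>k. \<integral>\<^sup>+a. f a * indicator (g ` A k) a \<partial>lborel)"
  proof (rule suminf_cong)
    fix k
    have Vk: "open (V k)" "V k \<subseteq> \<Omega>" "inj_on g (V k)" "bounded (V k)" using V[of k] by (auto simp: F_def)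
    obtain M where M: "\<And>x. x \<in> V k \<Longrightarrow> norm (deriv g x) \<le> M" using V[of k] by (auto simp: F_def)
    have "(\<integral>\<^sup>+a. f a * indicator (g ` A k) a \<partial>lborel) =
      (\<integral>\<^sup>+z. f (g z) * (ennreal ((norm (deriv g z))\<^sup>2) * indicator (A k) z) \<partial>lborel)"
      using Vk M AV[of k] 
      by (intro nn_integral_image_inj_holomorphic[where U = "V k" and M = M])
         (auto intro: holomorphic_on_subset[OF hol] bounded_subset)
    also have "\<dots> = (\<integral>\<^sup>+z. G z * indicator (A k) z \<partial>lborel)"
      using AV[of k] Vk(2) by (intro nn_integral_cong) (auto simp: G_def indicator_def deriv_g)
    finally show "(\<integral>\<^sup>+z. G z * indicator (A k) z \<partial>lborel) = (\<integral>\<^sup>+a. f a * indicator (g ` A k) a \<partial>lborel)" ..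
  qed
  also have "\<dots> = (\<integral>\<^sup>+a. (\<Sum>k. f a * indicator (g ` A k) a) \<partial>lborel)"
  proof (rule nn_integral_suminf[symmetric])
    fix k
    have Vk: "open (V k)" "V k \<subseteq> \<Omega>" "inj_on g (V k)" using V[of k] by (auto simp: F_def)
    have "g ` A k \<in> sets borel"
      using Vk AV[of k] by (intro borel_image_inj_holomorphic[of "V k"] holomorphic_on_subset[OF hol]) auto
    then show "(\<lambda>a. f a * indicator (g ` A k) a) \<in> borel_measurable lborel" by simp
  qed
  also have "\<dots> = (\<integral>\<^sup>+a. f a * (\<Sum>z\<in>#proots (N - Polynomial.smult a q). indicator B z) \<partial>lborel)"
  proof (rule nn_integral_cong_AE)
    (* The critical values form a finite, hence null, set; for all other values the roots are
       simple. *)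
    let ?E = "g ` {z. poly W z = 0}"
    have "finite ?E" using \<open>W \<noteq> 0\<close> by (intro finite_imageI poly_roots_finite)
    then have "?E \<in> null_sets lborel" by (intro finite_imp_null_set_lborel)
    then have "AE a in lborel. a \<notin> ?E" by (rule AE_not_in)
    then show "AE a in lborel. (\<Sum>k. f a * indicator (g ` A k) a) =
        f a * (\<Sum>z\<in>#proots (N - Polynomial.smult a q). indicator B z)"
    proof eventually_elim
      fix a assume a: "a \<notin> ?E"
      let ?p = "N - Polynomial.smult a q"
      have "degree (Polynomial.smult a q) < degree N"
        using deg degree_smult_le[of a q] by linarith
      then have p0: "?p \<noteq> 0" by (auto)
      define R where "R = {z. poly ?p z = 0}"
      have finR: "finite R" unfolding R_def by (rule poly_roots_finite[OF p0])
      have R: "z \<in> R \<longleftrightarrow> poly q z \<noteq> 0 \<and> g z = a" for z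
        using cop[of z] by (auto simp: R_def g_def field_simps)
      have R\<Omega>: "R \<subseteq> \<Omega>" using a by (auto simp: R \<Omega>_def)
      have simple: "Polynomial.order z ?p = 1" if "z \<in> R" for z
      proof -
        have z: "poly q z \<noteq> 0" "a = g z" "poly W z \<noteq> 0" using that R R\<Omega> by (auto simp: \<Omega>_def)
        have "poly (pderiv ?p) z = poly W z / poly q z"
          using z by (simp add: pderiv_diff pderiv_smult W g_def field_simps)
        then have nz: "poly (pderiv ?p) z \<noteq> 0" using z by simp
        have "poly ?p z = 0" using that by (simp add: R_def)
        then have "Polynomial.order z ?p = Suc (Polynomial.order z (pderiv ?p))" by (rule order_pderiv[OF p0])
        moreover have "Polynomial.order z (pderiv ?p) = 0" using nz by (rule order_0I)
        ultimately show ?thesis by simp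
      qed
      have "proots ?p = mset_set R"
      proof (rule multiset_eqI)
        fix z
        show "count (proots ?p) z = count (mset_set R) z"
          using simple[of z] p0 finR by (cases "z \<in> R") (auto simp: R_def order_0I)
      qed
      then have "(\<Sum>z\<in>#proots ?p. indicator B z :: ennreal) = (\<Sum>z\<in>R. indicator B z)"
        by (simp add: sum_unfold_sum_mset)
      also have "\<dots> = (\<Sum>z\<in>R. \<Sum>k. indicator (A k) z)"
        unfolding suminf_indicator[OF disj] UA
        using R\<Omega> by (intro sum.cong) (auto simp: indicator_def)
      also have "\<dots> = (\<Sum>k. \<Sum>z\<in>R. indicator (A k) z)"
        by (rule suminf_sum[symmetric]) auto
      also have "\<dots> = (\<Sum>k. indicator (g ` A k) a)"
      proof (rule suminf_cong)
        fix k
        have Vk: "V k \<subseteq> \<Omega>" "inj_on g (V k)" using V[of k] by (auto simp: F_def)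
        show "(\<Sum>z\<in>R. indicator (A k) z :: ennreal) = indicator (g ` A k) a"
        proof (cases "a \<in> g ` A k")
          case True
          then obtain z where z: "z \<in> A k" "a = g z" by auto
          have "R \<inter> A k = {z}"
            using z AV[of k] Vk(1) inj_onD[OF inj_on_subset[OF Vk(2) AV]]
            by (auto simp: R \<Omega>_def)
          moreover have "(\<Sum>z\<in>R. indicator (A k) z :: ennreal) = (\<Sum>z\<in>R \<inter> A k. 1)"
            using finR by (simp add: indicator_def sum.If_cases)
          ultimately show ?thesis using True by simp
        next
          case False
          then have "R \<inter> A k = {}" by (auto simp: R)
          moreover have "(\<Sum>z\<in>R. indicator (A k) z :: ennreal) = (\<Sum>z\<in>R \<inter> A k. 1)"
            using finR by (simp add: indicator_def sum.If_cases)
          ultimately show ?thesis using False by simp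
        qed
      qed
      finally show "(\<Sum>k. f a * indicator (g ` A k) a) = f a * (\<Sum>z\<in>#proots ?p. indicator B z)"
        by simp
    qed
  qed
  finally show ?thesis ..
qed

section \<open>Radial integrals and the Poisson distribution function\<close>

text \<open>A disc of radius \<open>sqrt a\<close> has area \<open>pi a\<close>, so the squared
  modulus is distributed like \<open>pi\<close> times Lebesgue measure on the half-line.\<close>

lemma distr_norm_power2:
  "distr lborel borel (\<lambda>z::complex. (norm z)\<^sup>2) = density lborel (\<lambda>s. ennreal pi * indicator {0..} s)"
proof (rule measure_eqI_generator_eq[where E = "range (\<lambda>a::real. {..a})" and \<Omega> = UNIV and A = "\<lambda>i. {..real i}"])
  show "Int_stable (range (\<lambda>a::real. {..a}))"
    by (auto simp: Int_stable_def intro!: image_eqI[where x = "min _ _"])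
  fix X :: "real set" assume "X \<in> range (\<lambda>a. {..a})"
  then obtain a where X: "X = {..a}" by auto
  have eq: "(\<lambda>z::complex. (norm z)\<^sup>2) -` {..a} = (if a \<ge> 0 then cball 0 (sqrt a) else {})"
  proof -
    have "(norm z)\<^sup>2 \<le> a \<longleftrightarrow> a \<ge> 0 \<and> norm z \<le> sqrt a" for z :: complex
    proof (cases "a \<ge> 0")
      case True
      have "norm z \<le> sqrt a \<longleftrightarrow> sqrt ((norm z)\<^sup>2) \<le> sqrt a" by simp
      also have "\<dots> \<longleftrightarrow> (norm z)\<^sup>2 \<le> a" by (rule real_sqrt_le_iff)
      finally show ?thesis using True by simp
    next
      case False
      then show ?thesis using zero_le_power2[of "norm z"] by linarith
    qed
    then show ?thesis by auto
  qed
  have "emeasure (distr lborel borel (\<lambda>z::complex. (norm z)\<^sup>2)) X = (if a \<ge> 0 then ennreal (pi * a) else 0)"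
    unfolding X by (subst emeasure_distr) (auto simp: eq emeasure_cball unit_ball_vol_2)
  moreover have "emeasure (density lborel (\<lambda>s. ennreal pi * indicator {0..} s)) X = 
      ennreal pi * emeasure lborel ({0..} \<inter> {..a})"
    unfolding X by (subst emeasure_density) (auto simp: mult.assoc nn_integral_cmult indicator_inter_arith[symmetric])
  moreover have "{0..} \<inter> {..a} = {0..a}" by auto
  ultimately show "emeasure (distr lborel borel (\<lambda>z::complex. (norm z)\<^sup>2)) X = emeasure (density lborel (\<lambda>s. ennreal pi * indicator {0..} s)) X"
    by (auto simp: ennreal_mult)
next
  show "sets (distr lborel borel (\<lambda>z::complex. (norm z)\<^sup>2)) = sigma_sets UNIV (range (\<lambda>a::real. {..a}))"
    by (simp add: borel_eq_atMost)
  show "sets (density lborel (\<lambda>s. ennreal pi * indicator {0..} s)) = sigma_sets UNIV (range (\<lambda>a::real. {..a}))"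
    by (simp add: borel_eq_atMost)
  show "(\<Union>i. {..real i}) = UNIV" using real_arch_simple by auto
  fix i
  have "(\<lambda>z::complex. (norm z)\<^sup>2) -` {..real i} \<subseteq> cball 0 (sqrt (real i))"
    by (auto simp: real_le_rsqrt)
  then have "emeasure lborel ((\<lambda>z::complex. (norm z)\<^sup>2) -` {..real i}) \<le> emeasure lborel (cball (0::complex) (sqrt (real i)))"
    by (intro emeasure_mono) auto
  also have "\<dots> < \<infinity>" by (simp add: emeasure_cball)
  finally show "emeasure (distr lborel borel (\<lambda>z::complex. (norm z)\<^sup>2)) {..real i} \<noteq> \<infinity>"
    by (subst emeasure_distr) auto
qed auto

lemma nn_integral_radial:
  assumes [measurable]: "h \<in> borel_measurable borel"
  shows "(\<integral>\<^sup>+(z::complex). h ((norm z)\<^sup>2) \<partial>lborel) = ennreal pi * (\<integral>\<^sup>+s. h s * indicator {0..} s \<partial>lborel)"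
proof -
  have "(\<integral>\<^sup>+(z::complex). h ((norm z)\<^sup>2) \<partial>lborel) = nn_integral (distr lborel borel (\<lambda>z::complex. (norm z)\<^sup>2)) h"
    by (subst nn_integral_distr) auto
  also have "\<dots> = (\<integral>\<^sup>+s. ennreal pi * (h s * indicator {0..} s) \<partial>lborel)"
    unfolding distr_norm_power2 by (subst nn_integral_density) (auto simp: mult_ac)
  finally show ?thesis by (simp add: nn_integral_cmult)
qed

text \<open>The probability that a Poisson variable of mean \<open>x\<close> is less than
  \<open>n\<close>. As a function of \<open>x\<close> it is the radial profile of the mean
  spectral density.\<close>

definition poisson_cdf :: "nat \<Rightarrow> real \<Rightarrow> real" where
  "poisson_cdf n x = exp (- x) * (\<Sum>k<n. x ^ k / fact k)"

lemma poisson_cdf_Suc: "poisson_cdf (Suc n) x = poisson_cdf n x + exp (- x) * x ^ n / fact n"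
  by (simp add: poisson_cdf_def algebra_simps)

lemma poisson_cdf_nonneg: "x \<ge> 0 \<Longrightarrow> poisson_cdf n x \<ge> 0"
  by (auto simp: poisson_cdf_def intro!: mult_nonneg_nonneg sum_nonneg)

lemma poisson_cdf_le_1: "x \<ge> 0 \<Longrightarrow> poisson_cdf n x \<le> 1"
proof -
  assume x: "x \<ge> 0"
  have "(\<Sum>k<n. x ^ k / fact k) \<le> (\<Sum>k. x ^ k / fact k)"
    using x summable_exp_generic[of x] by (intro sum_le_suminf) (auto simp: divide_inverse mult.commute)
  also have "\<dots> = exp x" by (simp add: exp_def divide_inverse mult.commute)
  finally have "poisson_cdf n x \<le> exp (- x) * exp x" unfolding poisson_cdf_def by (intro mult_left_mono) auto
  then show ?thesis by (simp add: exp_minus)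
qed

lemma poisson_cdf_measurable [measurable]: "poisson_cdf n \<in> borel_measurable borel"
  unfolding poisson_cdf_def by measurable

lemma mult_Suc_div_fact_Suc: "real (Suc m) * (y / fact (Suc m)) = y / fact m"
  unfolding fact_Suc using of_nat_neq_0[of m] by (simp del: of_nat_Suc)

text \<open>The derivative of each term cancels the previous one, and only the last
  survives.\<close>

lemma DERIV_poisson_cdf:
  "((\<lambda>x. poisson_cdf (Suc n) x) has_real_derivative - (exp (- x) * x ^ n / fact n)) (at x)"
proof (induction n)
  case 0
  show ?case by (auto simp: poisson_cdf_def intro!: derivative_eq_intros)
next
  case (Suc n)
  have "((\<lambda>x. exp (- x) * x ^ Suc n) has_real_derivative
      (real (Suc n) * (exp (- x) * x ^ n) - exp (- x) * x ^ Suc n)) (at x)"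
    by (rule derivative_eq_intros refl)+ (simp add: algebra_simps)
  from DERIV_cdivide[OF this, of "fact (Suc n)"]
  have "((\<lambda>x. exp (- x) * x ^ Suc n / fact (Suc n)) has_real_derivative
      real (Suc n) * ((exp (- x) * x ^ n) / fact (Suc n)) - exp (- x) * x ^ Suc n / fact (Suc n)) (at x)"
    by (simp only: diff_divide_distrib times_divide_eq_right)
  then have "((\<lambda>x. exp (- x) * x ^ Suc n / fact (Suc n)) has_real_derivative 
      (exp (- x) * x ^ n / fact n) - exp (- x) * x ^ Suc n / fact (Suc n)) (at x)"
    unfolding mult_Suc_div_fact_Suc by simp
  from DERIV_add[OF Suc this] show ?case by (subst poisson_cdf_Suc[of "Suc n", abs_def]) simp
qed

text \<open>An antiderivative of \<open>poisson_cdf n\<close>, found by integration by parts: the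
  remaining integrand is the derivative of \<open>- n * poisson_cdf (Suc n)\<close>. It runs from
  0 to \<open>n\<close>.\<close>

definition poisson_cdf_int :: "nat \<Rightarrow> real \<Rightarrow> real" where
  "poisson_cdf_int n x = x * poisson_cdf n x + real n * (1 - poisson_cdf (Suc n) x)"

lemma DERIV_poisson_cdf_int:
  assumes "n > 0"
  shows "(poisson_cdf_int n has_real_derivative poisson_cdf n x) (at x)"
proof -
  obtain m where n: "n = Suc m" using assms by (cases n) auto
  have "((\<lambda>x. x * poisson_cdf (Suc m) x + real (Suc m) * (1 - poisson_cdf (Suc (Suc m)) x)) has_real_derivative poisson_cdf (Suc m) x) (at x)"
    using mult_Suc_div_fact_Suc[of m "exp (- x) * x ^ Suc m"]
    by (rule_tac derivative_eq_intros DERIV_poisson_cdf refl)+ (simp del: fact_Suc add: algebra_simps)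
  then show ?thesis by (simp add: n poisson_cdf_int_def[abs_def])
qed

lemma poisson_cdf_int_0: "n > 0 \<Longrightarrow> poisson_cdf_int n 0 = 0"
  by (cases n) (simp_all add: poisson_cdf_int_def poisson_cdf_def sum.lessThan_Suc_shift del: sum.lessThan_Suc)

lemma poisson_cdf_int_at_top:
  assumes "n > 0" shows "(poisson_cdf_int n \<longlongrightarrow> real n) at_top"
proof -
  have e: "((\<lambda>x::real. exp (- x) * x ^ k) \<longlongrightarrow> 0) at_top" for k
    by real_asymp
  have p: "((\<lambda>x. poisson_cdf m x) \<longlongrightarrow> 0) at_top" for m
  proof -
    have "((\<lambda>x::real. \<Sum>k<m. (1 / fact k) * (exp (- x) * x ^ k)) \<longlongrightarrow> (\<Sum>k<m. (1 / fact k) * 0)) at_top"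
      by (intro tendsto_sum tendsto_mult_left e)
    then show ?thesis by (simp add: poisson_cdf_def sum_distrib_left)
  qed
  have "((\<lambda>x. x * poisson_cdf n x) \<longlongrightarrow> 0) at_top"
  proof -
    have eq: "x * poisson_cdf n x = (\<Sum>k<n. (1 / fact k) * (exp (- x) * x ^ Suc k))" for x
      unfolding poisson_cdf_def sum_distrib_left by (rule sum.cong) (simp_all add: field_simps)
    have "((\<lambda>x::real. \<Sum>k<n. (1 / fact k) * (exp (- x) * x ^ Suc k)) \<longlongrightarrow> (\<Sum>k<n. (1 / fact k) * 0)) at_top"
      by (intro tendsto_sum tendsto_mult_left e)
    then show ?thesis unfolding eq by (simp only: mult_zero_right sum.neutral_const)
  qed
  then have "((\<lambda>x. x * poisson_cdf n x + real n * (1 - poisson_cdf (Suc n) x)) \<longlongrightarrow> 0 + real n * (1 - 0)) at_top"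
    by (intro tendsto_intros p)
  then show ?thesis by (simp add: poisson_cdf_int_def[abs_def])
qed

lemma nn_integral_poisson_cdf_Icc:
  assumes "n > 0" "0 \<le> a" "a \<le> b"
  shows "(\<integral>\<^sup>+x. ennreal (poisson_cdf n x) * indicator {a..b} x \<partial>lborel) = ennreal (poisson_cdf_int n b - poisson_cdf_int n a)"
  using assms by (intro nn_integral_FTC_Icc) (auto intro: has_field_derivative_at_within[OF DERIV_poisson_cdf_int] poisson_cdf_nonneg)

lemma nn_integral_poisson_cdf_atLeast:
  assumes "n > 0" "0 \<le> a"
  shows "(\<integral>\<^sup>+x. ennreal (poisson_cdf n x) * indicator {a..} x \<partial>lborel) = ennreal (real n - poisson_cdf_int n a)"
  using assms by (intro nn_integral_FTC_atLeast) (auto intro: DERIV_poisson_cdf_int poisson_cdf_nonneg poisson_cdf_int_at_top)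

lemma poisson_cdf_int_eq:
  assumes "n > 0"
  shows "real n - poisson_cdf_int n x = (real n - x) * poisson_cdf n x + real n * (exp (- x) * x ^ n / fact n)"
  by (simp add: poisson_cdf_int_def poisson_cdf_Suc algebra_simps)

lemma exp_ge_power_div_fact: "x \<ge> 0 \<Longrightarrow> x ^ n / fact n \<le> exp (x::real)"
proof -
  assume x: "x \<ge> 0"
  have "(\<Sum>k\<in>{n}. x ^ k / fact k) \<le> (\<Sum>k. x ^ k / fact k)"
    using x summable_exp_generic[of x] by (intro sum_le_suminf) (auto simp: divide_inverse mult.commute)
  then show ?thesis by (simp add: exp_def divide_inverse mult.commute)
qed

section \<open>Product Lebesgue measure and additive bijections\<close>

text \<open>Matrices are functions on a finite set of index pairs, and this is Lebesgue measure on
  them.\<close>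

abbreviation leb :: "'i set \<Rightarrow> ('i \<Rightarrow> complex) measure" where
  "leb I \<equiv> PiM I (\<lambda>_. lborel)"

interpretation lebesgue_product: product_sigma_finite "\<lambda>_::'i. lborel :: complex measure" ..

lemma distr_leb_componentwise:
  assumes I: "finite I" and \<phi>m: "\<And>i. i \<in> I \<Longrightarrow> \<phi> i \<in> borel_measurable borel"
    and \<phi>: "\<And>i. i \<in> I \<Longrightarrow> distr lborel borel (\<phi> i) = (lborel :: complex measure)"
  shows "distr (leb I) (leb I) (\<lambda>x. \<lambda>i\<in>I. \<phi> i (x i)) = leb I"
proof (rule lebesgue_product.PiM_eqI[OF I])
  have m: "(\<lambda>x. \<lambda>i\<in>I. \<phi> i (x i)) \<in> leb I \<rightarrow>\<^sub>M leb I"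
    using \<phi>m by (intro measurable_restrict measurable_compose[OF measurable_component_singleton]) auto
  fix A :: "'a \<Rightarrow> complex set" assume A: "\<And>i. i \<in> I \<Longrightarrow> A i \<in> sets lborel"
  have "(\<lambda>x. \<lambda>i\<in>I. \<phi> i (x i)) -` Pi\<^sub>E I A \<inter> space (leb I) = Pi\<^sub>E I (\<lambda>i. \<phi> i -` A i)"
    by (auto simp: space_PiM PiE_iff)
  then have "emeasure (distr (leb I) (leb I) (\<lambda>x. \<lambda>i\<in>I. \<phi> i (x i))) (Pi\<^sub>E I A) = 
      emeasure (leb I) (Pi\<^sub>E I (\<lambda>i. \<phi> i -` A i))"
    using m A I by (subst emeasure_distr) (auto intro!: sets_PiM_I_finite)
  also have "\<dots> = (\<Prod>i\<in>I. emeasure lborel (\<phi> i -` A i))"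
    using I A measurable_sets[OF \<phi>m] by (intro lebesgue_product.emeasure_PiM) auto
  also have "\<dots> = (\<Prod>i\<in>I. emeasure lborel (A i))"
  proof (rule prod.cong[OF refl])
    fix i assume i: "i \<in> I"
    have "emeasure (distr lborel borel (\<phi> i)) (A i) = emeasure lborel (\<phi> i -` A i)"
      using i A \<phi>m by (subst emeasure_distr) auto
    then show "emeasure lborel (\<phi> i -` A i) = emeasure lborel (A i)" by (simp add: \<phi>[OF i])
  qed
  finally show "emeasure (distr (leb I) (leb I) (\<lambda>x. \<lambda>i\<in>I. \<phi> i (x i))) (Pi\<^sub>E I A) = (\<Prod>i\<in>I. emeasure lborel (A i))" .
qed simp

lemma distr_lborel_translate: "distr lborel borel (\<lambda>z. z + c) = (lborel :: complex measure)"
  using lborel_affine[of 1 c] by (simp add: density_1 add.commute)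

lemma distr_lborel_reflect: "distr lborel borel (\<lambda>z. c - z) = (lborel :: complex measure)"
  using lborel_affine[of "-1" c] by (simp add: density_1)

lemma measurable_leb_componentwise:
  assumes "\<And>i. i \<in> I \<Longrightarrow> \<phi> i \<in> borel_measurable borel"
  shows "(\<lambda>x. \<lambda>i\<in>I. \<phi> i (x i)) \<in> leb I \<rightarrow>\<^sub>M leb I"
  using assms by (intro measurable_restrict measurable_compose[OF measurable_component_singleton]) auto

lemma nn_integral_leb_componentwise:
  assumes I: "finite I" and f: "f \<in> borel_measurable (leb I)" and \<phi>m: "\<And>i. i \<in> I \<Longrightarrow> \<phi> i \<in> borel_measurable borel"
    and \<phi>: "\<And>i. i \<in> I \<Longrightarrow> distr lborel borel (\<phi> i) = (lborel :: complex measure)"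
  shows "(\<integral>\<^sup>+x. f (\<lambda>i\<in>I. \<phi> i (x i)) \<partial>leb I) = (\<integral>\<^sup>+x. f x \<partial>leb I)"
proof -
  have "(\<integral>\<^sup>+x. f x \<partial>leb I) = nn_integral (distr (leb I) (leb I) (\<lambda>x. \<lambda>i\<in>I. \<phi> i (x i))) f"
    using distr_leb_componentwise[OF I, of \<phi>] \<phi>m \<phi> by simp
  also have "\<dots> = (\<integral>\<^sup>+x. f (\<lambda>i\<in>I. \<phi> i (x i)) \<partial>leb I)"
    using f by (intro nn_integral_distr measurable_leb_componentwise \<phi>m) auto
  finally show ?thesis ..
qed

lemma nn_integral_leb_translate:
  assumes I: "finite I" and f: "f \<in> borel_measurable (leb I)"
  shows "(\<integral>\<^sup>+x. f (\<lambda>i\<in>I. x i + c i) \<partial>leb I) = (\<integral>\<^sup>+x. f x \<partial>leb I)"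
  using nn_integral_leb_componentwise[OF I f, of "\<lambda>i z. z + c i"]
  by (simp add: distr_lborel_translate)

lemma nn_integral_leb_reflect:
  assumes I: "finite I" and f: "f \<in> borel_measurable (leb I)"
  shows "(\<integral>\<^sup>+x. f (\<lambda>i\<in>I. c i - x i) \<partial>leb I) = (\<integral>\<^sup>+x. f x \<partial>leb I)"
  using nn_integral_leb_componentwise[OF I f, of "\<lambda>i z. c i - z"]
  by (simp add: distr_lborel_reflect)

lemma nn_integral_gauss:
  assumes "t > 0" shows "(\<integral>\<^sup>+(z::complex). ennreal (exp (- (t * (norm z)\<^sup>2))) \<partial>lborel) = ennreal (pi / t)"
proof -
  have "(\<integral>\<^sup>+s. ennreal (exp (- t * s)) * indicator {0..} s \<partial>lborel) = ennreal (0 - (- exp (- t * 0) / t))"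
  proof (rule nn_integral_FTC_atLeast)
    show "((\<lambda>s. - exp (- t * s) / t) \<longlongrightarrow> 0) at_top" using assms by real_asymp
    show "((\<lambda>s. - exp (- t * s) / t) has_real_derivative exp (- t * s)) (at s)" for s
      using assms by (auto intro!: derivative_eq_intros)
  qed auto
  then show ?thesis using assms
    by (subst nn_integral_radial[of "\<lambda>s. ennreal (exp (- (t * s)))"]) (auto simp: ennreal_mult[symmetric])
qed

definition gauss_weight :: "real \<Rightarrow> 'i set \<Rightarrow> ('i \<Rightarrow> complex) \<Rightarrow> ennreal" where
  "gauss_weight t I x = ennreal (exp (- (t * (\<Sum>i\<in>I. (norm (x i))\<^sup>2))))"

lemma gauss_weight_measurable [measurable]: "gauss_weight t I \<in> borel_measurable (leb I)"
  unfolding gauss_weight_def by measurable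

lemma gauss_weight_prod: 
  assumes "finite I" shows "gauss_weight t I x = (\<Prod>i\<in>I. ennreal (exp (- (t * (norm (x i))\<^sup>2))))"
  using assms by (simp add: gauss_weight_def exp_sum[symmetric] sum_distrib_left prod_ennreal sum_negf[symmetric])

lemma nn_integral_gauss_weight:
  assumes I: "finite I" and t: "t > 0"
  shows "(\<integral>\<^sup>+x. gauss_weight t I x \<partial>leb I) = ennreal ((pi / t) ^ card I)"
  unfolding gauss_weight_prod[OF I]
  using t by (subst lebesgue_product.product_nn_integral_prod[OF I])
    (auto simp: nn_integral_gauss ennreal_power)

text \<open>Uniqueness of Haar measure, by the classical double integral: in the integral of
  \<open>f x * g (T u)\<close> one replaces \<open>x\<close> by \<open>x + T u\<close>, and then
  shifts \<open>u\<close> by a preimage of \<open>- x\<close>; the factor \<open>f\<close> then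
  depends on \<open>u\<close> alone. An even Gaussian \<open>g\<close> has a known positive
  integral and thus determines the constant. No formula for the Jacobian of \<open>T\<close>
  enters, which is what allows constants to remain unevaluated later.\<close>

lemma nn_integral_additive_bijection:
  fixes T :: "('i \<Rightarrow> complex) \<Rightarrow> ('i \<Rightarrow> complex)"
  assumes I: "finite I" and T [measurable]: "T \<in> leb I \<rightarrow>\<^sub>M leb I"
    and add: "\<And>x y. x \<in> space (leb I) \<Longrightarrow> y \<in> space (leb I) \<Longrightarrow> 
        T (\<lambda>i\<in>I. x i + y i) = (\<lambda>i\<in>I. T x i + T y i)"
    and surj: "\<And>y. y \<in> space (leb I) \<Longrightarrow> \<exists>z\<in>space (leb I). T z = y"
    and f [measurable]: "f \<in> borel_measurable (leb I)"
  shows "(\<integral>\<^sup>+x. f (T x) \<partial>leb I) = 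
     (\<integral>\<^sup>+x. gauss_weight 1 I (T x) \<partial>leb I) / ennreal (pi ^ card I) * (\<integral>\<^sup>+x. f x \<partial>leb I)"
proof -
  let ?\<mu> = "leb I" and ?g = "gauss_weight 1 I"
  interpret \<mu>: sigma_finite_measure ?\<mu> by (rule lebesgue_product.sigma_finite[OF I])
  interpret P: pair_sigma_finite ?\<mu> ?\<mu> ..
  have Ti: "(\<lambda>z. T (fst z) i) \<in> borel_measurable (?\<mu> \<Otimes>\<^sub>M ?\<mu>)" if "i \<in> I" for i
    using measurable_compose[OF measurable_compose[OF measurable_fst T] measurable_component_singleton[OF that]] by simp
  have pm' [measurable]: "(\<lambda>z. \<lambda>i\<in>I. snd z i + T (fst z) i) \<in> ?\<mu> \<Otimes>\<^sub>M ?\<mu> \<rightarrow>\<^sub>M ?\<mu>"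
    "(\<lambda>z. \<lambda>i\<in>I. T (fst z) i - snd z i) \<in> ?\<mu> \<Otimes>\<^sub>M ?\<mu> \<rightarrow>\<^sub>M ?\<mu>"
    using Ti by (auto intro!: measurable_restrict borel_measurable_add borel_measurable_diff
        measurable_compose[OF measurable_snd measurable_component_singleton])
  have tr [measurable]: "(\<lambda>x. \<lambda>i\<in>I. x i + c i) \<in> ?\<mu> \<rightarrow>\<^sub>M ?\<mu>" for c
    by (rule measurable_leb_componentwise) auto
  have re [measurable]: "(\<lambda>x. \<lambda>i\<in>I. c i - x i) \<in> ?\<mu> \<rightarrow>\<^sub>M ?\<mu>" for c
    by (rule measurable_leb_componentwise) auto
  have Tsp: "T u \<in> space ?\<mu>" if "u \<in> space ?\<mu>" for u using that T by (rule measurable_space[rotated])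
  have "(\<integral>\<^sup>+x. f x \<partial>?\<mu>) * (\<integral>\<^sup>+u. ?g (T u) \<partial>?\<mu>) = (\<integral>\<^sup>+u. (\<integral>\<^sup>+x. f x \<partial>?\<mu>) * ?g (T u) \<partial>?\<mu>)"
    by (simp add: nn_integral_cmult)
  also have "\<dots> = (\<integral>\<^sup>+u. (\<integral>\<^sup>+x. f (\<lambda>i\<in>I. x i + T u i) * ?g (T u) \<partial>?\<mu>) \<partial>?\<mu>)"
  proof (rule nn_integral_cong)
    fix u
    have "(\<integral>\<^sup>+x. f x \<partial>?\<mu>) = (\<integral>\<^sup>+x. f (\<lambda>i\<in>I. x i + T u i) \<partial>?\<mu>)"
      by (rule nn_integral_leb_translate[OF I f, symmetric])
    then show "(\<integral>\<^sup>+x. f x \<partial>?\<mu>) * ?g (T u) = (\<integral>\<^sup>+x. f (\<lambda>i\<in>I. x i + T u i) * ?g (T u) \<partial>?\<mu>)"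
      by (simp add: nn_integral_multc)
  qed
  also have "\<dots> = (\<integral>\<^sup>+x. (\<integral>\<^sup>+u. f (\<lambda>i\<in>I. x i + T u i) * ?g (T u) \<partial>?\<mu>) \<partial>?\<mu>)"
    by (rule P.Fubini'[symmetric]) (simp add: split_beta)
  also have "\<dots> = (\<integral>\<^sup>+x. (\<integral>\<^sup>+u. f (T u) * ?g (\<lambda>i\<in>I. T u i - x i) \<partial>?\<mu>) \<partial>?\<mu>)"
  proof (rule nn_integral_cong)
    fix x assume x: "x \<in> space ?\<mu>"
    have "(\<lambda>i\<in>I. - x i) \<in> space ?\<mu>" by (simp add: space_PiM)
    then obtain z where z: "z \<in> space ?\<mu>" "T z = (\<lambda>i\<in>I. - x i)" using surj by blast
    have mm: "(\<lambda>u. f (\<lambda>i\<in>I. x i + T u i) * ?g (T u)) \<in> borel_measurable ?\<mu>"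
      using tr[of x, THEN measurable_compose[OF T]] f by (simp add: add.commute)
    have "(\<integral>\<^sup>+u. f (\<lambda>i\<in>I. x i + T u i) * ?g (T u) \<partial>?\<mu>) =
      (\<integral>\<^sup>+u. f (\<lambda>i\<in>I. x i + T (\<lambda>i\<in>I. u i + z i) i) * ?g (T (\<lambda>i\<in>I. u i + z i)) \<partial>?\<mu>)"
      by (rule nn_integral_leb_translate[OF I mm, symmetric])
    also have "\<dots> = (\<integral>\<^sup>+u. f (T u) * ?g (\<lambda>i\<in>I. T u i - x i) \<partial>?\<mu>)"
    proof (rule nn_integral_cong)
      fix u assume u: "u \<in> space ?\<mu>"
      have eq: "T (\<lambda>i\<in>I. u i + z i) = (\<lambda>i\<in>I. T u i - x i)"
        by (subst add[OF u z(1)]) (auto simp: z(2))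
      moreover have "(\<lambda>i\<in>I. x i + (\<lambda>i\<in>I. T u i - x i) i) = T u"
        using Tsp[OF u] by (auto simp: space_PiM PiE_def extensional_def fun_eq_iff)
      ultimately show "f (\<lambda>i\<in>I. x i + T (\<lambda>i\<in>I. u i + z i) i) * ?g (T (\<lambda>i\<in>I. u i + z i)) =
          f (T u) * ?g (\<lambda>i\<in>I. T u i - x i)" by (simp only:)
    qed
    finally show "(\<integral>\<^sup>+u. f (\<lambda>i\<in>I. x i + T u i) * ?g (T u) \<partial>?\<mu>) = (\<integral>\<^sup>+u. f (T u) * ?g (\<lambda>i\<in>I. T u i - x i) \<partial>?\<mu>)" .
  qed
  also have "\<dots> = (\<integral>\<^sup>+u. (\<integral>\<^sup>+x. f (T u) * ?g (\<lambda>i\<in>I. T u i - x i) \<partial>?\<mu>) \<partial>?\<mu>)"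
    by (rule P.Fubini') (simp add: split_beta)
  also have "\<dots> = (\<integral>\<^sup>+u. f (T u) * (\<integral>\<^sup>+x. ?g x \<partial>?\<mu>) \<partial>?\<mu>)"
  proof (rule nn_integral_cong)
    fix u
    have "(\<integral>\<^sup>+x. ?g (\<lambda>i\<in>I. T u i - x i) \<partial>?\<mu>) = (\<integral>\<^sup>+x. ?g x \<partial>?\<mu>)"
      by (rule nn_integral_leb_reflect[OF I]) simp
    then show "(\<integral>\<^sup>+x. f (T u) * ?g (\<lambda>i\<in>I. T u i - x i) \<partial>?\<mu>) = f (T u) * (\<integral>\<^sup>+x. ?g x \<partial>?\<mu>)"
      by (simp add: nn_integral_cmult)
  qed
  also have "\<dots> = (\<integral>\<^sup>+u. f (T u) \<partial>?\<mu>) * ennreal (pi ^ card I)"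
    by (simp add: nn_integral_multc nn_integral_gauss_weight[OF I])
  finally have eq: "(\<integral>\<^sup>+x. f x \<partial>?\<mu>) * (\<integral>\<^sup>+u. ?g (T u) \<partial>?\<mu>) = (\<integral>\<^sup>+u. f (T u) \<partial>?\<mu>) * ennreal (pi ^ card I)" .
  have "(\<integral>\<^sup>+u. f (T u) \<partial>?\<mu>) = ((\<integral>\<^sup>+x. f x \<partial>?\<mu>) * (\<integral>\<^sup>+u. ?g (T u) \<partial>?\<mu>)) / ennreal (pi ^ card I)"
    unfolding eq by (simp add: ennreal_mult_divide_eq)
  then show ?thesis by (simp add: ennreal_times_divide mult.commute)
qed

section \<open>Zero sets of polynomial functions\<close>

text \<open>Functions that are polynomial in finitely many complex coordinates, as a closure under
  the ring operations.\<close>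

inductive poly_fun :: "'i set \<Rightarrow> (('i \<Rightarrow> complex) \<Rightarrow> complex) \<Rightarrow> bool" for I where
  const: "poly_fun I (\<lambda>_. c)"
| coord: "i \<in> I \<Longrightarrow> poly_fun I (\<lambda>x. x i)"
| add: "poly_fun I f \<Longrightarrow> poly_fun I g \<Longrightarrow> poly_fun I (\<lambda>x. f x + g x)"
| mult: "poly_fun I f \<Longrightarrow> poly_fun I g \<Longrightarrow> poly_fun I (\<lambda>x. f x * g x)"

lemma poly_fun_measurable: "poly_fun I f \<Longrightarrow> f \<in> borel_measurable (leb I)"
proof (induction rule: poly_fun.induct)
  case (coord i)
  then show ?case using measurable_component_singleton[of i I "\<lambda>_. lborel"] by simp
qed auto

lemma poly_fun_sum: "finite A \<Longrightarrow> (\<And>a. a \<in> A \<Longrightarrow> poly_fun I (f a)) \<Longrightarrow> poly_fun I (\<lambda>x. \<Sum>a\<in>A. f a x)"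
  by (induction A rule: finite_induct) (auto intro: poly_fun.intros)

lemma poly_fun_prod: "finite A \<Longrightarrow> (\<And>a. a \<in> A \<Longrightarrow> poly_fun I (f a)) \<Longrightarrow> poly_fun I (\<lambda>x. \<Prod>a\<in>A. f a x)"
  by (induction A rule: finite_induct) (auto intro: poly_fun.intros)

lemma poly_fun_if: "(c \<Longrightarrow> poly_fun I f) \<Longrightarrow> (\<not> c \<Longrightarrow> poly_fun I g) \<Longrightarrow> poly_fun I (\<lambda>x. if c then f x else g x)"
  by (cases c) simp_all

lemma poly_fun_update: "poly_fun (insert i I) f \<Longrightarrow> poly_fun I (\<lambda>x. f (x(i := a)))"
proof (induction rule: poly_fun.induct)
  case (coord j)
  then show ?case by (cases "j = i") (auto intro: poly_fun.intros)
qed (auto intro: poly_fun.intros)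

lemma poly_fun_slice: "poly_fun I f \<Longrightarrow> \<exists>p. \<forall>a. f (x(i := a)) = poly p a"
proof (induction rule: poly_fun.induct)
  case (const c)
  then show ?case by (intro exI[of _ "[:c:]"]) simp
next
  case (coord j)
  then show ?case
    by (cases "j = i") (auto intro: exI[of _ "[:0, 1:]"] exI[of _ "[:x j:]"])
next
  case (add f g)
  then obtain p q where "\<forall>a. f (x(i := a)) = poly p a" "\<forall>a. g (x(i := a)) = poly q a" by blast
  then show ?case by (intro exI[of _ "p + q"]) (simp del: fun_upd_apply)
next
  case (mult f g)
  then obtain p q where "\<forall>a. f (x(i := a)) = poly p a" "\<forall>a. g (x(i := a)) = poly q a" by blast
  then show ?case by (intro exI[of _ "p * q"]) (simp del: fun_upd_apply)
qed

text \<open>Induction on the coordinates: almost every choice of the other coordinates keeps the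
  function nonzero at the old value of the new coordinate, and then, as a polynomial in that
  coordinate, it has only finitely many zeros.\<close>

lemma poly_fun_nonzero_AE:
  assumes "finite I" "poly_fun I f" "f x0 \<noteq> 0"
  shows "AE x in leb I. f x \<noteq> 0"
  using assms
proof (induction I arbitrary: f rule: finite_induct)
  case empty
  have "f x = f y" for x y
    using \<open>poly_fun {} f\<close> by (induction rule: poly_fun.induct) auto
  then have "f x \<noteq> 0" for x using \<open>f x0 \<noteq> 0\<close> by metis
  then show ?case by simp
next
  case (insert i I)
  have fm [measurable]: "f \<in> borel_measurable (leb (insert i I))" by (rule poly_fun_measurable[OF insert.prems(1)])
  have "AE x in leb I. f (x(i := x0 i)) \<noteq> 0"
    by (rule insert.IH[OF poly_fun_update[OF insert.prems(1)]]) (use insert.prems in simp)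
  then have AE: "AE x in leb I. (\<integral>\<^sup>+a. indicator {0} (f (x(i := a))) \<partial>lborel) = 0"
  proof eventually_elim
    fix x assume nz: "f (x(i := x0 i)) \<noteq> 0"
    obtain p where p: "\<And>a. f (x(i := a)) = poly p a" using poly_fun_slice[OF insert.prems(1)] by blast
    with nz have "p \<noteq> 0" by auto
    then have fin: "finite {a. poly p a = 0}" by (rule poly_roots_finite)
    have "(\<integral>\<^sup>+a. indicator {0} (f (x(i := a))) \<partial>lborel) = (\<integral>\<^sup>+a. indicator {a. poly p a = 0} a \<partial>lborel)"
      by (intro nn_integral_cong) (auto simp: p indicator_def)
    also have "\<dots> = emeasure lborel {a. poly p a = 0}"
      using fin by (intro nn_integral_indicator) (auto intro: borel_closed finite_imp_closed)
    also have "\<dots> = 0" using finite_imp_null_set_lborel[OF fin] by auto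
    finally show "(\<integral>\<^sup>+a. indicator {0} (f (x(i := a))) \<partial>lborel) = 0" .
  qed
  have "(\<integral>\<^sup>+x. indicator {0} (f x) \<partial>leb (insert i I)) = 
      (\<integral>\<^sup>+x. \<integral>\<^sup>+a. indicator {0} (f (x(i := a))) \<partial>lborel \<partial>leb I)"
    using insert.hyps by (intro lebesgue_product.product_nn_integral_insert) auto
  also have "\<dots> = (\<integral>\<^sup>+x. 0 \<partial>leb I)" by (rule nn_integral_cong_AE[OF AE])
  finally have "(\<integral>\<^sup>+x. indicator {0} (f x) \<partial>leb (insert i I)) = 0" by simp
  then have "AE x in leb (insert i I). indicator {0} (f x) = (0 :: ennreal)"
    by (subst (asm) nn_integral_0_iff_AE) auto
  then show ?case by eventually_elim (auto simp: indicator_def split: if_splits)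
qed

text \<open>Families of univariate polynomials whose coefficients depend polynomially on the
  coordinates.\<close>

definition poly_poly_fun :: "'i set \<Rightarrow> (('i \<Rightarrow> complex) \<Rightarrow> complex poly) \<Rightarrow> bool" where
  "poly_poly_fun I P \<longleftrightarrow> (\<forall>k. poly_fun I (\<lambda>x. coeff (P x) k))"

lemma poly_poly_fun_const: "poly_poly_fun I (\<lambda>_. p)"
  by (auto simp: poly_poly_fun_def intro: poly_fun.intros)

lemma poly_poly_fun_add: "poly_poly_fun I P \<Longrightarrow> poly_poly_fun I Q \<Longrightarrow> poly_poly_fun I (\<lambda>x. P x + Q x)"
  by (auto simp: poly_poly_fun_def intro: poly_fun.intros)

lemma poly_poly_fun_mult: "poly_poly_fun I P \<Longrightarrow> poly_poly_fun I Q \<Longrightarrow> poly_poly_fun I (\<lambda>x. P x * Q x)"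
  by (auto simp: poly_poly_fun_def coeff_mult intro!: poly_fun_sum poly_fun.mult)

lemma poly_poly_fun_sum: "finite A \<Longrightarrow> (\<And>a. a \<in> A \<Longrightarrow> poly_poly_fun I (f a)) \<Longrightarrow> poly_poly_fun I (\<lambda>x. \<Sum>a\<in>A. f a x)"
  by (induction A rule: finite_induct) (auto intro: poly_poly_fun_const poly_poly_fun_add)

lemma poly_poly_fun_prod: "finite A \<Longrightarrow> (\<And>a. a \<in> A \<Longrightarrow> poly_poly_fun I (f a)) \<Longrightarrow> poly_poly_fun I (\<lambda>x. \<Prod>a\<in>A. f a x)"
  by (induction A rule: finite_induct) (auto intro: poly_poly_fun_const poly_poly_fun_mult)

lemma poly_fun_det:
  assumes "\<And>x. A x \<in> carrier_mat n n" "\<And>i j. i < n \<Longrightarrow> j < n \<Longrightarrow> poly_fun I (\<lambda>x. A x $$ (i, j))"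
  shows "poly_fun I (\<lambda>x. Determinant.det (A x))"
proof -
  have "poly_fun I (\<lambda>x. \<Sum>p | p permutes {0..<n}. signof p * (\<Prod>i = 0..<n. A x $$ (i, p i)))"
    using assms(2) by (intro poly_fun_sum poly_fun.mult poly_fun.const poly_fun_prod)
       (auto simp: finite_permutations dest: permutes_in_image)
  then show ?thesis by (simp only: Determinant.det_def'[OF assms(1)])
qed

lemma poly_poly_fun_det:
  assumes "\<And>x. A x \<in> carrier_mat n n" "\<And>i j. i < n \<Longrightarrow> j < n \<Longrightarrow> poly_poly_fun I (\<lambda>x. A x $$ (i, j))"
  shows "poly_poly_fun I (\<lambda>x. Determinant.det (A x))"
proof -
  have "poly_poly_fun I (\<lambda>x. \<Sum>p | p permutes {0..<n}. signof p * (\<Prod>i = 0..<n. A x $$ (i, p i)))"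
    using assms(2) by (intro poly_poly_fun_sum poly_poly_fun_mult poly_poly_fun_const poly_poly_fun_prod)
       (auto simp: finite_permutations dest: permutes_in_image)
  then show ?thesis by (simp only: Determinant.det_def'[OF assms(1)])
qed

lemma poly_poly_fun_char_poly:
  assumes "\<And>x. A x \<in> carrier_mat n n" "\<And>i j. i < n \<Longrightarrow> j < n \<Longrightarrow> poly_fun I (\<lambda>x. A x $$ (i, j))"
  shows "poly_poly_fun I (\<lambda>x. char_poly (A x))"
  unfolding char_poly_def
proof (rule poly_poly_fun_det)
  show "char_poly_matrix (A x) \<in> carrier_mat n n" for x using assms(1)[of x] by simp
  fix i j assume ij: "i < n" "j < n"
  have cA: "poly_fun I (\<lambda>x. - (A x $$ (i, j)))"
    using poly_fun.mult[OF poly_fun.const[of I "-1"] assms(2)[OF ij]] by simp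
  have eq: "char_poly_matrix (A x) $$ (i, j) = (if i = j then [:0, 1:] else 0) + [: - (A x $$ (i, j)) :]" for x
    using assms(1)[of x] ij by (auto simp: char_poly_matrix_def)
  have "poly_poly_fun I (\<lambda>x. [: - (A x $$ (i, j)) :])"
    unfolding poly_poly_fun_def
  proof
    fix k show "poly_fun I (\<lambda>x. coeff [:- A x $$ (i, j):] k)"
      using cA by (cases k) (auto intro: poly_fun.const)
  qed
  then show "poly_poly_fun I (\<lambda>x. char_poly_matrix (A x) $$ (i, j))"
    unfolding eq by (intro poly_poly_fun_add poly_poly_fun_const)
qed

lemma poly_fun_resultant:
  assumes P: "poly_poly_fun I P" "\<And>x. degree (P x) = d" and Q: "poly_poly_fun I Q" "\<And>x. degree (Q x) = e"
  shows "poly_fun I (\<lambda>x. resultant (P x) (Q x))"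
  unfolding resultant_def
proof (rule poly_fun_det)
  show "sylvester_mat (P x) (Q x) \<in> carrier_mat (d + e) (d + e)" for x
    using sylvester_carrier_mat[of "P x" "Q x"] P(2) Q(2) by simp
  fix i j assume ij: "i < d + e" "j < d + e"
  show "poly_fun I (\<lambda>x. sylvester_mat (P x) (Q x) $$ (i, j))"
    using P(1) Q(1) ij unfolding sylvester_mat_def P(2) Q(2) poly_poly_fun_def
    by (auto simp: sylvester_mat_sub_def intro!: poly_fun_if poly_fun.const)
qed

section \<open>The Jacobian of a complex linear map\<close>

definition mat_act :: "nat \<Rightarrow> complex mat \<Rightarrow> (nat \<Rightarrow> complex) \<Rightarrow> nat \<Rightarrow> complex" where
  "mat_act m A x = (\<lambda>i\<in>{..<m}. \<Sum>j<m. A $$ (i, j) * x j)"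

lemma mat_act_measurable [measurable]: "mat_act m A \<in> leb {..<m} \<rightarrow>\<^sub>M leb {..<m}"
  unfolding mat_act_def by measurable

lemma mat_act_space: "mat_act m A x \<in> space (leb {..<m})"
  by (simp add: mat_act_def space_PiM)

lemma mat_act_add: "mat_act m A (\<lambda>i\<in>{..<m}. x i + y i) = (\<lambda>i\<in>{..<m}. mat_act m A x i + mat_act m A y i)"
  by (rule ext) (auto simp: mat_act_def sum.distrib distrib_left)

lemma mat_act_mult:
  assumes "A \<in> carrier_mat m m" "B \<in> carrier_mat m m"
  shows "mat_act m (A * B) x = mat_act m A (mat_act m B x)"
proof
  fix i
  show "mat_act m (A * B) x i = mat_act m A (mat_act m B x) i"
  proof (cases "i < m")
    case True
    have "(A * B) $$ (i, j) = (\<Sum>k<m. A $$ (i, k) * B $$ (k, j))" if "j < m" for j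
      using assms True that by (simp add: scalar_prod_def lessThan_atLeast0)
    then have "mat_act m (A * B) x i = (\<Sum>j<m. \<Sum>k<m. A $$ (i, k) * B $$ (k, j) * x j)"
      using True by (simp add: mat_act_def sum_distrib_right)
    also have "\<dots> = (\<Sum>k<m. \<Sum>j<m. A $$ (i, k) * B $$ (k, j) * x j)" by (rule sum.swap)
    also have "\<dots> = mat_act m A (mat_act m B x) i"
      using True by (simp add: mat_act_def sum_distrib_left mult.assoc)
    finally show ?thesis .
  qed (simp add: mat_act_def)
qed

lemma mat_act_one: "x \<in> space (leb {..<m}) \<Longrightarrow> mat_act m (1\<^sub>m m) x = x"
  by (rule ext) (auto simp: mat_act_def space_PiM PiE_def extensional_def if_distrib if_distribR sum.delta cong: if_cong)

lemma mat_invertible_imp_inverse: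
  fixes A :: "complex mat"
  assumes "A \<in> carrier_mat m m" "Determinant.det A \<noteq> 0"
  obtains B where "B \<in> carrier_mat m m" "A * B = 1\<^sub>m m" "B * A = 1\<^sub>m m"
  using det_non_zero_imp_unit[OF assms, of "()"] unfolding Units_def by (auto simp: ring_mat_def)

text \<open>The factor by which the pushforward under \<open>A\<close> rescales Lebesgue measure,
  read off from a Gaussian.\<close>

definition jacobian :: "nat \<Rightarrow> complex mat \<Rightarrow> ennreal" where
  "jacobian m A = (\<integral>\<^sup>+x. gauss_weight 1 {..<m} (mat_act m A x) \<partial>leb {..<m}) / ennreal (pi ^ card {..<m})"

lemma nn_integral_mat_act:
  assumes A: "A \<in> carrier_mat m m" and B: "B \<in> carrier_mat m m" "A * B = 1\<^sub>m m"
    and f: "f \<in> borel_measurable (leb {..<m})"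
  shows "(\<integral>\<^sup>+x. f (mat_act m A x) \<partial>leb {..<m}) = jacobian m A * (\<integral>\<^sup>+x. f x \<partial>leb {..<m})"
  unfolding jacobian_def
proof (rule nn_integral_additive_bijection)
  fix y assume y: "y \<in> space (leb {..<m})"
  show "\<exists>z\<in>space (leb {..<m}). mat_act m A z = y"
    using mat_act_mult[OF A B(1), of y] mat_act_one[OF y] by (intro bexI[OF _ mat_act_space[of m B y]]) (simp add: B)
qed (auto intro: mat_act_add f)

lemma jacobian_one: "jacobian m (1\<^sub>m m) = 1"
proof -
  have "(\<integral>\<^sup>+x. gauss_weight 1 {..<m} (mat_act m (1\<^sub>m m) x) \<partial>leb {..<m}) = ennreal (pi ^ card {..<m})"
    using nn_integral_gauss_weight[of "{..<m}" 1]
    by (subst nn_integral_cong[OF arg_cong[OF mat_act_one, where f = "gauss_weight 1 {..<m}"]]) auto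
  then show ?thesis by (simp add: jacobian_def ennreal_divide_self)
qed

lemma jacobian_mult:
  assumes A: "A \<in> carrier_mat m m" and A': "A' \<in> carrier_mat m m" "A * A' = 1\<^sub>m m"
    and B: "B \<in> carrier_mat m m" and B': "B' \<in> carrier_mat m m" "B * B' = 1\<^sub>m m"
  shows "jacobian m (A * B) = jacobian m A * jacobian m B"
proof -
  have "(\<integral>\<^sup>+x. gauss_weight 1 {..<m} (mat_act m (A * B) x) \<partial>leb {..<m}) =
    (\<integral>\<^sup>+x. gauss_weight 1 {..<m} (mat_act m A (mat_act m B x)) \<partial>leb {..<m})"
    by (simp add: mat_act_mult[OF A B])
  also have "\<dots> = jacobian m B * (\<integral>\<^sup>+x. gauss_weight 1 {..<m} (mat_act m A x) \<partial>leb {..<m})"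
    by (intro nn_integral_mat_act[OF B B']) measurable
  finally show ?thesis by (simp add: jacobian_def ennreal_times_divide mult_ac)
qed

text \<open>The case of a linear pencil: \<open>b z - a\<close> has exactly one root.\<close>

lemma nn_integral_lborel_scale:
  fixes b :: complex
  assumes b: "b \<noteq> 0" and f: "f \<in> borel_measurable borel"
  shows "(\<integral>\<^sup>+z. f (b * z) \<partial>lborel) * ennreal ((norm b)\<^sup>2) = (\<integral>\<^sup>+z. f z \<partial>lborel)"
proof -
  have W: "[:b:] = pderiv [:0, b:] * 1 - [:0, b:] * pderiv 1"
    by (simp add: pderiv_pCons)
  have "(\<integral>\<^sup>+a. f a * (\<Sum>z\<in>#proots ([:0, b:] - Polynomial.smult a 1). indicator UNIV z) \<partial>lborel) =
    (\<integral>\<^sup>+z. f (poly [:0, b:] z / poly 1 z) * (ennreal ((norm (poly [:b:] z / (poly 1 z)\<^sup>2))\<^sup>2) * indicator UNIV z) \<partial>lborel)"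
    using b f by (intro nn_integral_roots_pencil[OF _ _ W]) auto
  then show ?thesis using f b by (simp add: size_proots_complex nn_integral_multc mult.commute[of _ b])
qed

text \<open>For fixed last coordinate, the others undergo a triangular map and a translation, and
  the translation is invisible to Lebesgue measure; the last coordinate is scaled by its diagonal
  entry.\<close>

lemma nn_integral_upper_triangular:
  assumes "f \<in> borel_measurable (leb {..<m})"
    and "\<And>i j. i < m \<Longrightarrow> j < i \<Longrightarrow> B $$ (i, j) = 0" and "\<And>i. i < m \<Longrightarrow> B $$ (i, i) \<noteq> 0"
  shows "(\<integral>\<^sup>+x. f (mat_act m B x) \<partial>leb {..<m}) * ennreal ((norm (\<Prod>i<m. B $$ (i, i)))\<^sup>2) = (\<integral>\<^sup>+x. f x \<partial>leb {..<m})"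
  using assms
proof (induction m arbitrary: f)
  case 0
  have "f (mat_act 0 B x) = f x" if "x \<in> space (leb {..<0})" for x
    using that by (auto simp: mat_act_def space_PiM restrict_def)
  then have "(\<integral>\<^sup>+x. f (mat_act 0 B x) \<partial>leb {..<0}) = (\<integral>\<^sup>+x. f x \<partial>leb {..<0})"
    by (rule nn_integral_cong)
  then show ?case by simp
next
  case (Suc m)
  let ?b = "B $$ (m, m)"
  have ins: "{..<Suc m} = insert m {..<m}" by auto
  have fm [measurable]: "f \<in> borel_measurable (leb (insert m {..<m}))" using Suc.prems(1) by (simp add: ins)
  have fm': "(\<lambda>x. f (x(m := y))) \<in> borel_measurable (leb {..<m})" for y
    by (rule measurable_compose[OF _ fm]) (auto intro!: measurable_fun_upd[where J = "{..<m}"])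
  define F where "F y = (\<integral>\<^sup>+x. f (x(m := y)) \<partial>leb {..<m})" for y
  have Fm: "F \<in> borel_measurable borel"
  proof -
    interpret sigma_finite_measure "leb {..<m}" by (rule lebesgue_product.sigma_finite) simp
    have "(\<lambda>(y, x). f (x(m := y))) \<in> borel_measurable (lborel \<Otimes>\<^sub>M leb {..<m})"
      unfolding split_beta
      by (rule measurable_compose[OF _ fm]) (auto intro!: measurable_fun_upd[where J = "{..<m}"])
    then have "F \<in> borel_measurable lborel" unfolding F_def by (rule borel_measurable_nn_integral)
    then show ?thesis by simp
  qed
  have eq: "mat_act (Suc m) B (x(m := y)) = 
      (\<lambda>i\<in>{..<m}. mat_act m B x i + B $$ (i, m) * y)(m := ?b * y)" for x y
  proof
    fix i
    have "(\<Sum>j<m. B $$ (m, j) * (x(m := y)) j) = 0" using Suc.prems(2)[of m] by (intro sum.neutral) auto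
    moreover have "(\<Sum>j<m. B $$ (i, j) * (x(m := y)) j) = (\<Sum>j<m. B $$ (i, j) * x j)"
      by (intro sum.cong) auto
    ultimately show "mat_act (Suc m) B (x(m := y)) i = ((\<lambda>i\<in>{..<m}. mat_act m B x i + B $$ (i, m) * y)(m := ?b * y)) i"
      by (auto simp: mat_act_def less_Suc_eq)
  qed
  have Bm: "mat_act (Suc m) B \<in> leb (insert m {..<m}) \<rightarrow>\<^sub>M leb (insert m {..<m})"
    using mat_act_measurable[of "Suc m" B] by (simp add: ins)
  let ?P = "ennreal ((norm (\<Prod>i<m. B $$ (i, i)))\<^sup>2)"
  have "(\<integral>\<^sup>+x. f (mat_act (Suc m) B x) \<partial>leb {..<Suc m}) * ?P =
     (\<integral>\<^sup>+y. (\<integral>\<^sup>+x. f ((\<lambda>i\<in>{..<m}. mat_act m B x i + B $$ (i, m) * y)(m := ?b * y)) \<partial>leb {..<m}) \<partial>lborel) * ?P"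
    unfolding ins using measurable_compose[OF Bm fm]
    by (subst lebesgue_product.product_nn_integral_insert_rev) (auto simp: eq)
  also have "\<dots> = (\<integral>\<^sup>+y. (\<integral>\<^sup>+x. f ((\<lambda>i\<in>{..<m}. mat_act m B x i + B $$ (i, m) * y)(m := ?b * y)) \<partial>leb {..<m}) * ?P \<partial>lborel)"
  proof (rule nn_integral_multc[symmetric])
    have "(\<lambda>y. \<integral>\<^sup>+x. f (mat_act (Suc m) B (x(m := y))) \<partial>leb {..<m}) \<in> borel_measurable lborel"
    proof -
      interpret sigma_finite_measure "leb {..<m}" by (rule lebesgue_product.sigma_finite) simp
      show ?thesis
        by (rule borel_measurable_nn_integral, unfold split_beta, rule measurable_compose[OF _ measurable_compose[OF Bm fm]])
           (auto intro!: measurable_fun_upd[where J = "{..<m}"])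
    qed
    then show "(\<lambda>y. \<integral>\<^sup>+x. f ((\<lambda>i\<in>{..<m}. mat_act m B x i + B $$ (i, m) * y)(m := ?b * y)) \<partial>leb {..<m}) \<in> borel_measurable lborel"
      by (simp add: eq)
  qed
  also have "\<dots> = (\<integral>\<^sup>+y. F (?b * y) \<partial>lborel)"
  proof (rule nn_integral_cong)
    fix y :: complex
    let ?f = "\<lambda>x. f ((\<lambda>i\<in>{..<m}. x i + B $$ (i, m) * y)(m := ?b * y))"
    have tr: "(\<lambda>x. \<lambda>i\<in>{..<m}. x i + B $$ (i, m) * y) \<in> leb {..<m} \<rightarrow>\<^sub>M leb {..<m}"
      by (rule measurable_leb_componentwise) auto
    have "(\<integral>\<^sup>+x. ?f (mat_act m B x) \<partial>leb {..<m}) * ?P = (\<integral>\<^sup>+x. ?f x \<partial>leb {..<m})"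
      using Suc.prems by (intro Suc.IH measurable_compose[OF tr fm']) auto
    also have "\<dots> = F (?b * y)"
      unfolding F_def by (rule nn_integral_leb_translate[OF _ fm']) simp
    finally show "(\<integral>\<^sup>+x. f ((\<lambda>i\<in>{..<m}. mat_act m B x i + B $$ (i, m) * y)(m := ?b * y)) \<partial>leb {..<m}) * ?P = F (?b * y)" .
  qed
  finally have "(\<integral>\<^sup>+x. f (mat_act (Suc m) B x) \<partial>leb {..<Suc m}) * ?P * ennreal ((norm ?b)\<^sup>2) = (\<integral>\<^sup>+y. F y \<partial>lborel)"
    using nn_integral_lborel_scale[OF Suc.prems(3)[of m] Fm] by simp
  also have "\<dots> = (\<integral>\<^sup>+x. f x \<partial>leb {..<Suc m})"
    unfolding ins F_def by (subst lebesgue_product.product_nn_integral_insert_rev) auto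
  finally show ?case
    by (simp add: norm_mult power_mult_distrib ennreal_mult mult.assoc)
qed

text \<open>The Jacobian is multiplicative, hence invariant under similarity, so a Schur form
  reduces the claim to triangular matrices.\<close>

lemma jacobian_det:
  assumes A: "A \<in> carrier_mat m m" and det: "Determinant.det A \<noteq> 0"
  shows "jacobian m A * ennreal ((norm (Determinant.det A))\<^sup>2) = 1"
proof -
  obtain es where es: "char_poly A = (\<Prod>e\<leftarrow>es. [:- e, 1:])"
    using char_poly_factorized[OF A] by blast
  obtain B P Q where sd: "schur_decomposition A es = (B, P, Q)" by (metis prod_cases3)
  have *: "similar_mat_wit A B P Q" "upper_triangular B"
    using schur_decomposition[OF A es sd] by auto
  then have c: "A = P * B * Q" "P * Q = 1\<^sub>m m" "Q * P = 1\<^sub>m m"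
     "B \<in> carrier_mat m m" "P \<in> carrier_mat m m" "Q \<in> carrier_mat m m"
    using A by (auto simp: similar_mat_wit_def Let_def)
  have dB: "Determinant.det B = Determinant.det A"
    using det_similar[of A B] *(1) unfolding similar_mat_def by metis
  have dB': "Determinant.det B = (\<Prod>i<m. B $$ (i, i))"
    using det_upper_triangular[OF *(2) c(4)] c(4) by (simp add: prod_list_diag_prod lessThan_atLeast0)
  obtain B' where B': "B' \<in> carrier_mat m m" "B * B' = 1\<^sub>m m"
    using mat_invertible_imp_inverse[OF c(4)] dB det by metis
  have "jacobian m A = jacobian m (P * (B * Q))" using c by (simp add: assoc_mult_mat[of _ m m _ m _ m])
  also have "\<dots> = jacobian m P * jacobian m (B * Q)"
  proof (rule jacobian_mult[where A' = Q and B' = "P * B'"])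
    have "B * Q * (P * B') = B * (Q * (P * B'))"
      using c B' by (intro assoc_mult_mat[of _ m m _ m _ m]) auto
    also have "Q * (P * B') = (Q * P) * B'"
      using c B' by (intro assoc_mult_mat[symmetric, of _ m m _ m _ m]) auto
    finally show "B * Q * (P * B') = 1\<^sub>m m" using c(3) B' by simp
  qed (use c B' in auto)
  also have "jacobian m (B * Q) = jacobian m B * jacobian m Q"
    by (rule jacobian_mult[where A' = B' and B' = P]) (use c B' in auto)
  also have "jacobian m P * (jacobian m B * jacobian m Q) = jacobian m B * (jacobian m P * jacobian m Q)" by (simp add: mult_ac)
  also have "jacobian m P * jacobian m Q = jacobian m (P * Q)"
    by (rule jacobian_mult[where A' = Q and B' = P, symmetric]) (use c in auto)
  also have "\<dots> = 1" by (simp add: c jacobian_one)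
  finally have "jacobian m A = jacobian m B" by simp
  moreover have "jacobian m B * ennreal ((norm (Determinant.det B))\<^sup>2) = 1"
  proof -
    have nz: "B $$ (i, i) \<noteq> 0" if "i < m" for i
      using that dB dB' det prod_zero_iff[of "{..<m}" "\<lambda>i. B $$ (i, i)"] by auto
    have "(\<integral>\<^sup>+x. gauss_weight 1 {..<m} (mat_act m B x) \<partial>leb {..<m}) * ennreal ((norm (Determinant.det B))\<^sup>2) =
        (\<integral>\<^sup>+x. gauss_weight 1 {..<m} x \<partial>leb {..<m})"
      unfolding dB' using *(2) c(4) nz by (intro nn_integral_upper_triangular) auto
    also have "\<dots> = ennreal (pi ^ card {..<m})" by (simp add: nn_integral_gauss_weight)
    finally have eq: "(\<integral>\<^sup>+x. gauss_weight 1 {..<m} (mat_act m B x) \<partial>leb {..<m}) * ennreal ((norm (Determinant.det B))\<^sup>2) =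
      ennreal (pi ^ card {..<m})" .
    have "jacobian m B * ennreal ((norm (Determinant.det B))\<^sup>2) = ennreal (pi ^ card {..<m}) / ennreal (pi ^ card {..<m})"
      unfolding jacobian_def eq[symmetric] by (subst mult.commute, subst ennreal_times_divide, subst mult.commute) (rule refl)
    also have "\<dots> = 1" by (rule ennreal_divide_self) auto
    finally show ?thesis .
  qed
  ultimately show ?thesis by (simp add: dB)
qed

lemma nn_integral_linear_substitution:
  assumes A: "A \<in> carrier_mat m m" and det: "Determinant.det A \<noteq> 0"
    and f: "f \<in> borel_measurable (leb {..<m})"
  shows "(\<integral>\<^sup>+x. f x \<partial>leb {..<m}) = 
    (\<integral>\<^sup>+x. f (mat_act m A x) \<partial>leb {..<m}) * ennreal ((norm (Determinant.det A))\<^sup>2)"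
proof -
  obtain B where "B \<in> carrier_mat m m" "A * B = 1\<^sub>m m"
    using mat_invertible_imp_inverse[OF A det] by metis
  from nn_integral_mat_act[OF A this f] show ?thesis
    using jacobian_det[OF A det] by (simp add: mult_ac) (metis mult.assoc mult.commute mult.right_neutral)
qed

section \<open>Second moment of a Gaussian characteristic polynomial\<close>

text \<open>The complex Gaussian whose squared modulus has mean \<open>1 / t\<close>.\<close>

definition gauss :: "real \<Rightarrow> complex measure" where
  "gauss t = density lborel (\<lambda>z. ennreal (t / pi * exp (- (t * (norm z)\<^sup>2))))"

lemma sets_gauss [simp, measurable_cong]: "sets (gauss t) = sets borel"
  by (simp add: gauss_def)

lemma prob_space_gauss: assumes "t > 0" shows "prob_space (gauss t)"
proof
  have "emeasure (gauss t) (space (gauss t)) = (\<integral>\<^sup>+(z::complex). ennreal (t / pi) * ennreal (exp (- (t * (norm z)\<^sup>2))) \<partial>lborel)"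
    using assms unfolding gauss_def
    by (subst emeasure_density) (auto intro!: nn_integral_cong simp: ennreal_mult[symmetric])
  also have "\<dots> = ennreal (t / pi) * ennreal (pi / t)" using assms
    by (subst nn_integral_cmult) (auto simp: nn_integral_gauss)
  also have "\<dots> = 1" using assms by (simp flip: ennreal_mult)
  finally show "emeasure (gauss t) (space (gauss t)) = 1" .
qed

lemma PiM_gauss:
  assumes I: "finite I" and t: "t > 0"
  shows "PiM I (\<lambda>_. gauss t) = density (leb I) (\<lambda>x. ennreal ((t / pi) ^ card I) * gauss_weight t I x)"
proof -
  interpret G: prob_space "gauss t" by (rule prob_space_gauss[OF t])
  interpret P: product_sigma_finite "\<lambda>_. gauss t" ..
  let ?d = "\<lambda>z::complex. ennreal (t / pi * exp (- (t * (norm z)\<^sup>2)))"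
  have w: "ennreal ((t / pi) ^ card I) * gauss_weight t I x = (\<Prod>i\<in>I. ?d (x i))" for x
  proof -
    have "(\<Prod>i\<in>I. ?d (x i)) = ennreal (\<Prod>i\<in>I. t / pi * exp (- (t * (norm (x i))\<^sup>2)))"
      using t by (intro prod_ennreal) auto
    also have "\<dots> = ennreal ((t / pi) ^ card I * (\<Prod>i\<in>I. exp (- (t * (norm (x i))\<^sup>2))))"
      by (simp only: prod.distrib prod_constant)
    also have "\<dots> = ennreal ((t / pi) ^ card I) * ennreal (\<Prod>i\<in>I. exp (- (t * (norm (x i))\<^sup>2)))"
      using t by (intro ennreal_mult) (auto intro: prod_nonneg)
    also have "ennreal (\<Prod>i\<in>I. exp (- (t * (norm (x i))\<^sup>2))) = gauss_weight t I x"
      unfolding gauss_weight_prod[OF I] by (intro prod_ennreal[symmetric]) auto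
    finally show ?thesis ..
  qed
  show ?thesis
  proof (rule P.PiM_eqI[OF I, symmetric])
    fix A assume A: "\<And>i. i \<in> I \<Longrightarrow> A i \<in> sets (gauss t)"
    have AI: "Pi\<^sub>E I A \<in> sets (leb I)" using A I by (intro sets_PiM_I_finite) auto
    have "emeasure (density (leb I) (\<lambda>x. ennreal ((t / pi) ^ card I) * gauss_weight t I x)) (Pi\<^sub>E I A) =
      (\<integral>\<^sup>+x. (\<Prod>i\<in>I. ?d (x i)) * indicator (Pi\<^sub>E I A) x \<partial>leb I)"
      using AI by (subst emeasure_density) (simp_all only: w, simp_all)
    also have "\<dots> = (\<integral>\<^sup>+x. (\<Prod>i\<in>I. ?d (x i) * indicator (A i) (x i)) \<partial>leb I)"
    proof (rule nn_integral_cong)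
      fix x assume x: "x \<in> space (leb I)"
      have "indicator (Pi\<^sub>E I A) x = (\<Prod>i\<in>I. indicator (A i) (x i) :: ennreal)"
      proof (cases "x \<in> Pi\<^sub>E I A")
        case True
        then show ?thesis by (auto simp: PiE_iff)
      next
        case False
        then obtain i where "i \<in> I" "x i \<notin> A i" using x by (auto simp: space_PiM PiE_iff)
        then have "(\<Prod>i\<in>I. indicator (A i) (x i) :: ennreal) = 0"
          by (intro prod_zero[OF I] bexI[of _ i]) auto
        then show ?thesis using False by simp
      qed
      then show "(\<Prod>i\<in>I. ?d (x i)) * indicator (Pi\<^sub>E I A) x = (\<Prod>i\<in>I. ?d (x i) * indicator (A i) (x i))"
        by (simp add: prod.distrib)
    qed
    also have "\<dots> = (\<Prod>i\<in>I. \<integral>\<^sup>+z. ?d z * indicator (A i) z \<partial>lborel)"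
      using A by (intro lebesgue_product.product_nn_integral_prod[OF I]) auto
    also have "\<dots> = (\<Prod>i\<in>I. emeasure (gauss t) (A i))"
      using A by (intro prod.cong refl) (simp add: gauss_def emeasure_density)
    finally show "emeasure (density (leb I) (\<lambda>x. ennreal ((t / pi) ^ card I) * gauss_weight t I x)) (Pi\<^sub>E I A) =
      (\<Prod>i\<in>I. emeasure (gauss t) (A i))" .
  qed (simp add: sets_PiM_cong[OF refl, of I "\<lambda>_. gauss t" "\<lambda>_. lborel"])
qed

lemma nn_integral_gauss_norm_power2:
  assumes t: "t > 0" shows "(\<integral>\<^sup>+z. ennreal ((norm z)\<^sup>2) \<partial>gauss t) = ennreal (1 / t)"
proof -
  have "(\<integral>\<^sup>+s. ennreal (s * exp (- (t * s))) * indicator {0..} s \<partial>lborel) = ennreal (0 - (- exp (- t * 0) * (t * 0 + 1) / t\<^sup>2))"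
  proof (rule nn_integral_FTC_atLeast)
    show "((\<lambda>s. - exp (- t * s) * (t * s + 1) / t\<^sup>2) \<longlongrightarrow> 0) at_top" using t by real_asymp
    show "((\<lambda>s. - exp (- t * s) * (t * s + 1) / t\<^sup>2) has_real_derivative s * exp (- (t * s))) (at s)" for s
      using t by (auto intro!: derivative_eq_intros simp: power2_eq_square field_simps)
  qed auto
  then have r: "(\<integral>\<^sup>+(z::complex). ennreal ((norm z)\<^sup>2 * exp (- (t * (norm z)\<^sup>2))) \<partial>lborel) = ennreal (pi / t\<^sup>2)"
    using t by (subst nn_integral_radial[of "\<lambda>s. ennreal (s * exp (- (t * s)))"]) (auto simp: ennreal_mult[symmetric])
  have "(\<integral>\<^sup>+z. ennreal ((norm z)\<^sup>2) \<partial>gauss t) = 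
      (\<integral>\<^sup>+(z::complex). ennreal (t / pi) * ennreal ((norm z)\<^sup>2 * exp (- (t * (norm z)\<^sup>2))) \<partial>lborel)"
    using t unfolding gauss_def
    by (subst nn_integral_density) (auto intro!: nn_integral_cong simp: ennreal_mult[symmetric] mult_ac)
  also have "\<dots> = ennreal (t / pi) * ennreal (pi / t\<^sup>2)"
    using t by (subst nn_integral_cmult) (auto simp: r)
  also have "\<dots> = ennreal (1 / t)" using t by (simp flip: ennreal_mult add: power2_eq_square)
  finally show ?thesis .
qed

lemma gauss_moments:
  assumes t: "t > 0"
  shows "integrable (gauss t) (\<lambda>z. z)" "integrable (gauss t) (\<lambda>z. (norm z)\<^sup>2)"
    "(\<integral>z. z \<partial>gauss t) = 0" "(\<integral>z. (norm z)\<^sup>2 \<partial>gauss t) = 1 / t"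
proof -
  interpret G: prob_space "gauss t" by (rule prob_space_gauss[OF t])
  show i2: "integrable (gauss t) (\<lambda>z. (norm z)\<^sup>2)"
    using nn_integral_gauss_norm_power2[OF t] by (intro integrableI_nonneg) auto
  show "integrable (gauss t) (\<lambda>z. z)"
  proof (rule Bochner_Integration.integrable_bound[OF _ _ AE_I2])
    show "integrable (gauss t) (\<lambda>z. 1 + (norm z)\<^sup>2)" using i2 by simp
    fix z :: complex
    have "0 \<le> (norm z - 1)\<^sup>2" "0 \<le> (norm z)\<^sup>2" by simp_all
    then have "norm z \<le> 1 + (norm z)\<^sup>2" unfolding power2_diff power_one mult_1_right by linarith
    then show "norm z \<le> norm (1 + (norm z)\<^sup>2)" by simp
  qed simp
  show "(\<integral>z. (norm z)\<^sup>2 \<partial>gauss t) = 1 / t"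
    using nn_integral_gauss_norm_power2[OF t] t by (intro integral_eq_nn_integral[THEN trans]) auto
  have sym: "distr (gauss t) borel uminus = gauss t"
  proof -
    have "distr lborel borel uminus = (lborel :: complex measure)"
      using distr_lborel_reflect[of 0] by simp
    then have "gauss t = density (distr lborel borel uminus) (\<lambda>z. ennreal (t / pi * exp (- (t * (norm z)\<^sup>2))))"
      by (simp add: gauss_def)
    also have "\<dots> = distr (density lborel (\<lambda>z. ennreal (t / pi * exp (- (t * (norm (- z))\<^sup>2))))) borel uminus"
      by (rule density_distr) auto
    finally show ?thesis by (simp add: gauss_def)
  qed
  have "(\<integral>z. z \<partial>gauss t) = (\<integral>z. z \<partial>distr (gauss t) borel uminus)" by (simp only: sym)
  also have "\<dots> = - (\<integral>z. z \<partial>gauss t)"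
    by (subst integral_distr) auto
  finally show "(\<integral>z. z \<partial>gauss t) = 0" by simp
qed

lemma gauss_shifted_moments:
  assumes t: "t > 0"
  shows "integrable (gauss t) (\<lambda>z. c - z)" "(\<integral>z. c - z \<partial>gauss t) = c"
    "integrable (gauss t) (\<lambda>z. cnj (c - z))" "(\<integral>z. cnj (c - z) \<partial>gauss t) = cnj c"
    "integrable (gauss t) (\<lambda>z. (c - z) * cnj (c - z))" 
    "(\<integral>z. (c - z) * cnj (c - z) \<partial>gauss t) = of_real ((norm c)\<^sup>2 + 1 / t)"
proof -
  interpret G: prob_space "gauss t" by (rule prob_space_gauss[OF t])
  note m = gauss_moments[OF t]
  show 1: "integrable (gauss t) (\<lambda>z. c - z)" using m by simp
  show 2: "(\<integral>z. c - z \<partial>gauss t) = c" using m by (simp add: G.prob_space)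
  have ic: "integrable (gauss t) (\<lambda>z. cnj z)" using m by (simp add: integrable_cnj)
  show "integrable (gauss t) (\<lambda>z. cnj (c - z))" using ic by simp
  have icz: "(\<integral>z. cnj z \<partial>gauss t) = 0" using m by (simp add: integral_cnj)
  show "(\<integral>z. cnj (c - z) \<partial>gauss t) = cnj c" using ic icz by (simp add: G.prob_space)
  have eq: "(c - z) * cnj (c - z) = of_real ((norm c)\<^sup>2) - c * cnj z - cnj c * z + of_real ((norm z)\<^sup>2)" for z
    by (simp only: complex_norm_square) (simp add: algebra_simps)
  have in2: "integrable (gauss t) (\<lambda>z. complex_of_real ((norm z)\<^sup>2))"
    using m(2) by (rule integrable_of_real)
  show "integrable (gauss t) (\<lambda>z. (c - z) * cnj (c - z))" unfolding eq using m(1) ic in2 by simp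
  have "(\<integral>z. complex_of_real ((norm z)\<^sup>2) \<partial>gauss t) = of_real (1 / t)"
    by (subst integral_of_real) (simp_all add: m)
  then show "(\<integral>z. (c - z) * cnj (c - z) \<partial>gauss t) = of_real ((norm c)\<^sup>2 + 1 / t)"
    unfolding eq using m ic in2 icz by (simp add: G.prob_space)
qed

text \<open>Expanding the product selects a set \<open>S\<close> of fixed points, and a
  permutation fixing \<open>S\<close> is a permutation of the complement.\<close>

lemma sum_permutations_fixed_points:
  fixes a b :: real
  shows "(\<Sum>p | p permutes {..<m}. \<Prod>i<m. (if p i = i then a else 0) + b) = (\<Sum>k\<le>m. fact m / fact k * a ^ k * b ^ (m - k))"
proof -
  let ?F = "\<lambda>S. {p. p permutes {..<m} \<and> (\<forall>i\<in>S. p i = i)}"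
  have F: "?F S = {p. p permutes ({..<m} - S)}" if "S \<subseteq> {..<m}" for S
    using that by (auto simp: permutes_def)
  have cF: "card (?F S) = fact (m - card S)" if "S \<subseteq> {..<m}" for S
    using that unfolding F[OF that] by (subst card_permutations[OF refl]) (auto simp: card_Diff_subset finite_subset[OF that])
  have "(\<Sum>p | p permutes {..<m}. \<Prod>i<m. (if p i = i then a else 0) + b) =
    (\<Sum>p | p permutes {..<m}. \<Sum>S\<in>Pow {..<m}. (\<Prod>i\<in>S. if p i = i then a else 0) * (\<Prod>i\<in>{..<m} - S. b))"
    by (intro sum.cong refl prod_add) auto
  also have "\<dots> = (\<Sum>S\<in>Pow {..<m}. \<Sum>p | p permutes {..<m}. (\<Prod>i\<in>S. if p i = i then a else 0) * (\<Prod>i\<in>{..<m} - S. b))"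
    by (rule sum.swap)
  also have "\<dots> = (\<Sum>S\<in>Pow {..<m}. fact (m - card S) * a ^ card S * b ^ (m - card S))"
  proof (rule sum.cong[OF refl])
    fix S assume S: "S \<in> Pow {..<m}"
    then have fS: "finite S" "card S \<le> m" by (auto simp: finite_subset subset_eq_atLeast0_lessThan_card lessThan_atLeast0)
    have "(\<Prod>i\<in>S. if p i = i then a else 0) = (if \<forall>i\<in>S. p i = i then a ^ card S else 0)" for p :: "nat \<Rightarrow> nat"
      using fS by (auto intro!: prod_zero)
    then have "(\<Sum>p | p permutes {..<m}. (\<Prod>i\<in>S. if p i = i then a else 0) * (\<Prod>i\<in>{..<m} - S. b)) =
      (\<Sum>p | p permutes {..<m}. if \<forall>i\<in>S. p i = i then a ^ card S * b ^ (m - card S) else 0)"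
      using S fS by (intro sum.cong) (auto simp: card_Diff_subset)
    also have "\<dots> = (\<Sum>p\<in>?F S. a ^ card S * b ^ (m - card S))"
      by (simp add: sum.If_cases finite_permutations Collect_conj_eq Int_commute)
    also have "\<dots> = fact (m - card S) * a ^ card S * b ^ (m - card S)"
      using cF[of S] S by simp
    finally show "(\<Sum>p | p permutes {..<m}. (\<Prod>i\<in>S. if p i = i then a else 0) * (\<Prod>i\<in>{..<m} - S. b)) =
      fact (m - card S) * a ^ card S * b ^ (m - card S)" .
  qed
  also have "\<dots> = (\<Sum>k\<le>m. \<Sum>S | S \<in> Pow {..<m} \<and> card S = k. fact (m - card S) * a ^ card S * b ^ (m - card S))"
  proof (rule sum.group[symmetric])
    show "card ` Pow {..<m} \<subseteq> {..m}" using card_mono[of "{..<m}"] by fastforce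
  qed auto
  also have "\<dots> = (\<Sum>k\<le>m. real (m choose k) * (fact (m - k) * a ^ k * b ^ (m - k)))"
    using n_subsets[of "{..<m}"] by (intro sum.cong refl) simp
  also have "\<dots> = (\<Sum>k\<le>m. fact m / fact k * a ^ k * b ^ (m - k))"
    by (intro sum.cong refl) (simp add: binomial_fact field_simps)
  finally show ?thesis .
qed

definition shifted_mat :: "nat \<Rightarrow> complex \<Rightarrow> (nat \<times> nat \<Rightarrow> complex) \<Rightarrow> complex mat" where
  "shifted_mat m c Z = Matrix.mat m m (\<lambda>(i, j). (if i = j then c else 0) - Z (i, j))"

text \<open>In the double expansion over permutations \<open>p\<close> and \<open>q\<close> the
  entries are independent. If \<open>p i\<close> and \<open>q i\<close> differ, one of the
  positions \<open>(i, p i)\<close> and \<open>(i, q i)\<close> is off the diagonal and occurs to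
  first order only, so the term has mean zero. The diagonal terms \<open>p = q\<close> are
  products of \<open>1 / t\<close>, increased by the squared modulus of \<open>c\<close> at fixed
  points.\<close>

lemma nn_integral_det_gauss:
  assumes t: "t > 0"
  shows "(\<integral>\<^sup>+Z. ennreal ((norm (Determinant.det (shifted_mat m c Z)))\<^sup>2) \<partial>PiM ({..<m} \<times> {..<m}) (\<lambda>_. gauss t)) =
    ennreal (\<Sum>k\<le>m. fact m / fact k * ((norm c)\<^sup>2) ^ k * (1 / t) ^ (m - k))"
proof -
  interpret G: prob_space "gauss t" by (rule prob_space_gauss[OF t])
  interpret P: product_sigma_finite "\<lambda>_. gauss t" ..
  let ?J = "{..<m} \<times> {..<m}"
  let ?M = "PiM ?J (\<lambda>_. gauss t)"
  let ?S = "{p. p permutes {..<m}}"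
  define d where "d e = (if fst e = snd e then c else 0)" for e :: "nat \<times> nat"
  define h where "h p q e z = (if p (fst e) = snd e then d e - z else 1) * (if q (fst e) = snd e then cnj (d e - z) else 1)"
    for p q :: "nat \<Rightarrow> nat" and e :: "nat \<times> nat" and z :: complex
  note sm = gauss_shifted_moments[OF t]
  have hi: "integrable (gauss t) (h p q e)" for p q e
    unfolding h_def[abs_def]
    by (cases "p (fst e) = snd e"; cases "q (fst e) = snd e") (use sm[of "d e"] in simp_all)
  have hv: "(\<integral>z. h p q e z \<partial>gauss t) = (if p (fst e) = snd e then (if q (fst e) = snd e then of_real ((norm (d e))\<^sup>2 + 1 / t) else d e)
     else (if q (fst e) = snd e then cnj (d e) else 1))" for p q e
    unfolding h_def
    by (cases "p (fst e) = snd e"; cases "q (fst e) = snd e") (use sm[of "d e"] in \<open>simp_all add: G.prob_space\<close>)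
  have fJ: "finite ?J" by simp
  have ih: "integrable ?M (\<lambda>Z. \<Prod>e\<in>?J. h p q e (Z e))" for p q
    by (rule P.product_integrable_prod[OF fJ hi])
  have vh: "(\<integral>Z. (\<Prod>e\<in>?J. h p q e (Z e)) \<partial>?M) = (\<Prod>e\<in>?J. \<integral>z. h p q e z \<partial>gauss t)" for p q
    by (rule P.product_integral_prod[OF fJ hi])
  (* A product along the graph of a permutation, written as a product over all positions. *)
  have graph: "(\<Prod>e\<in>?J. if p (fst e) = snd e then F e else 1) = (\<Prod>i<m. F (i, p i))"
    if "p permutes {..<m}" for p and F :: "nat \<times> nat \<Rightarrow> complex"
  proof -
    have "(\<Prod>e\<in>?J. if p (fst e) = snd e then F e else 1) = (\<Prod>i<m. \<Prod>j<m. if p i = j then F (i, j) else 1)"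
      by (subst prod.cartesian_product) (auto intro!: prod.cong)
    also have "\<dots> = (\<Prod>i<m. F (i, p i))"
      using permutes_in_image[OF that] by (intro prod.cong) (auto simp: prod.delta)
    finally show ?thesis .
  qed
  have detZ: "complex_of_real ((norm (Determinant.det (shifted_mat m c Z)))\<^sup>2) =
    (\<Sum>p\<in>?S. \<Sum>q\<in>?S. (signof p * signof q) * (\<Prod>e\<in>?J. h p q e (Z e)))" for Z
  proof -
    have D: "Determinant.det (shifted_mat m c Z) = (\<Sum>p\<in>?S. signof p * (\<Prod>i<m. d (i, p i) - Z (i, p i)))"
      by (subst Determinant.det_def'[of _ m])
         (auto simp: shifted_mat_def d_def lessThan_atLeast0 permutes_in_image intro!: sum.cong prod.cong)
    have cD: "cnj (Determinant.det (shifted_mat m c Z)) = (\<Sum>q\<in>?S. signof q * (\<Prod>i<m. cnj (d (i, q i) - Z (i, q i))))"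
      unfolding D by (simp only: cnj_sum complex_cnj_mult cnj_prod) (simp add: sign_def)
    have pr: "(\<Prod>e\<in>?J. h p q e (Z e)) = (\<Prod>i<m. d (i, p i) - Z (i, p i)) * (\<Prod>i<m. cnj (d (i, q i) - Z (i, q i)))"
      if "p \<in> ?S" "q \<in> ?S" for p q
      unfolding h_def prod.distrib
      using graph[of p "\<lambda>e. d e - Z e"] graph[of q "\<lambda>e. cnj (d e - Z e)"] that by simp
    have "complex_of_real ((norm (Determinant.det (shifted_mat m c Z)))\<^sup>2) = 
        Determinant.det (shifted_mat m c Z) * cnj (Determinant.det (shifted_mat m c Z))"
      by (rule complex_norm_square)
    also have "\<dots> = (\<Sum>p\<in>?S. \<Sum>q\<in>?S. (signof p * (\<Prod>i<m. d (i, p i) - Z (i, p i))) * (signof q * (\<Prod>i<m. cnj (d (i, q i) - Z (i, q i)))))"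
      by (simp only: D[symmetric] cD[symmetric] sum_product[symmetric])
    also have "\<dots> = (\<Sum>p\<in>?S. \<Sum>q\<in>?S. (signof p * signof q) * (\<Prod>e\<in>?J. h p q e (Z e)))"
      using pr by (intro sum.cong refl) (simp add: mult_ac)
    finally show ?thesis .
  qed
  have zero: "(\<Prod>e\<in>?J. \<integral>z. h p q e z \<partial>gauss t) = 0" if pq: "p \<in> ?S" "q \<in> ?S" "p \<noteq> q" for p q
  proof -
    obtain i where i: "p i \<noteq> q i" using pq by auto
    have im: "i < m"
    proof (rule ccontr)
      assume "\<not> i < m"
      then have "p i = i" "q i = i" using pq by (auto simp: permutes_def)
      with i show False by simp
    qed
    have "p i < m" "q i < m" using pq im permutes_in_image[of p "{..<m}" i] permutes_in_image[of q "{..<m}" i] by auto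
    show ?thesis
    proof (cases "p i = i")
      case False
      have "(\<integral>z. h p q (i, p i) z \<partial>gauss t) = 0" unfolding hv using i False by (simp add: d_def)
      then show ?thesis using im \<open>p i < m\<close> by (intro prod_zero[OF fJ] bexI[of _ "(i, p i)"]) auto
    next
      case True
      have "(\<integral>z. h p q (i, q i) z \<partial>gauss t) = 0" unfolding hv using i True by (simp add: d_def)
      then show ?thesis using im \<open>q i < m\<close> by (intro prod_zero[OF fJ] bexI[of _ "(i, q i)"]) auto
    qed
  qed
  have diag: "(\<Prod>e\<in>?J. \<integral>z. h p p e z \<partial>gauss t) = of_real (\<Prod>i<m. (if p i = i then (norm c)\<^sup>2 else 0) + 1 / t)"
    if "p \<in> ?S" for p
  proof -
    have "(\<Prod>e\<in>?J. \<integral>z. h p p e z \<partial>gauss t) = 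
      (\<Prod>e\<in>?J. if p (fst e) = snd e then of_real ((norm (d e))\<^sup>2 + 1 / t) else 1)"
      by (intro prod.cong refl) (simp add: hv)
    also have "\<dots> = (\<Prod>i<m. of_real ((norm (d (i, p i)))\<^sup>2 + 1 / t))" using that by (subst graph) auto
    also have "\<dots> = of_real (\<Prod>i<m. (if p i = i then (norm c)\<^sup>2 else 0) + 1 / t)"
      unfolding of_real_prod by (intro prod.cong refl) (auto simp: d_def)
    finally show ?thesis .
  qed
  have int: "integrable ?M (\<lambda>Z. complex_of_real ((norm (Determinant.det (shifted_mat m c Z)))\<^sup>2))"
    unfolding detZ using ih by (intro Bochner_Integration.integrable_sum integrable_mult_right) auto
  have "(\<integral>Z. complex_of_real ((norm (Determinant.det (shifted_mat m c Z)))\<^sup>2) \<partial>?M) =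
    (\<Sum>p\<in>?S. \<Sum>q\<in>?S. (signof p * signof q) * (\<Prod>e\<in>?J. \<integral>z. h p q e z \<partial>gauss t))"
    unfolding detZ using ih
    by (subst Bochner_Integration.integral_sum, fastforce)+ (simp add: vh)
  also have "\<dots> = (\<Sum>p\<in>?S. \<Sum>q\<in>?S. if q = p then of_real (\<Prod>i<m. (if p i = i then (norm c)\<^sup>2 else 0) + 1 / t) else 0)"
    using zero diag by (intro sum.cong refl) (auto simp: sign_def)
  also have "\<dots> = of_real (\<Sum>p\<in>?S. \<Prod>i<m. (if p i = i then (norm c)\<^sup>2 else 0) + 1 / t)"
    unfolding of_real_sum by (intro sum.cong refl) (simp add: sum.delta finite_permutations)
  also have "(\<Sum>p\<in>?S. \<Prod>i<m. (if p i = i then (norm c)\<^sup>2 else 0) + 1 / t) = (\<Sum>k\<le>m. fact m / fact k * ((norm c)\<^sup>2) ^ k * (1 / t) ^ (m - k))"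
    by (rule sum_permutations_fixed_points)
  finally have val: "(\<integral>Z. complex_of_real ((norm (Determinant.det (shifted_mat m c Z)))\<^sup>2) \<partial>?M) =
    of_real (\<Sum>k\<le>m. fact m / fact k * ((norm c)\<^sup>2) ^ k * (1 / t) ^ (m - k))" .
  have intr: "integrable ?M (\<lambda>Z. (norm (Determinant.det (shifted_mat m c Z)))\<^sup>2)"
    using integrable_Re[OF int] by (simp only: Re_complex_of_real)
  have valr: "(\<integral>Z. (norm (Determinant.det (shifted_mat m c Z)))\<^sup>2 \<partial>?M) = 
     (\<Sum>k\<le>m. fact m / fact k * ((norm c)\<^sup>2) ^ k * (1 / t) ^ (m - k))"
    using integral_Re[OF int] unfolding val by (simp only: Re_complex_of_real)
  show ?thesis unfolding valr[symmetric] by (intro nn_integral_eq_integral intr) auto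
qed

section \<open>Deflation along a fixed eigenvector\<close>

text \<open>The Householder reflection that maps \<open>v\<close> to a positive multiple
  \<open>\<rho>\<close> of the last basis vector. It exists without a phase factor because the
  last entry of \<open>v\<close> is real and positive.\<close>

lemma householder_exists:
  fixes v :: "nat \<Rightarrow> complex"
  assumes vm: "v m = 1"
  shows "\<exists>H \<rho>. \<rho> > (0::real) \<and> (\<forall>i j. H j i = cnj (H i j)) \<and>
    (\<forall>i\<le>m. \<forall>j\<le>m. (\<Sum>k\<le>m. H i k * H k j) = (if i = j then 1 else 0)) \<and>
    (\<forall>i\<le>m. (\<Sum>j\<le>m. H i j * v j) = (if i = m then of_real \<rho> else 0))"
proof -
  define s where "s = (\<Sum>j\<le>m. (norm (v j))\<^sup>2)"
  define \<rho> where "\<rho> = sqrt s"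
  have "(norm (v m))\<^sup>2 \<le> s" unfolding s_def by (rule member_le_sum) auto
  then have s1: "s \<ge> 1" by (simp add: vm)
  then have \<rho>: "\<rho> > 0" "\<rho> * \<rho> = s" by (auto simp: \<rho>_def)
  define u where "u j = (if j = m then of_real \<rho> else 0) - v j" for j
  define \<tau> where "\<tau> = 1 / (s - \<rho>)"
  (* If v is a multiple of the last basis vector, then u = 0 and \<tau> = 1 / 0 = 0, so H is the
     identity. *)
  define H where "H i j = (if i = j then 1 else 0) - of_real \<tau> * u i * cnj (u j)" for i j
  have vv: "(\<Sum>j\<le>m. cnj (v j) * v j) = of_real s"
    unfolding s_def of_real_sum by (intro sum.cong refl) (simp only: complex_norm_square mult.commute)
  have uv: "(\<Sum>j\<le>m. cnj (u j) * v j) = of_real (\<rho> - s)"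
  proof -
    have "(\<Sum>j\<le>m. cnj (u j) * v j) = (\<Sum>j\<le>m. (if j = m then of_real \<rho> * v j else 0) - cnj (v j) * v j)"
      by (intro sum.cong refl) (simp add: u_def left_diff_distrib)
    also have "\<dots> = of_real (\<rho> - s)" by (simp add: sum_subtractf vv vm)
    finally show ?thesis .
  qed
  have uu: "(\<Sum>j\<le>m. cnj (u j) * u j) = of_real (2 * (s - \<rho>))"
  proof -
    have "(\<Sum>j\<le>m. cnj (u j) * u j) = (\<Sum>j\<le>m. (if j = m then of_real \<rho> * cnj (u j) else 0) - cnj (u j) * v j)"
      by (intro sum.cong refl) (auto simp: u_def algebra_simps)
    also have "\<dots> = of_real \<rho> * cnj (u m) - of_real (\<rho> - s)" by (simp add: sum_subtractf uv)
    also have "cnj (u m) = of_real (\<rho> - 1)" by (simp add: u_def vm)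
    also have "of_real \<rho> * of_real (\<rho> - 1) - complex_of_real (\<rho> - s) = of_real (\<rho> * (\<rho> - 1) - (\<rho> - s))" by simp
    also have "\<rho> * (\<rho> - 1) - (\<rho> - s) = 2 * (s - \<rho>)" using \<rho>(2) by (simp add: algebra_simps)
    finally show ?thesis .
  qed
  have u0: "u j = 0" if "s = \<rho>" "j \<le> m" for j
  proof -
    have "of_real (\<Sum>j\<le>m. (norm (u j))\<^sup>2) = (\<Sum>j\<le>m. cnj (u j) * u j)"
      unfolding of_real_sum by (intro sum.cong refl) (simp only: complex_norm_square mult.commute)
    also have "\<dots> = 0" using uu that by simp
    finally have "(\<Sum>j\<le>m. (norm (u j))\<^sup>2) = 0" by (simp only: of_real_eq_0_iff)
    then show ?thesis using that by (subst (asm) sum_nonneg_eq_0_iff) auto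
  qed
  show ?thesis
  proof (intro exI[of _ H] exI[of _ \<rho>] conjI allI impI)
    show "\<rho> > 0" by fact
    show "H j i = cnj (H i j)" for i j by (simp add: H_def mult_ac)
    fix i assume i: "i \<le> m"
    have "(\<Sum>j\<le>m. H i j * v j) = (\<Sum>j\<le>m. (if i = j then v j else 0) - of_real \<tau> * u i * (cnj (u j) * v j))"
      by (intro sum.cong refl) (simp add: H_def algebra_simps)
    also have "\<dots> = v i - of_real \<tau> * u i * of_real (\<rho> - s)"
      using i by (simp only: sum_subtractf sum_distrib_left[symmetric] uv) simp
    also have "\<dots> = v i + u i"
    proof (cases "s = \<rho>")
      case True
      then show ?thesis using u0[OF True i] by simp
    next
      case False
      then have "\<tau> * (\<rho> - s) = -1" by (simp add: \<tau>_def field_simps)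
      then have "of_real \<tau> * of_real (\<rho> - s) = (-1 :: complex)" by (metis of_real_mult of_real_minus of_real_1)
      then have "of_real \<tau> * u i * of_real (\<rho> - s) = - u i" by (metis mult.assoc mult.commute mult_minus1)
      then show ?thesis by simp
    qed
    also have "\<dots> = (if i = m then of_real \<rho> else 0)" by (simp add: u_def)
    finally show "(\<Sum>j\<le>m. H i j * v j) = (if i = m then of_real \<rho> else 0)" .
    fix j assume j: "j \<le> m"
    have "(\<Sum>k\<le>m. H i k * H k j) = (\<Sum>k\<le>m. (if i = k then (if k = j then 1 else 0) else 0) 
        - (if i = k then of_real \<tau> * u k * cnj (u j) else 0) - (if k = j then of_real \<tau> * u i * cnj (u k) else 0)
        + of_real \<tau> * of_real \<tau> * u i * cnj (u j) * (cnj (u k) * u k))"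
      by (intro sum.cong refl) (simp add: H_def algebra_simps)
    also have "\<dots> = (if i = j then 1 else 0) - 2 * (of_real \<tau> * u i * cnj (u j)) + of_real \<tau> * of_real \<tau> * u i * cnj (u j) * of_real (2 * (s - \<rho>))"
      using i j by (simp only: sum.distrib sum_subtractf sum_distrib_left[symmetric] uu) (simp add: sum.delta)
    also have "\<dots> = (if i = j then 1 else 0)"
    proof -
      have "\<tau> * \<tau> * (2 * (s - \<rho>)) = 2 * \<tau>" 
      proof (cases "s = \<rho>")
        case False
        then have "\<tau> * (s - \<rho>) = 1" by (simp add: \<tau>_def)
        then show ?thesis by (metis mult.assoc mult.commute mult.right_neutral)
      qed (simp add: \<tau>_def)
      then have "of_real \<tau> * of_real \<tau> * of_real (2 * (s - \<rho>)) = 2 * (of_real \<tau> :: complex)"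
        by (metis of_real_mult of_real_numeral)
      then have "of_real \<tau> * of_real \<tau> * u i * cnj (u j) * of_real (2 * (s - \<rho>)) = 2 * (of_real \<tau> * u i * cnj (u j))"
        by (metis (no_types, opaque_lifting) mult.assoc mult.commute)
      then show ?thesis by simp
    qed
    finally show "(\<Sum>k\<le>m. H i k * H k j) = (if i = j then 1 else 0)" .
  qed
qed

lemma sum_norm_power2_isometry:
  fixes U :: "nat \<Rightarrow> nat \<Rightarrow> complex"
  assumes U: "\<And>k l. k \<le> m \<Longrightarrow> l \<le> m \<Longrightarrow> (\<Sum>i\<le>m. cnj (U i k) * U i l) = (if k = l then 1 else 0)"
  shows "(\<Sum>i\<le>m. (norm (\<Sum>k\<le>m. U i k * a k))\<^sup>2) = (\<Sum>k\<le>m. (norm (a k))\<^sup>2)"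
proof -
  have "complex_of_real (\<Sum>i\<le>m. (norm (\<Sum>k\<le>m. U i k * a k))\<^sup>2) =
     (\<Sum>i\<le>m. (\<Sum>l\<le>m. U i l * a l) * (\<Sum>k\<le>m. cnj (U i k) * cnj (a k)))"
    unfolding of_real_sum by (intro sum.cong refl) (simp only: complex_norm_square cnj_sum complex_cnj_mult)
  also have "\<dots> = (\<Sum>i\<le>m. \<Sum>l\<le>m. \<Sum>k\<le>m. a l * cnj (a k) * (cnj (U i k) * U i l))"
    unfolding sum_product by (intro sum.cong refl) (simp add: mult_ac)
  also have "\<dots> = (\<Sum>l\<le>m. \<Sum>i\<le>m. \<Sum>k\<le>m. a l * cnj (a k) * (cnj (U i k) * U i l))"
    by (rule sum.swap)
  also have "\<dots> = (\<Sum>l\<le>m. \<Sum>k\<le>m. \<Sum>i\<le>m. a l * cnj (a k) * (cnj (U i k) * U i l))"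
    by (intro sum.cong refl sum.swap)
  also have "\<dots> = (\<Sum>l\<le>m. \<Sum>k\<le>m. if k = l then a l * cnj (a k) else 0)"
    by (intro sum.cong refl) (simp add: sum_distrib_left[symmetric] U)
  also have "\<dots> = (\<Sum>l\<le>m. a l * cnj (a l))" by (intro sum.cong refl) (simp add: sum.delta)
  also have "\<dots> = complex_of_real (\<Sum>k\<le>m. (norm (a k))\<^sup>2)"
    unfolding of_real_sum by (intro sum.cong refl) (simp only: complex_norm_square)
  finally show ?thesis by (simp only: of_real_eq_iff)
qed

lemma measurable_det:
  assumes A: "\<And>x. A x \<in> carrier_mat n n" and m: "\<And>i j. i < n \<Longrightarrow> j < n \<Longrightarrow> (\<lambda>x. A x $$ (i, j)) \<in> borel_measurable M"
  shows "(\<lambda>x. Determinant.det (A x :: complex mat)) \<in> borel_measurable M"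
  unfolding Determinant.det_def'[OF A] using m
  by (intro borel_measurable_sum borel_measurable_times borel_measurable_prod borel_measurable_const)
     (auto dest: permutes_in_image)

text \<open>The product of \<open>Suc m\<close> by \<open>Suc m\<close> matrices, as an operation
  on entry functions.\<close>

definition mmul :: "nat \<Rightarrow> (nat \<Rightarrow> nat \<Rightarrow> complex) \<Rightarrow> (nat \<Rightarrow> nat \<Rightarrow> complex) \<Rightarrow> nat \<Rightarrow> nat \<Rightarrow> complex" where
  "mmul m A B i j = (\<Sum>k\<le>m. A i k * B k j)"

lemma mmul_assoc: "mmul m (mmul m A B) C = mmul m A (mmul m B C)"
proof (intro ext)
  fix i j
  have "mmul m (mmul m A B) C i j = (\<Sum>l\<le>m. \<Sum>k\<le>m. A i k * B k l * C l j)"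
    by (simp add: mmul_def sum_distrib_right)
  also have "\<dots> = (\<Sum>k\<le>m. \<Sum>l\<le>m. A i k * B k l * C l j)" by (rule sum.swap)
  also have "\<dots> = mmul m A (mmul m B C) i j" by (simp add: mmul_def sum_distrib_left mult.assoc)
  finally show "mmul m (mmul m A B) C i j = mmul m A (mmul m B C) i j" .
qed

lemma mmul_cong:
  "(\<And>k. k \<le> m \<Longrightarrow> A i k = A' i k) \<Longrightarrow> (\<And>k. k \<le> m \<Longrightarrow> B k j = B' k j) \<Longrightarrow> mmul m A B i j = mmul m A' B' i j"
  by (simp add: mmul_def)

text \<open>The index set of the first \<open>m\<close> columns of a square matrix of size
  \<open>m + 1\<close>.\<close>

abbreviation tall :: "nat \<Rightarrow> (nat \<times> nat) set" where
  "tall m \<equiv> {..<Suc m} \<times> {..<m}"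

text \<open>The vector \<open>w\<close> with a final entry 1: almost every eigenvector can be
  normalised in this way.\<close>

definition eigvec :: "nat \<Rightarrow> (nat \<Rightarrow> complex) \<Rightarrow> nat \<Rightarrow> complex" where
  "eigvec m w i = (if i < m then w i else 1)"

text \<open>The last column of the matrix with first columns \<open>C\<close> that has the vector
  \<open>eigvec m w\<close> as an eigenvector to the eigenvalue \<open>c\<close>.\<close>

definition eigcol :: "nat \<Rightarrow> complex \<Rightarrow> (nat \<Rightarrow> complex) \<Rightarrow> (nat \<times> nat \<Rightarrow> complex) \<Rightarrow> nat \<Rightarrow> complex" where
  "eigcol m c w C i = c * eigvec m w i - (\<Sum>j<m. C (i, j) * w j)"

text \<open>The matrix \<open>c I - X\<close> with its last column replaced by the eigenvector.
  Its determinant is the complex Jacobian of the passage from the pair of eigenvalue and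
  eigenvector to the last column of \<open>X\<close>.\<close>

definition bordered_mat :: "nat \<Rightarrow> complex \<Rightarrow> (nat \<Rightarrow> complex) \<Rightarrow> (nat \<times> nat \<Rightarrow> complex) \<Rightarrow> complex mat" where
  "bordered_mat m c w C = Matrix.mat (Suc m) (Suc m)
     (\<lambda>(i, j). if j < m then (if i = j then c else 0) - C (i, j) else eigvec m w i)"

text \<open>The weight of a matrix with a prescribed eigenpair: the real Jacobian times the
  Gaussian weight of all its entries.\<close>

definition incidence_weight :: "real \<Rightarrow> nat \<Rightarrow> complex \<Rightarrow> (nat \<Rightarrow> complex) \<Rightarrow> (nat \<times> nat \<Rightarrow> complex) \<Rightarrow> ennreal" where
  "incidence_weight t m c w C = ennreal ((norm (Determinant.det (bordered_mat m c w C)))\<^sup>2) *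
     ennreal (exp (- (t * ((\<Sum>e\<in>tall m. (norm (C e))\<^sup>2) + (\<Sum>i\<le>m. (norm (eigcol m c w C i))\<^sup>2)))))"

text \<open>Conjugating by the Householder reflection of the eigenvector makes it a basis vector,
  so \<open>c I - X\<close> acquires a zero last column. The reflection preserves the Frobenius
  norm, whence the Gaussian weight splits off the factor of the eigenvalue and leaves an
  independent Gaussian rectangular matrix; the bordered determinant becomes, up to a factor that
  depends on \<open>w\<close> only, the determinant of its upper square block. The map between the
  two rectangular matrices is an additive bijection that does not involve \<open>c\<close>, so its
  Jacobian goes into the constant \<open>J\<close>. That \<open>J\<close> depends neither on
  \<open>c\<close> nor on \<open>t\<close> is the point of the statement.\<close>

lemma incidence_weight_deflation:
  "\<exists>J. \<forall>c t. (\<integral>\<^sup>+C. incidence_weight t m c w C \<partial>leb (tall m)) =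
     J * ennreal (exp (- (t * (norm c)\<^sup>2))) *
     (\<integral>\<^sup>+Z. ennreal ((norm (Determinant.det (shifted_mat m c Z)))\<^sup>2) * gauss_weight t (tall m) Z \<partial>leb (tall m))"
proof -
  let ?I = "tall m"
  let ?v = "eigvec m w"
  have fI: "finite ?I" by simp
  have "?v m = 1" by (simp add: eigvec_def)
  from householder_exists[where v = ?v and m = m, OF this]
  obtain H \<rho> where H: "\<rho> > (0::real) \<and> (\<forall>i j. H j i = cnj (H i j)) \<and>
    (\<forall>i\<le>m. \<forall>j\<le>m. (\<Sum>k\<le>m. H i k * H k j) = (if i = j then 1 else 0)) \<and>
    (\<forall>i\<le>m. (\<Sum>j\<le>m. H i j * ?v j) = (if i = m then of_real \<rho> else 0))"
    by (elim exE)
  have \<rho>: "\<rho> > 0" using H by (elim conjE)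
  have Hh: "H j i = cnj (H i j)" for i j using H by (elim conjE) (erule allE, erule allE, assumption)
  have HH: "(\<Sum>k\<le>m. H i k * H k j) = (if i = j then 1 else 0)" if "i \<le> m" "j \<le> m" for i j
    using conjunct1[OF conjunct2[OF conjunct2[OF H]]] that by blast
  have Hv: "(\<Sum>j\<le>m. H i j * ?v j) = (if i = m then of_real \<rho> else 0)" if "i \<le> m" for i
    using conjunct2[OF conjunct2[OF conjunct2[OF H]]] that by blast
  define I1 where "I1 i j = (if i = j then 1 else 0 :: complex)" for i j :: nat
  have HHm: "mmul m H H i j = I1 i j" if "i \<le> m" "j \<le> m" for i j
    using HH[OF that] by (simp add: mmul_def I1_def)
  have I1l: "mmul m I1 A i j = A i j" if "i \<le> m" for A i j
    using that by (simp add: mmul_def I1_def if_distrib[where f = "\<lambda>x. x * _"] sum.delta' cong: if_cong)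
  have I1r: "mmul m A I1 i j = A i j" if "j \<le> m" for A i j
    using that by (simp add: mmul_def I1_def if_distrib[where f = "\<lambda>x. _ * x"] sum.delta cong: if_cong)
  (* Conjugation by H, an involution. *)
  define cH where "cH A = mmul m H (mmul m A H)" for A
  have cH_cong: "cH A i j = cH B i j" if "\<And>k l. k \<le> m \<Longrightarrow> l \<le> m \<Longrightarrow> A k l = B k l" for A B i j
    unfolding cH_def using that by (intro mmul_cong) auto
  have cHcH: "cH (cH A) i j = A i j" if ij: "i \<le> m" "j \<le> m" for A i j
  proof -
    have "cH (cH A) i j = mmul m (mmul m H H) (mmul m A (mmul m H H)) i j"
      by (simp add: cH_def mmul_assoc)
    also have "\<dots> = mmul m I1 (mmul m A (mmul m H H)) i j"
      using ij by (intro mmul_cong) (auto simp: HHm)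
    also have "\<dots> = mmul m A (mmul m H H) i j" by (rule I1l[OF ij(1)])
    also have "\<dots> = mmul m A I1 i j" using ij by (intro mmul_cong) (auto simp: HHm)
    also have "\<dots> = A i j" by (rule I1r[OF ij(2)])
    finally show ?thesis .
  qed
  (* Z extended by a zero column, and Y extended by the column that makes the eigenvector a kernel
     vector; conjugation by H exchanges the two kinds of matrices. *)
  define ZH where "ZH Z i j = (if j < m then Z (i, j) else 0)" for Z :: "nat \<times> nat \<Rightarrow> complex" and i j
  define YH where "YH Y i j = (if j < m then Y (i, j) else - (\<Sum>l<m. Y (i, l) * w l))" for Y :: "nat \<times> nat \<Rightarrow> complex" and i j
  define T where "T Z = (\<lambda>e\<in>?I. cH (ZH Z) (fst e) (snd e))" for Z
  define S where "S Y = (\<lambda>e\<in>?I. cH (YH Y) (fst e) (snd e))" for Y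
  have atMost_split: "(\<Sum>j\<le>m. f j) = (\<Sum>j<m. f j) + f m" for f :: "nat \<Rightarrow> complex"
    by (simp add: lessThan_Suc_atMost[symmetric])
  (* As H is an involution that maps the eigenvector to \<rho> times a basis vector, its last
     column is the normalised eigenvector. *)
  have Hm: "H l m = ?v l / of_real \<rho>" if l: "l \<le> m" for l
  proof -
    have "?v l = (\<Sum>k\<le>m. I1 l k * ?v k)"
      using l by (simp add: I1_def if_distrib[where f = "\<lambda>x. x * _"] sum.delta' cong: if_cong)
    also have "\<dots> = (\<Sum>k\<le>m. \<Sum>i\<le>m. H l i * (H i k * ?v k))"
      using l by (intro sum.cong refl) (simp add: HHm[symmetric] mmul_def sum_distrib_right mult.assoc)
    also have "\<dots> = (\<Sum>i\<le>m. \<Sum>k\<le>m. H l i * (H i k * ?v k))" by (rule sum.swap)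
    also have "\<dots> = (\<Sum>i\<le>m. if i = m then H l i * of_real \<rho> else 0)"
      by (intro sum.cong refl) (simp add: sum_distrib_left[symmetric] Hv)
    also have "\<dots> = H l m * of_real \<rho>" by simp
    finally show ?thesis using \<rho> by simp
  qed
  have kill: "(\<Sum>j\<le>m. YH Y i j * ?v j) = 0" for Y i
    by (simp add: atMost_split YH_def eigvec_def)
  have cHZ_kill: "(\<Sum>j\<le>m. cH (ZH Z) i j * ?v j) = 0" for Z i
  proof -
    have "(\<Sum>j\<le>m. cH (ZH Z) i j * ?v j) = mmul m (cH (ZH Z)) (\<lambda>k _. ?v k) i 0" by (simp add: mmul_def)
    also have "\<dots> = mmul m H (mmul m (ZH Z) (mmul m H (\<lambda>k _. ?v k))) i 0" by (simp add: cH_def mmul_assoc)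
    also have "\<dots> = mmul m H (\<lambda>_ _. 0) i 0"
    proof (rule mmul_cong[OF refl])
      fix k
      have "mmul m (ZH Z) (mmul m H (\<lambda>k _. ?v k)) k 0 = (\<Sum>l\<le>m. ZH Z k l * (if l = m then of_real \<rho> else 0))"
        unfolding mmul_def by (intro sum.cong refl) (simp add: Hv)
      also have "\<dots> = 0" by (intro sum.neutral) (simp add: ZH_def)
      finally show "mmul m (ZH Z) (mmul m H (\<lambda>k _. ?v k)) k 0 = 0" .
    qed
    also have "\<dots> = 0" by (simp add: mmul_def)
    finally show ?thesis .
  qed
  have YHT: "YH (T Z) i j = cH (ZH Z) i j" if ij: "i \<le> m" "j \<le> m" for Z i j
  proof (cases "j < m")
    case True
    then show ?thesis using ij by (simp add: YH_def T_def)
  next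
    case False
    then have j: "j = m" using ij by simp
    have "(\<Sum>l<m. cH (ZH Z) i l * w l) + cH (ZH Z) i m = 0"
      using cHZ_kill[of Z i] by (simp add: atMost_split eigvec_def)
    then have "cH (ZH Z) i m = - (\<Sum>l<m. cH (ZH Z) i l * w l)" by (simp add: eq_neg_iff_add_eq_0 add.commute)
    then show ?thesis using ij by (simp add: j YH_def T_def)
  qed
  have ZHS: "ZH (S Y) i j = cH (YH Y) i j" if ij: "i \<le> m" "j \<le> m" for Y i j
  proof (cases "j < m")
    case True
    then show ?thesis using ij by (simp add: ZH_def S_def)
  next
    case False
    then have j: "j = m" using ij by simp
    have "mmul m (YH Y) H k m = (\<Sum>l\<le>m. (YH Y k l * ?v l) / of_real \<rho>)" for k
      unfolding mmul_def by (intro sum.cong refl) (simp add: Hm)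
    then have "mmul m (YH Y) H k m = 0" for k by (simp only: sum_divide_distrib[symmetric] kill div_0)
    then have "cH (YH Y) i m = 0" unfolding cH_def by (subst mmul_def) simp
    then show ?thesis by (simp add: j ZH_def)
  qed
  have ext: "f = g" if "f \<in> space (leb ?I)" "g \<in> space (leb ?I)" "\<And>i j. i \<le> m \<Longrightarrow> j < m \<Longrightarrow> f (i, j) = g (i, j)"
    for f g :: "nat \<times> nat \<Rightarrow> complex"
    using that by (intro extensionalityI[of f ?I g]) (auto simp: space_PiM PiE_def less_Suc_eq_le)
  have Tsp: "T Z \<in> space (leb ?I)" for Z by (simp add: T_def space_PiM)
  have Ssp: "S Y \<in> space (leb ?I)" for Y by (simp add: S_def space_PiM)
  have ST: "S (T Z) = Z" if Z: "Z \<in> space (leb ?I)" for Z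
  proof (rule ext[OF Ssp Z])
    fix i j assume ij: "i \<le> m" "j < m"
    have "S (T Z) (i, j) = cH (YH (T Z)) i j" using ij by (simp add: S_def)
    also have "\<dots> = cH (cH (ZH Z)) i j" by (rule cH_cong) (rule YHT)
    also have "\<dots> = Z (i, j)" using ij by (simp add: cHcH ZH_def)
    finally show "S (T Z) (i, j) = Z (i, j)" .
  qed
  have TS: "T (S Y) = Y" if Y: "Y \<in> space (leb ?I)" for Y
  proof (rule ext[OF Tsp Y])
    fix i j assume ij: "i \<le> m" "j < m"
    have "T (S Y) (i, j) = cH (ZH (S Y)) i j" using ij by (simp add: T_def)
    also have "\<dots> = cH (cH (YH Y)) i j" by (rule cH_cong) (rule ZHS)
    also have "\<dots> = Y (i, j)" using ij by (simp add: cHcH YH_def)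
    finally show "T (S Y) (i, j) = Y (i, j)" .
  qed
  have S_entry: "cH (YH Y) i j = (\<Sum>k\<le>m. H i k * ((\<Sum>l<m. Y (k, l) * H l j) - (\<Sum>l<m. Y (k, l) * w l) * H m j))" for Y i j
    by (simp add: cH_def mmul_def atMost_split YH_def)
  have ent [measurable]: "(\<lambda>C. C (i, j)) \<in> borel_measurable (leb ?I)" if "i \<le> m" "j < m" for i j
    using that measurable_component_singleton[of "(i, j)" ?I "\<lambda>_. lborel"] by simp
  have Sm: "S \<in> leb ?I \<rightarrow>\<^sub>M leb ?I"
    unfolding S_def[abs_def]
  proof (rule measurable_restrict)
    fix e assume "e \<in> ?I"
    have "(\<lambda>Y. cH (YH Y) (fst e) (snd e)) \<in> borel_measurable (leb ?I)"
      unfolding S_entry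
      by (intro borel_measurable_sum borel_measurable_times borel_measurable_const borel_measurable_diff ent) auto
    then show "(\<lambda>Y. cH (YH Y) (fst e) (snd e)) \<in> leb ?I \<rightarrow>\<^sub>M lborel" by simp
  qed
  have Sadd: "S (\<lambda>e\<in>?I. x e + y e) = (\<lambda>e\<in>?I. S x e + S y e)" for x y
  proof (rule ext[OF Ssp])
    show "(\<lambda>e\<in>?I. S x e + S y e) \<in> space (leb ?I)" by (simp add: space_PiM)
    fix i j assume ij: "i \<le> m" "j < m"
    have a: "YH (\<lambda>e\<in>?I. x e + y e) k l = YH x k l + YH y k l" if "k \<le> m" for k l
      using that by (auto simp: YH_def distrib_right sum.distrib)
    have "cH (YH (\<lambda>e\<in>?I. x e + y e)) i j = cH (\<lambda>k l. YH x k l + YH y k l) i j"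
      by (rule cH_cong) (rule a)
    also have "\<dots> = cH (YH x) i j + cH (YH y) i j"
      by (simp add: cH_def mmul_def distrib_left distrib_right sum.distrib)
    finally show "S (\<lambda>e\<in>?I. x e + y e) (i, j) = (\<lambda>e\<in>?I. S x e + S y e) (i, j)" using ij by (simp add: S_def)
  qed
  define Hn where "Hn = Matrix.mat (Suc m) (Suc m) (\<lambda>(i, j). H i j)"
  define Hs where "Hs = Matrix.mat m m (\<lambda>(i, j). H i j)"
  define \<kappa> where "\<kappa> = (\<rho> * norm (Determinant.det Hs) / norm (Determinant.det Hn))\<^sup>2"
  have detHn: "Determinant.det Hn \<noteq> 0"
  proof -
    have "Hn * Hn = 1\<^sub>m (Suc m)"
      by (rule eq_matI) (auto simp: Hn_def scalar_prod_def HH atLeast0LessThan lessThan_Suc_atMost less_Suc_eq_le simp del: sum.op_ivl_Suc sum.lessThan_Suc)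
    then have "Determinant.det Hn * Determinant.det Hn = 1"
      using det_mult[of Hn "Suc m" Hn] by (simp add: Hn_def)
    then show ?thesis by auto
  qed
  have det_eq: "(norm (Determinant.det (Matrix.mat (Suc m) (Suc m) (\<lambda>(i, j). if j < m then T Z (i, j) else ?v i))))\<^sup>2 =
      \<kappa> * (norm (Determinant.det (Matrix.mat m m Z)))\<^sup>2" for Z
  proof -
    let ?D = "Matrix.mat (Suc m) (Suc m) (\<lambda>(i, j). if j < m then T Z (i, j) else ?v i)"
    let ?E = "Matrix.mat (Suc m) (Suc m) (\<lambda>(i, j). if j < m then mmul m (ZH Z) H i j else if i = m then of_real \<rho> else 0)"
    (* Multiplying by H from the left turns the last column into \<rho> times a basis vector;
       expanding along that column leaves the upper left block of Z times that of H. *)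
    have "Hn * ?D = ?E"
    proof (rule eq_matI)
      fix i j assume "i < dim_row ?E" "j < dim_col ?E"
      then have ij: "i \<le> m" "j \<le> m" by auto
      have "(Hn * ?D) $$ (i, j) = (\<Sum>k\<le>m. H i k * (if j < m then cH (ZH Z) k j else ?v k))"
        using ij by (auto simp: Hn_def scalar_prod_def T_def atLeast0LessThan lessThan_Suc_atMost less_Suc_eq_le simp del: sum.op_ivl_Suc sum.lessThan_Suc intro!: sum.cong)
      also have "\<dots> = ?E $$ (i, j)"
      proof (cases "j < m")
        case True
        have "(\<Sum>k\<le>m. H i k * cH (ZH Z) k j) = mmul m (mmul m H H) (mmul m (ZH Z) H) i j"
          by (simp add: cH_def mmul_assoc) (simp add: mmul_def)
        also have "\<dots> = mmul m I1 (mmul m (ZH Z) H) i j" using ij by (intro mmul_cong) (auto simp: HHm)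
        also have "\<dots> = mmul m (ZH Z) H i j" by (rule I1l[OF ij(1)])
        finally show ?thesis using ij True by simp
      next
        case False
        then show ?thesis using ij by (simp add: Hv)
      qed
      finally show "(Hn * ?D) $$ (i, j) = ?E $$ (i, j)" .
    qed (auto simp: Hn_def)
    then have "Determinant.det Hn * Determinant.det ?D = Determinant.det ?E"
      using det_mult[of Hn "Suc m" ?D] by (simp add: Hn_def)
    also have "\<dots> = (\<Sum>i<Suc m. ?E $$ (i, m) * cofactor ?E i m)"
      by (rule laplace_expansion_column) auto
    also have "\<dots> = of_real \<rho> * cofactor ?E m m" by (simp add: sum.neutral)
    also have "cofactor ?E m m = Determinant.det (mat_delete ?E m m)"
      by (simp add: cofactor_def mult_2[symmetric] power_mult)
    also have "mat_delete ?E m m = Matrix.mat m m Z * Hs"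
      by (rule eq_matI) (auto simp: mat_delete_def Hs_def scalar_prod_def mmul_def atMost_split ZH_def atLeast0LessThan)
    also have "Determinant.det (Matrix.mat m m Z * Hs) = Determinant.det (Matrix.mat m m Z) * Determinant.det Hs"
      by (rule det_mult) (auto simp: Hs_def)
    finally have e: "Determinant.det Hn * Determinant.det ?D = of_real \<rho> * (Determinant.det (Matrix.mat m m Z) * Determinant.det Hs)" .
    have "norm (Determinant.det Hn) * norm (Determinant.det ?D) = \<rho> * norm (Determinant.det Hs) * norm (Determinant.det (Matrix.mat m m Z))"
      using arg_cong[OF e, of norm] \<rho> unfolding norm_mult by (simp add: mult_ac)
    then have "norm (Determinant.det ?D) = \<rho> * norm (Determinant.det Hs) / norm (Determinant.det Hn) * norm (Determinant.det (Matrix.mat m m Z))"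
      using detHn by (simp add: field_simps)
    then show ?thesis by (simp add: \<kappa>_def power_mult_distrib power_divide)
  qed
  have frob: "(\<Sum>i\<le>m. \<Sum>j\<le>m. (norm (cH A i j))\<^sup>2) = (\<Sum>i\<le>m. \<Sum>j\<le>m. (norm (A i j))\<^sup>2)" for A
  proof -
    have U1: "(\<Sum>i\<le>m. cnj (H i k) * H i l) = (if k = l then 1 else 0)" if "k \<le> m" "l \<le> m" for k l
      by (simp only: Hh[symmetric] HH[OF that])
    have U2: "(\<Sum>i\<le>m. cnj (H k i) * H l i) = (if k = l then 1 else 0)" if "k \<le> m" "l \<le> m" for k l
    proof -
      have "(\<Sum>i\<le>m. cnj (H k i) * H l i) = (\<Sum>i\<le>m. H l i * H i k)"
        by (intro sum.cong refl) (simp only: Hh[symmetric] mult.commute)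
      also have "\<dots> = (if l = k then 1 else 0)" by (rule HH[OF that(2,1)])
      finally show ?thesis by auto
    qed
    have "(\<Sum>i\<le>m. \<Sum>j\<le>m. (norm (cH A i j))\<^sup>2) = (\<Sum>j\<le>m. \<Sum>i\<le>m. (norm (cH A i j))\<^sup>2)" by (rule sum.swap)
    also have "\<dots> = (\<Sum>j\<le>m. \<Sum>k\<le>m. (norm (mmul m A H k j))\<^sup>2)"
    proof (rule sum.cong[OF refl])
      fix j
      have "cH A i j = (\<Sum>k\<le>m. H i k * mmul m A H k j)" for i by (simp add: cH_def mmul_def)
      then show "(\<Sum>i\<le>m. (norm (cH A i j))\<^sup>2) = (\<Sum>k\<le>m. (norm (mmul m A H k j))\<^sup>2)"
        using sum_norm_power2_isometry[of m H, OF U1] by simp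
    qed
    also have "\<dots> = (\<Sum>k\<le>m. \<Sum>j\<le>m. (norm (mmul m A H k j))\<^sup>2)" by (rule sum.swap)
    also have "\<dots> = (\<Sum>k\<le>m. \<Sum>j\<le>m. (norm (A k j))\<^sup>2)"
    proof (rule sum.cong[OF refl])
      fix k
      have "mmul m A H k j = (\<Sum>l\<le>m. H l j * A k l)" for j by (simp add: mmul_def mult.commute)
      then show "(\<Sum>j\<le>m. (norm (mmul m A H k j))\<^sup>2) = (\<Sum>j\<le>m. (norm (A k j))\<^sup>2)"
        using sum_norm_power2_isometry[of m "\<lambda>i k. H k i", OF U2] by simp
    qed
    finally show ?thesis .
  qed
  have split2: "(\<Sum>i\<le>m. \<Sum>j\<le>m. g i j) = (\<Sum>e\<in>?I. g (fst e) (snd e)) + (\<Sum>i\<le>m. g i m)" for g :: "nat \<Rightarrow> nat \<Rightarrow> real"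
  proof -
    have "(\<Sum>i\<le>m. \<Sum>j\<le>m. g i j) = (\<Sum>i\<le>m. (\<Sum>j<m. g i j) + g i m)"
      by (simp add: lessThan_Suc_atMost[symmetric])
    also have "(\<Sum>i\<le>m. (\<Sum>j<m. g i j) + g i m) = (\<Sum>i\<le>m. \<Sum>j<m. g i j) + (\<Sum>i\<le>m. g i m)" by (rule sum.distrib)
    also have "(\<Sum>i\<le>m. \<Sum>j<m. g i j) = (\<Sum>e\<in>?I. g (fst e) (snd e))"
      by (simp add: sum.cartesian_product lessThan_Suc_atMost split_beta)
    finally show ?thesis .
  qed
  (* The entries of X outside the last column, together with that column, are all entries of c I -
     YH (T Z). *)
  have exp_eq: "(\<Sum>e\<in>?I. (norm ((if fst e = snd e then c else 0) - T Z e))\<^sup>2) + 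
      (\<Sum>i\<le>m. (norm (eigcol m c w (\<lambda>e\<in>?I. (if fst e = snd e then c else 0) - T Z e) i))\<^sup>2) =
      (\<Sum>e\<in>?I. (norm ((if fst e = snd e then c else 0) - Z e))\<^sup>2) + (norm c)\<^sup>2" for c Z
  proof -
    let ?G = "\<lambda>i j. c * I1 i j - YH (T Z) i j"
    have col: "eigcol m c w (\<lambda>e\<in>?I. (if fst e = snd e then c else 0) - T Z e) i = ?G i m" if i: "i \<le> m" for i
    proof -
      have "(\<Sum>j<m. (\<lambda>e\<in>?I. (if fst e = snd e then c else 0) - T Z e) (i, j) * w j) =
        (\<Sum>j<m. (if i = j then c * w j else 0)) - (\<Sum>j<m. T Z (i, j) * w j)"
        using i unfolding sum_subtractf[symmetric] by (intro sum.cong refl) (simp add: left_diff_distrib)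
      also have "(\<Sum>j<m. (if i = j then c * w j else 0)) = (if i < m then c * w i else 0)"
        by (simp add: sum.delta')
      finally show ?thesis using i unfolding eigcol_def eigvec_def I1_def YH_def by simp
    qed
    have "(\<Sum>e\<in>?I. (norm ((if fst e = snd e then c else 0) - T Z e))\<^sup>2) + 
      (\<Sum>i\<le>m. (norm (eigcol m c w (\<lambda>e\<in>?I. (if fst e = snd e then c else 0) - T Z e) i))\<^sup>2) =
      (\<Sum>e\<in>?I. (norm (?G (fst e) (snd e)))\<^sup>2) + (\<Sum>i\<le>m. (norm (?G i m))\<^sup>2)"
      using col by (intro arg_cong2[where f = "(+)"] sum.cong refl) (auto simp: I1_def YH_def)
    also have "\<dots> = (\<Sum>i\<le>m. \<Sum>j\<le>m. (norm (?G i j))\<^sup>2)" by (rule split2[symmetric])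
    also have "\<dots> = (\<Sum>i\<le>m. \<Sum>j\<le>m. (norm (cH (\<lambda>i j. c * I1 i j - ZH Z i j) i j))\<^sup>2)"
    proof (intro sum.cong refl)
      fix i j assume "i \<in> {..m}" "j \<in> {..m}"
      then have ij: "i \<le> m" "j \<le> m" by auto
      have "cH (\<lambda>i j. c * I1 i j - ZH Z i j) i j = c * cH I1 i j - cH (ZH Z) i j"
        by (simp add: cH_def mmul_def algebra_simps sum_subtractf sum_distrib_left)
      also have "cH I1 i j = mmul m H H i j" unfolding cH_def using ij by (intro mmul_cong refl) (simp add: I1l)
      also have "\<dots> = I1 i j" by (rule HHm[OF ij])
      finally show "(norm (?G i j))\<^sup>2 = (norm (cH (\<lambda>i j. c * I1 i j - ZH Z i j) i j))\<^sup>2"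
        using YHT[OF ij, of Z] by simp
    qed
    also have "\<dots> = (\<Sum>i\<le>m. \<Sum>j\<le>m. (norm (c * I1 i j - ZH Z i j))\<^sup>2)" by (rule frob)
    also have "\<dots> = (\<Sum>e\<in>?I. (norm (c * I1 (fst e) (snd e) - ZH Z (fst e) (snd e)))\<^sup>2) + (\<Sum>i\<le>m. (norm (c * I1 i m - ZH Z i m))\<^sup>2)"
      by (rule split2)
    also have "(\<Sum>i\<le>m. (norm (c * I1 i m - ZH Z i m))\<^sup>2) = (\<Sum>i\<le>m. if i = m then (norm c)\<^sup>2 else 0)"
      by (intro sum.cong refl) (simp add: I1_def ZH_def)
    also have "\<dots> = (norm c)\<^sup>2" by simp
    also have "(\<Sum>e\<in>?I. (norm (c * I1 (fst e) (snd e) - ZH Z (fst e) (snd e)))\<^sup>2) = (\<Sum>e\<in>?I. (norm ((if fst e = snd e then c else 0) - Z e))\<^sup>2)"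
      by (intro sum.cong refl) (auto simp: I1_def ZH_def)
    finally show ?thesis .
  qed
  define J where "J = (\<integral>\<^sup>+x. gauss_weight 1 ?I (S x) \<partial>leb ?I) / ennreal (pi ^ card ?I)"
  have main: "(\<integral>\<^sup>+C. incidence_weight t m c w C \<partial>leb ?I) =
     (J * ennreal \<kappa>) * ennreal (exp (- (t * (norm c)\<^sup>2))) *
     (\<integral>\<^sup>+Z. ennreal ((norm (Determinant.det (shifted_mat m c Z)))\<^sup>2) * gauss_weight t ?I Z \<partial>leb ?I)" for c t
  proof -
    let ?d = "\<lambda>e :: nat \<times> nat. if fst e = snd e then c else 0"
    have iw: "incidence_weight t m c w \<in> borel_measurable (leb ?I)"
    proof -
      have "(\<lambda>C. Determinant.det (bordered_mat m c w C)) \<in> borel_measurable (leb ?I)"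
      proof (rule measurable_det)
        fix i j assume "i < Suc m" "j < Suc m"
        then show "(\<lambda>C. bordered_mat m c w C $$ (i, j)) \<in> borel_measurable (leb ?I)"
          by (cases "j < m") (simp_all add: bordered_mat_def ent)
      qed (simp add: bordered_mat_def)
      moreover have "(\<lambda>C. \<Sum>i\<le>m. (norm (eigcol m c w C i))\<^sup>2) \<in> borel_measurable (leb ?I)"
        unfolding eigcol_def by (intro borel_measurable_sum borel_measurable_power borel_measurable_norm borel_measurable_diff borel_measurable_times borel_measurable_const) (auto intro: ent)
      moreover have "(\<lambda>C. \<Sum>e\<in>?I. (norm (C e))\<^sup>2) \<in> borel_measurable (leb ?I)"
        by (intro borel_measurable_sum borel_measurable_power borel_measurable_norm) (auto intro: ent)
      ultimately show ?thesis unfolding incidence_weight_def[abs_def] by measurable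
    qed
    define f where "f Z = ennreal (\<kappa> * exp (- (t * (norm c)\<^sup>2))) * 
        (ennreal ((norm (Determinant.det (Matrix.mat m m Z)))\<^sup>2) * gauss_weight t ?I (\<lambda>e\<in>?I. ?d e - Z e))" for Z
    have detm: "(\<lambda>Z. Determinant.det (Matrix.mat m m Z)) \<in> borel_measurable (leb ?I)"
      by (rule measurable_det) (auto intro: ent)
    have re: "(\<lambda>Z. \<lambda>e\<in>?I. ?d e - Z e) \<in> leb ?I \<rightarrow>\<^sub>M leb ?I" by (rule measurable_leb_componentwise) auto
    have fm: "f \<in> borel_measurable (leb ?I)"
      unfolding f_def[abs_def] using detm re by measurable
    have fT: "incidence_weight t m c w (\<lambda>e\<in>?I. ?d e - T Z e) = f Z" for Z
    proof -
      have "bordered_mat m c w (\<lambda>e\<in>?I. ?d e - T Z e) = Matrix.mat (Suc m) (Suc m) (\<lambda>(i, j). if j < m then T Z (i, j) else ?v i)"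
        by (rule eq_matI) (auto simp: bordered_mat_def)
      then have d: "(norm (Determinant.det (bordered_mat m c w (\<lambda>e\<in>?I. ?d e - T Z e))))\<^sup>2 = \<kappa> * (norm (Determinant.det (Matrix.mat m m Z)))\<^sup>2"
        using det_eq[of Z] by simp
      have r: "(\<Sum>e\<in>?I. (norm ((\<lambda>e\<in>?I. ?d e - X e) e))\<^sup>2) = (\<Sum>e\<in>?I. (norm (?d e - X e))\<^sup>2)" for X
        by (intro sum.cong) auto
      have \<kappa>0: "\<kappa> \<ge> 0" by (simp add: \<kappa>_def)
      show ?thesis
        unfolding incidence_weight_def f_def d r exp_eq gauss_weight_def
        using \<kappa>0 by (simp add: ennreal_mult[symmetric] exp_add[symmetric] algebra_simps)
    qed
    have "(\<integral>\<^sup>+C. incidence_weight t m c w C \<partial>leb ?I) = (\<integral>\<^sup>+Y. incidence_weight t m c w (\<lambda>e\<in>?I. ?d e - Y e) \<partial>leb ?I)"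
      by (rule nn_integral_leb_reflect[OF fI iw, symmetric])
    also have "\<dots> = (\<integral>\<^sup>+Y. f (S Y) \<partial>leb ?I)"
      using fT[of "S _"] TS by (intro nn_integral_cong) metis
    also have "\<dots> = J * (\<integral>\<^sup>+Z. f Z \<partial>leb ?I)"
      unfolding J_def
    proof (rule nn_integral_additive_bijection[OF fI Sm Sadd _ fm])
      fix y assume "y \<in> space (leb ?I)"
      then show "\<exists>z\<in>space (leb ?I). S z = y" using ST Tsp by (intro bexI[of _ "T y"]) auto
    qed
    also have "(\<integral>\<^sup>+Z. f Z \<partial>leb ?I) = (\<integral>\<^sup>+Z. f (\<lambda>e\<in>?I. ?d e - Z e) \<partial>leb ?I)"
      by (rule nn_integral_leb_reflect[OF fI fm, symmetric])
    also have "\<dots> = (\<integral>\<^sup>+Z. ennreal (\<kappa> * exp (- (t * (norm c)\<^sup>2))) * 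
       (ennreal ((norm (Determinant.det (shifted_mat m c Z)))\<^sup>2) * gauss_weight t ?I Z) \<partial>leb ?I)"
    proof (rule nn_integral_cong)
      fix Z :: "nat \<times> nat \<Rightarrow> complex"
      have "Matrix.mat m m (\<lambda>e\<in>?I. ?d e - Z e) = shifted_mat m c Z"
        by (rule eq_matI) (auto simp: shifted_mat_def)
      moreover have "gauss_weight t ?I (\<lambda>e\<in>?I. ?d e - (\<lambda>e\<in>?I. ?d e - Z e) e) = gauss_weight t ?I Z"
        unfolding gauss_weight_def by (intro arg_cong[where f = "\<lambda>s. ennreal (exp (- (t * s)))"] sum.cong) auto
      ultimately show "f (\<lambda>e\<in>?I. ?d e - Z e) = ennreal (\<kappa> * exp (- (t * (norm c)\<^sup>2))) * 
         (ennreal ((norm (Determinant.det (shifted_mat m c Z)))\<^sup>2) * gauss_weight t ?I Z)"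
        unfolding f_def by simp
    qed
    also have "\<dots> = ennreal (\<kappa> * exp (- (t * (norm c)\<^sup>2))) * 
       (\<integral>\<^sup>+Z. ennreal ((norm (Determinant.det (shifted_mat m c Z)))\<^sup>2) * gauss_weight t ?I Z \<partial>leb ?I)"
    proof (rule nn_integral_cmult)
      have "(\<lambda>Z. Determinant.det (shifted_mat m c Z)) \<in> borel_measurable (leb ?I)"
        by (rule measurable_det) (auto simp: shifted_mat_def intro!: ent)
      then show "(\<lambda>Z. ennreal ((norm (Determinant.det (shifted_mat m c Z)))\<^sup>2) * gauss_weight t ?I Z) \<in> borel_measurable (leb ?I)"
        by measurable
    qed
    finally show ?thesis by (simp add: \<kappa>_def ennreal_mult mult.assoc)
  qed
  then show ?thesis by blast
qed

section \<open>Eigenvalue counts as integrals over slices\<close>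

lemma poly_poly_fun_char_poly_mat:
  assumes "\<And>i j. i < n \<Longrightarrow> j < n \<Longrightarrow> poly_fun I (\<lambda>y. a y (i, j))"
  shows "poly_poly_fun I (\<lambda>y. char_poly (Matrix.mat n n (a y)))"
  using assms by (intro poly_poly_fun_char_poly[where n = n]) auto

definition corner_set :: "nat \<Rightarrow> (nat \<times> nat) set" where
  "corner_set m = {..<Suc m} \<times> {..<Suc m} - {(m, m)}"

definition full_poly :: "nat \<Rightarrow> (nat \<times> nat \<Rightarrow> complex) \<Rightarrow> complex poly" where
  "full_poly m y = char_poly (Matrix.mat (Suc m) (Suc m) (\<lambda>p. if p = (m, m) then 0 else y p))"

definition minor_poly :: "nat \<Rightarrow> (nat \<times> nat \<Rightarrow> complex) \<Rightarrow> complex poly" where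
  "minor_poly m y = char_poly (Matrix.mat m m y)"

lemma degree_full_poly: "degree (full_poly m y) = Suc m"
  and degree_minor_poly: "degree (minor_poly m y) = m"
  unfolding full_poly_def minor_poly_def by (intro degree_monic_char_poly[THEN conjunct1] mat_carrier)+

lemma poly_poly_fun_full: "poly_poly_fun (corner_set m) (full_poly m)"
  unfolding full_poly_def[abs_def]
  by (rule poly_poly_fun_char_poly_mat) (auto simp: corner_set_def intro!: poly_fun_if poly_fun.intros)

lemma poly_poly_fun_minor: "poly_poly_fun (corner_set m) (minor_poly m)"
  unfolding minor_poly_def[abs_def]
  by (rule poly_poly_fun_char_poly_mat) (auto simp: corner_set_def intro!: poly_fun.intros)

lemma finite_corner_set [simp]: "finite (corner_set m)"
  by (simp add: corner_set_def)

text \<open>The permutation matrix of a cycle. Its leading minor is nilpotent while the matrix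
  itself is invertible, so the two characteristic polynomials have no common root.\<close>

definition cyclic_entries :: "nat \<Rightarrow> nat \<times> nat \<Rightarrow> complex" where
  "cyclic_entries m p = (if snd p = Suc (fst p) \<or> (fst p = m \<and> snd p = 0) then 1 else 0)"

lemma cyclic_minor_no_common_root:
  "\<not> (poly (minor_poly m (cyclic_entries m)) z = 0 \<and> poly (full_poly m (cyclic_entries m)) z = 0)"
proof
  assume *: "poly (minor_poly m (cyclic_entries m)) z = 0 \<and> poly (full_poly m (cyclic_entries m)) z = 0"
  let ?D = "Matrix.mat m m (cyclic_entries m)"
  let ?X = "Matrix.mat (Suc m) (Suc m) (\<lambda>p. if p = (m, m) then 0 else cyclic_entries m p)"
  have ut: "upper_triangular ?D" by (auto simp: upper_triangular_def cyclic_entries_def)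
  have "char_poly ?D = (\<Prod>a\<leftarrow>diag_mat ?D. [:- a, 1:])"
    by (rule char_poly_upper_triangular[OF _ ut]) auto
  also have "diag_mat ?D = replicate m 0"
    by (auto simp: diag_mat_def cyclic_entries_def list_eq_iff_nth_eq)
  finally have "poly (minor_poly m (cyclic_entries m)) z = z ^ m"
    by (simp add: minor_poly_def prod_list_replicate)
  with * have z: "z = 0" "m > 0" by (auto split: if_splits simp: power_0_left)
  have "eigenvalue ?X z"
    using * eigenvalue_root_char_poly[of ?X "Suc m" z] by (simp add: full_poly_def)
  then obtain v where v: "v \<in> carrier_vec (Suc m)" "v \<noteq> 0\<^sub>v (Suc m)" "?X *\<^sub>v v = z \<cdot>\<^sub>v v"
    by (auto simp: eigenvalue_def eigenvector_def)
  have Xv: "vec_index (?X *\<^sub>v v) i = 0" if "i < Suc m" for i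
    using v z that by simp
  have row: "vec_index (?X *\<^sub>v v) i = (\<Sum>j<Suc m. (if (i, j) = (m, m) then 0 else cyclic_entries m (i, j)) * vec_index v j)" if "i < Suc m" for i
    using v(1) that by (simp add: scalar_prod_def lessThan_atLeast0)
  have "vec_index v j = 0" if j: "j < Suc m" for j
  proof (cases j)
    case 0
    have "vec_index (?X *\<^sub>v v) m = (\<Sum>j<Suc m. if j = 0 then vec_index v j else 0)"
      unfolding row[OF lessI] using z by (intro sum.cong refl) (auto simp: cyclic_entries_def)
    also have "\<dots> = vec_index v 0" by (subst sum.delta) auto
    finally show ?thesis unfolding 0 using Xv[OF lessI] by (metis (no_types))
  next
    case (Suc i)
    have "vec_index (?X *\<^sub>v v) i = (\<Sum>l<Suc m. if l = Suc i then vec_index v l else 0)"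
      unfolding row[OF Suc_lessD[OF j[unfolded Suc]]] using z j Suc by (intro sum.cong refl) (auto simp: cyclic_entries_def)
    also have "\<dots> = vec_index v (Suc i)" using j Suc by (subst sum.delta) auto
    finally show ?thesis unfolding Suc using Xv[OF Suc_lessD[OF j[unfolded Suc]]] by (metis (no_types))
  qed
  then have "v = 0\<^sub>v (Suc m)" using v(1) by (intro eq_vecI) auto
  with v show False by simp
qed

text \<open>This is how a common root becomes the vanishing of one polynomial function of the
  entries.\<close>

lemma resultant_zero_iff_common_root:
  fixes p q :: "complex poly"
  assumes "p \<noteq> 0"
  shows "resultant p q = 0 \<longleftrightarrow> (\<exists>z. poly p z = 0 \<and> poly q z = 0)"
proof -
  have "resultant p q = 0 \<longleftrightarrow> degree (gcd p q) \<noteq> 0" by (rule resultant_0_gcd)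
  also have "\<dots> \<longleftrightarrow> (\<exists>z. poly (gcd p q) z = 0)"
  proof
    assume "degree (gcd p q) \<noteq> 0"
    then show "\<exists>z. poly (gcd p q) z = 0"
      by (metis Fundamental_Theorem_Algebra.fundamental_theorem_of_algebra constant_degree)
  next
    assume "\<exists>z. poly (gcd p q) z = 0"
    then obtain z where z: "poly (gcd p q) z = 0" ..
    have nz: "gcd p q \<noteq> 0" using assms by simp
    show "degree (gcd p q) \<noteq> 0"
    proof
      assume "degree (gcd p q) = 0"
      then obtain c where "gcd p q = [:c:]" by (rule degree_eq_zeroE)
      with z nz show False by simp
    qed
  qed
  also have "\<dots> \<longleftrightarrow> (\<exists>z. poly p z = 0 \<and> poly q z = 0)"
    by (meson poly_eq_0_iff_dvd gcd_greatest_iff)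
  finally show ?thesis .
qed

text \<open>The resultant is a polynomial in the entries, and the cyclic matrix shows that it is
  not the zero polynomial.\<close>

lemma AE_no_common_root:
  "AE y in leb (corner_set m). \<forall>z. \<not> (poly (minor_poly m y) z = 0 \<and> poly (full_poly m y) z = 0)"
proof -
  have nz: "minor_poly m y \<noteq> 0" for y
    using degree_monic_char_poly[of "Matrix.mat m m y" m] by (auto simp: minor_poly_def)
  have "AE y in leb (corner_set m). resultant (minor_poly m y) (full_poly m y) \<noteq> 0"
  proof (rule poly_fun_nonzero_AE)
    show "poly_fun (corner_set m) (\<lambda>y. resultant (minor_poly m y) (full_poly m y))"
      by (rule poly_fun_resultant[OF poly_poly_fun_minor degree_minor_poly poly_poly_fun_full degree_full_poly])
    show "resultant (minor_poly m (cyclic_entries m)) (full_poly m (cyclic_entries m)) \<noteq> 0"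
      using cyclic_minor_no_common_root[of m] resultant_zero_iff_common_root[OF nz] by blast
  qed simp
  then show ?thesis
    by eventually_elim (use resultant_zero_iff_common_root[OF nz] in blast)
qed

text \<open>The determinant is affine in the corner entry, and the cofactor of that entry is the
  minor.\<close>

lemma char_poly_corner:
  "char_poly (Matrix.mat (Suc m) (Suc m) (y((m, m) := a))) = full_poly m y - Polynomial.smult a (minor_poly m y)"
proof -
  let ?A = "\<lambda>a. char_poly_matrix (Matrix.mat (Suc m) (Suc m) (y((m, m) := a)))"
  have cof: "cofactor (?A a) m j = cofactor (?A b) m j" for a b j
    unfolding cofactor_def
    by (intro arg_cong2[where f = "(*)"] refl arg_cong[where f = Determinant.det] eq_matI)
       (auto simp: mat_delete_def char_poly_matrix_def)
  have lap: "Determinant.det (?A a) = (\<Sum>j<Suc m. ?A a $$ (m, j) * cofactor (?A a) m j)" for a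
    by (rule laplace_expansion_row[symmetric, THEN sym]) auto
  have cmm: "cofactor (?A a) m m = minor_poly m y" for a
  proof -
    have "mat_delete (?A a) m m = char_poly_matrix (Matrix.mat m m y)"
      by (rule eq_matI) (auto simp: mat_delete_def char_poly_matrix_def)
    then show ?thesis by (simp add: cofactor_def minor_poly_def char_poly_def mult_2[symmetric] power_mult)
  qed
  have "Determinant.det (?A a) - Determinant.det (?A 0) = (\<Sum>j<Suc m. (?A a $$ (m, j) - ?A 0 $$ (m, j)) * cofactor (?A 0) m j)"
    unfolding lap sum_subtractf[symmetric] left_diff_distrib by (intro sum.cong refl) (simp add: cof[of a _ 0])
  also have "\<dots> = (\<Sum>j<Suc m. if j = m then [:- a:] * minor_poly m y else 0)"
  proof (rule sum.cong[OF refl])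
    fix j assume "j \<in> {..<Suc m}"
    then have "?A a $$ (m, j) - ?A 0 $$ (m, j) = (if j = m then [:- a:] else 0)"
      by (auto simp: char_poly_matrix_def)
    then show "(?A a $$ (m, j) - ?A 0 $$ (m, j)) * cofactor (?A 0) m j = (if j = m then [:- a:] * minor_poly m y else 0)"
      using cmm[of 0] by auto
  qed
  also have "\<dots> = - Polynomial.smult a (minor_poly m y)" by (simp add: sum.delta)
  finally have "Determinant.det (?A a) = Determinant.det (?A 0) - Polynomial.smult a (minor_poly m y)"
    by (simp add: algebra_simps)
  moreover have "Matrix.mat (Suc m) (Suc m) (y((m, m) := 0)) = Matrix.mat (Suc m) (Suc m) (\<lambda>p. if p = (m, m) then 0 else y p)"
    by (rule eq_matI) auto
  ultimately show ?thesis by (simp add: full_poly_def char_poly_def)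
qed

definition eig_count :: "nat \<Rightarrow> complex set \<Rightarrow> (nat \<times> nat \<Rightarrow> complex) \<Rightarrow> ennreal" where
  "eig_count n B X = (\<Sum>z\<in>#proots (char_poly (Matrix.mat n n X)). indicator B z)"

lemma poly_coeff_measurable: "poly_poly_fun I P \<Longrightarrow> (\<lambda>x. coeff (P x) k) \<in> borel_measurable (leb I)"
  by (rule poly_fun_measurable) (simp add: poly_poly_fun_def)

lemma eig_count_measurable:
  assumes B: "B \<in> sets borel"
  shows "eig_count n B \<in> borel_measurable (leb ({..<n} \<times> {..<n}))"
  unfolding eig_count_def[abs_def]
proof (rule root_count_measurable[OF _ _ _ B])
  have "poly_poly_fun ({..<n} \<times> {..<n}) (\<lambda>y. char_poly (Matrix.mat n n y))"
    by (rule poly_poly_fun_char_poly_mat) (auto intro!: poly_fun.intros)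
  then show "(\<lambda>x. coeff (char_poly (Matrix.mat n n x)) k) \<in> borel_measurable (leb ({..<n} \<times> {..<n}))" for k
    by (rule poly_coeff_measurable)
  show "degree (char_poly (Matrix.mat n n x)) = n" for x :: "nat \<times> nat \<Rightarrow> complex"
    by (rule degree_monic_char_poly[THEN conjunct1]) simp
  show "char_poly (Matrix.mat n n x) \<noteq> 0" for x :: "nat \<times> nat \<Rightarrow> complex"
    using degree_monic_char_poly[of "Matrix.mat n n x" n] by auto
qed

text \<open>The numerator of the derivative of \<open>full_poly m y / minor_poly m
  y\<close>.\<close>

definition wronskian :: "nat \<Rightarrow> (nat \<times> nat \<Rightarrow> complex) \<Rightarrow> complex poly" where
  "wronskian m y = pderiv (full_poly m y) * minor_poly m y - full_poly m y * pderiv (minor_poly m y)"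

text \<open>The contribution to the spectral density at \<open>z\<close> of the matrices whose
  entries outside the corner are \<open>y\<close>: the corner entry that makes \<open>z\<close> an
  eigenvalue is the value of the rational function at \<open>z\<close>, and the last factor is its
  Jacobian.\<close>

definition slice_density :: "real \<Rightarrow> nat \<Rightarrow> complex \<Rightarrow> (nat \<times> nat \<Rightarrow> complex) \<Rightarrow> ennreal" where
  "slice_density t m z y = gauss_weight t (corner_set m) y *
     (ennreal (exp (- (t * (norm (poly (full_poly m y) z / poly (minor_poly m y) z))\<^sup>2))) *
      ennreal ((norm (poly (wronskian m y) z / (poly (minor_poly m y) z)\<^sup>2))\<^sup>2))"

lemma slice_density_measurable_aux:
  fixes a b c d :: "'a \<Rightarrow> complex"
  assumes [measurable]: "g \<in> borel_measurable M" "a \<in> borel_measurable M" "b \<in> borel_measurable M"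
    "c \<in> borel_measurable M" "d \<in> borel_measurable M"
  shows "(\<lambda>x. g x * (ennreal (exp (- (t * (norm (a x / b x))\<^sup>2))) *
    ennreal ((norm ((c x * b x - a x * d x) / (b x)\<^sup>2))\<^sup>2))) \<in> borel_measurable M"
  by measurable

lemma slice_density_measurable:
  "(\<lambda>(y, z). slice_density t m z y) \<in> borel_measurable (leb (corner_set m) \<Otimes>\<^sub>M lborel)"
proof -
  let ?M = "leb (corner_set m) \<Otimes>\<^sub>M (lborel :: complex measure)"
  have c: "(\<lambda>x. coeff (full_poly m (fst x)) k) \<in> borel_measurable ?M"
     "(\<lambda>x. coeff (minor_poly m (fst x)) k) \<in> borel_measurable ?M" for k
    by (rule measurable_compose[OF measurable_fst poly_coeff_measurable[OF poly_poly_fun_full]],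
        rule measurable_compose[OF measurable_fst poly_coeff_measurable[OF poly_poly_fun_minor]])
  have c': "(\<lambda>x. coeff (pderiv (full_poly m (fst x))) k) \<in> borel_measurable ?M"
     "(\<lambda>x. coeff (pderiv (minor_poly m (fst x))) k) \<in> borel_measurable ?M" for k
    unfolding coeff_pderiv using c[of "Suc k"] by simp_all
  have s: "snd \<in> borel_measurable ?M" by (simp add: measurable_snd'')
  have e [measurable]: "(\<lambda>x. poly (full_poly m (fst x)) (snd x)) \<in> borel_measurable ?M"
    "(\<lambda>x. poly (minor_poly m (fst x)) (snd x)) \<in> borel_measurable ?M"
    "(\<lambda>x. poly (pderiv (full_poly m (fst x))) (snd x)) \<in> borel_measurable ?M"
    "(\<lambda>x. poly (pderiv (minor_poly m (fst x))) (snd x)) \<in> borel_measurable ?M"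
    using s by (auto intro!: poly_eval_measurable[where d = "Suc m"] c c' simp: degree_full_poly degree_minor_poly degree_pderiv)
  have "(\<lambda>x. gauss_weight t (corner_set m) (fst x)) \<in> borel_measurable ?M"
    by (rule measurable_compose[OF measurable_fst gauss_weight_measurable])
  then show ?thesis
    unfolding slice_density_def wronskian_def split_beta poly_diff poly_mult
    by (rule slice_density_measurable_aux) (rule e)+
qed

text \<open>With all entries but the corner \<open>a\<close> held fixed, the eigenvalues are the
  roots of the pencil \<open>full_poly - a minor_poly\<close>, so the average over
  \<open>a\<close> is the change of variables for pencils.\<close>

lemma eig_count_slices:
  assumes B [measurable]: "B \<in> sets borel"
  shows "(\<integral>\<^sup>+X. eig_count (Suc m) B X * gauss_weight t ({..<Suc m} \<times> {..<Suc m}) X \<partial>leb ({..<Suc m} \<times> {..<Suc m})) =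
    (\<integral>\<^sup>+z. (\<integral>\<^sup>+y. slice_density t m z y \<partial>leb (corner_set m)) * indicator B z \<partial>lborel)"
proof -
  let ?I = "{..<Suc m} \<times> {..<Suc m}" and ?J = "corner_set m"
  have I: "?I = insert (m, m) ?J" and nI: "(m, m) \<notin> ?J" by (auto simp: corner_set_def)
  interpret sJ: sigma_finite_measure "leb ?J" by (rule lebesgue_product.sigma_finite) simp
  interpret P: pair_sigma_finite "leb ?J" "lborel :: complex measure" ..
  have "(\<integral>\<^sup>+X. eig_count (Suc m) B X * gauss_weight t ?I X \<partial>leb ?I) =
     (\<integral>\<^sup>+y. (\<integral>\<^sup>+a. eig_count (Suc m) B (y((m, m) := a)) * gauss_weight t ?I (y((m, m) := a)) \<partial>lborel) \<partial>leb ?J)"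
    unfolding I using eig_count_measurable[OF B, of "Suc m"] nI unfolding I
    by (intro lebesgue_product.product_nn_integral_insert) auto
  also have "\<dots> = (\<integral>\<^sup>+y. (\<integral>\<^sup>+z. slice_density t m z y * indicator B z \<partial>lborel) \<partial>leb ?J)"
  proof (rule nn_integral_cong_AE, use AE_no_common_root[of m] in eventually_elim)
    fix y assume y: "\<forall>z. \<not> (poly (minor_poly m y) z = 0 \<and> poly (full_poly m y) z = 0)"
    have gw: "gauss_weight t ?I (y((m, m) := a)) = gauss_weight t ?J y * ennreal (exp (- (t * (norm a)\<^sup>2)))" for a
    proof -
      have "(\<Sum>i\<in>?I. (norm ((y((m, m) := a)) i))\<^sup>2) = (norm a)\<^sup>2 + (\<Sum>i\<in>?J. (norm (y i))\<^sup>2)"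
        unfolding I using nI by (auto intro!: sum.cong)
      then show ?thesis unfolding gauss_weight_def by (simp only: distrib_left minus_add_distrib exp_add ennreal_mult'' exp_ge_zero mult.commute)
    qed
    have ec: "eig_count (Suc m) B (y((m, m) := a)) = (\<Sum>z\<in>#proots (full_poly m y - Polynomial.smult a (minor_poly m y)). indicator B z)" for a
      unfolding eig_count_def char_poly_corner ..
    let ?F = "\<lambda>a. ennreal (exp (- (t * (norm a)\<^sup>2)))"
    have "(\<integral>\<^sup>+a. eig_count (Suc m) B (y((m, m) := a)) * gauss_weight t ?I (y((m, m) := a)) \<partial>lborel) =
      (\<integral>\<^sup>+a. gauss_weight t ?J y * (?F a * eig_count (Suc m) B (y((m, m) := a))) \<partial>lborel)"
      unfolding gw by (intro nn_integral_cong) (simp add: mult_ac)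
    also have "\<dots> = gauss_weight t ?J y * (\<integral>\<^sup>+a. ?F a * eig_count (Suc m) B (y((m, m) := a)) \<partial>lborel)"
    proof (rule nn_integral_cmult)
      have "(\<lambda>a. eig_count (Suc m) B (y((m, m) := a))) \<in> borel_measurable lborel"
        unfolding eig_count_def char_poly_corner
      proof (rule root_count_measurable[OF _ _ _ B])
        have d: "degree (full_poly m y - Polynomial.smult a (minor_poly m y)) = Suc m" for a
        proof -
          have "degree (Polynomial.smult (- a) (minor_poly m y)) < degree (full_poly m y)"
            using degree_smult_le[of "- a" "minor_poly m y"] by (simp add: degree_full_poly degree_minor_poly)
          then have "degree (full_poly m y + Polynomial.smult (- a) (minor_poly m y)) = degree (full_poly m y)"
            by (rule degree_add_eq_left)
          then show ?thesis by (simp add: degree_full_poly)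
        qed
        then show "degree (full_poly m y - Polynomial.smult a (minor_poly m y)) = Suc m" for a .
        show "full_poly m y - Polynomial.smult a (minor_poly m y) \<noteq> 0" for a using d[of a] by auto
      qed simp
      then show "(\<lambda>a. ?F a * eig_count (Suc m) B (y((m, m) := a))) \<in> borel_measurable lborel" by measurable
    qed
    also have "(\<integral>\<^sup>+a. ?F a * eig_count (Suc m) B (y((m, m) := a)) \<partial>lborel) =
      (\<integral>\<^sup>+z. ?F (poly (full_poly m y) z / poly (minor_poly m y) z) *
         (ennreal ((norm (poly (wronskian m y) z / (poly (minor_poly m y) z)\<^sup>2))\<^sup>2) * indicator B z) \<partial>lborel)"
      unfolding ec using y B
      by (intro nn_integral_roots_pencil) (auto simp: degree_full_poly degree_minor_poly wronskian_def)
    also have "gauss_weight t ?J y * \<dots> = (\<integral>\<^sup>+z. gauss_weight t ?J y * (?F (poly (full_poly m y) z / poly (minor_poly m y) z) *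
         (ennreal ((norm (poly (wronskian m y) z / (poly (minor_poly m y) z)\<^sup>2))\<^sup>2) * indicator B z)) \<partial>lborel)"
      using B by (intro nn_integral_cmult[symmetric]) measurable
    also have "\<dots> = (\<integral>\<^sup>+z. slice_density t m z y * indicator B z \<partial>lborel)"
      by (simp add: slice_density_def mult_ac)
    finally show "(\<integral>\<^sup>+a. eig_count (Suc m) B (y((m, m) := a)) * gauss_weight t ?I (y((m, m) := a)) \<partial>lborel) =
      (\<integral>\<^sup>+z. slice_density t m z y * indicator B z \<partial>lborel)" .
  qed
  also have "\<dots> = (\<integral>\<^sup>+z. (\<integral>\<^sup>+y. slice_density t m z y * indicator B z \<partial>leb ?J) \<partial>lborel)"
  proof (rule P.Fubini'[symmetric])
    have "(\<lambda>x. indicator B (snd x) :: ennreal) \<in> borel_measurable (leb ?J \<Otimes>\<^sub>M lborel)"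
      using B by (intro measurable_compose[OF measurable_snd]) simp
    then show "(\<lambda>(y, z). slice_density t m z y * indicator B z) \<in> borel_measurable (leb ?J \<Otimes>\<^sub>M lborel)"
      using slice_density_measurable[of t m] unfolding split_beta by (intro borel_measurable_times_ennreal)
  qed
  also have "\<dots> = (\<integral>\<^sup>+z. (\<integral>\<^sup>+y. slice_density t m z y \<partial>leb ?J) * indicator B z \<partial>lborel)"
    using measurable_compose[OF measurable_Pair2' slice_density_measurable[of t m]]
    by (intro nn_integral_cong nn_integral_multc) (auto simp: split_beta)
  finally show ?thesis .
qed

section \<open>From slices to planted eigenvectors\<close>

lemma poly_char_poly_eq_det: "poly (char_poly (Matrix.mat n n a)) z = Determinant.det (shifted_mat n z a)"
proof -
  let ?A = "char_poly_matrix (Matrix.mat n n a)"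
  have "poly (char_poly (Matrix.mat n n a)) z = (\<Sum>p | p permutes {0..<n}. signof p * (\<Prod>i = 0..<n. poly (?A $$ (i, p i)) z))"
    unfolding char_poly_def
    by (subst Determinant.det_def'[of _ n]) (auto simp: poly_sum poly_prod sign_def intro!: sum.cong)
  also have "\<dots> = Determinant.det (shifted_mat n z a)"
    by (subst Determinant.det_def'[of _ n])
       (auto simp: shifted_mat_def char_poly_matrix_def intro!: sum.cong prod.cong dest: permutes_in_image)
  finally show ?thesis .
qed

text \<open>A column is indexed by pairs; this identifies it with a vector.\<close>

lemma nn_integral_leb_column:
  assumes f: "f \<in> borel_measurable (leb ({..<m} \<times> {k}))"
  shows "(\<integral>\<^sup>+b. f b \<partial>leb ({..<m} \<times> {k})) = (\<integral>\<^sup>+b. f (\<lambda>e\<in>{..<m} \<times> {k}. b (fst e)) \<partial>leb {..<m :: nat})"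
proof -
  let ?I = "{..<m} \<times> {k}" and ?T = "\<lambda>b. \<lambda>e\<in>{..<m} \<times> {k}. b (fst e) :: complex"
  have T: "?T \<in> leb {..<m} \<rightarrow>\<^sub>M leb ?I"
    by (intro measurable_restrict measurable_component_singleton) auto
  have "distr (leb {..<m}) (leb ?I) ?T = leb ?I"
  proof (rule lebesgue_product.PiM_eqI)
    fix A :: "nat \<times> 'a \<Rightarrow> complex set" assume A: "\<And>i. i \<in> ?I \<Longrightarrow> A i \<in> sets lborel"
    have "?T -` Pi\<^sub>E ?I A \<inter> space (leb {..<m}) = Pi\<^sub>E {..<m} (\<lambda>i. A (i, k))"
      by (auto simp: space_PiM PiE_iff)
    then have "emeasure (distr (leb {..<m}) (leb ?I) ?T) (Pi\<^sub>E ?I A) = emeasure (leb {..<m}) (Pi\<^sub>E {..<m} (\<lambda>i. A (i, k)))"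
      using A T by (subst emeasure_distr) (auto intro!: sets_PiM_I_finite)
    also have "\<dots> = (\<Prod>i<m. emeasure lborel (A (i, k)))"
      using A by (intro lebesgue_product.emeasure_PiM) auto
    also have "\<dots> = (\<Prod>e\<in>?I. emeasure lborel (A e))"
      by (rule prod.reindex_bij_witness[of _ fst "\<lambda>i. (i, k)"]) auto
    finally show "emeasure (distr (leb {..<m}) (leb ?I) ?T) (Pi\<^sub>E ?I A) = (\<Prod>e\<in>?I. emeasure lborel (A e))" .
  qed simp_all
  then have "(\<integral>\<^sup>+b. f b \<partial>leb ?I) = nn_integral (distr (leb {..<m}) (leb ?I) ?T) f" by simp
  also have "\<dots> = (\<integral>\<^sup>+b. f (?T b) \<partial>leb {..<m})" using T f by (intro nn_integral_distr) auto
  finally show ?thesis .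
qed

text \<open>Adding to the last column of \<open>\<zeta> I - X\<close> the combination of the
  others that forms the eigenvector multiplies out to \<open>(\<zeta> - z)\<close> times that
  eigenvector.\<close>

lemma det_planted_eigenvector:
  assumes X: "\<And>i j. i \<le> m \<Longrightarrow> j < m \<Longrightarrow> X (i, j) = C (i, j)" "\<And>i. i \<le> m \<Longrightarrow> X (i, m) = eigcol m z w C i"
  shows "Determinant.det (shifted_mat (Suc m) \<zeta> X) = (\<zeta> - z) * Determinant.det (bordered_mat m \<zeta> w C)"
proof -
  let ?S = "shifted_mat (Suc m) \<zeta> X" and ?B = "bordered_mat m \<zeta> w C"
  (* P performs the column operation, and G scales the last column. *)
  define P where "P = Matrix.mat (Suc m) (Suc m) (\<lambda>(i, j). if j = m then eigvec m w i else if i = j then 1 else 0)"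
  define G where "G = Matrix.mat (Suc m) (Suc m) (\<lambda>(i, j). if i = j then (if j = m then \<zeta> - z else 1) else 0 :: complex)"
  have dP: "Determinant.det P = 1"
  proof -
    have "upper_triangular P" by (auto simp: P_def)
    then have "Determinant.det P = (\<Prod>i = 0..<Suc m. P $$ (i, i))"
      using det_upper_triangular[of P "Suc m"] by (simp add: P_def prod_list_diag_prod)
    also have "\<dots> = (\<Prod>i = 0..<Suc m. 1)" by (intro prod.cong) (auto simp: P_def eigvec_def)
    finally show ?thesis by simp
  qed
  have dG: "Determinant.det G = \<zeta> - z"
  proof -
    have "upper_triangular G" by (auto simp: G_def)
    then have "Determinant.det G = (\<Prod>i = 0..<Suc m. G $$ (i, i))"
      using det_upper_triangular[of G "Suc m"] by (simp add: G_def prod_list_diag_prod)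
    also have "\<dots> = (\<Prod>i = 0..<m. 1) * (\<zeta> - z)" by (simp add: G_def)
    finally show ?thesis by simp
  qed
  have "?S * P = ?B * G"
  proof (rule eq_matI)
    fix i j assume "i < dim_row (?B * G)" "j < dim_col (?B * G)"
    then have ij: "i \<le> m" "j \<le> m" by (auto simp: bordered_mat_def G_def)
    have sp: "(\<Sum>k = 0..<Suc m. f k) = (\<Sum>k<m. f k) + f m" for f :: "nat \<Rightarrow> complex"
      by (simp add: atLeast0LessThan)
    have L: "(?S * P) $$ (i, j) = (\<Sum>k<m. ?S $$ (i, k) * P $$ (k, j)) + ?S $$ (i, m) * P $$ (m, j)"
      using ij by (simp add: shifted_mat_def P_def scalar_prod_def sp del: sum.op_ivl_Suc)
    have R: "(?B * G) $$ (i, j) = (\<Sum>k<m. ?B $$ (i, k) * G $$ (k, j)) + ?B $$ (i, m) * G $$ (m, j)"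
      using ij by (simp add: bordered_mat_def G_def scalar_prod_def sp del: sum.op_ivl_Suc)
    show "(?S * P) $$ (i, j) = (?B * G) $$ (i, j)"
    proof (cases "j = m")
      case False
      then have j: "j < m" using ij by simp
      have "(\<Sum>k<m. ?S $$ (i, k) * P $$ (k, j)) = (\<Sum>k<m. if k = j then ?S $$ (i, j) else 0)"
        using ij j by (intro sum.cong refl) (auto simp: P_def)
      moreover have "(\<Sum>k<m. ?B $$ (i, k) * G $$ (k, j)) = (\<Sum>k<m. if k = j then ?B $$ (i, j) else 0)"
        using ij j by (intro sum.cong refl) (auto simp: G_def)
      moreover have "P $$ (m, j) = 0" "G $$ (m, j) = 0" using j by (auto simp: P_def G_def)
      ultimately show ?thesis unfolding L R using ij j X(1) by (simp add: shifted_mat_def bordered_mat_def)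
    next
      case True
      have "(\<Sum>k<m. ?S $$ (i, k) * P $$ (k, j)) = (\<Sum>k<m. (if i = k then \<zeta> * w k else 0) - C (i, k) * w k)"
        using ij True X(1) by (intro sum.cong refl) (auto simp: shifted_mat_def P_def eigvec_def algebra_simps)
      also have "\<dots> = (if i < m then \<zeta> * w i else 0) - (\<Sum>k<m. C (i, k) * w k)"
        by (simp add: sum_subtractf sum.delta')
      finally have l: "(?S * P) $$ (i, j) = (if i < m then \<zeta> * w i else 0) - (\<Sum>k<m. C (i, k) * w k) + ((if i = m then \<zeta> else 0) - eigcol m z w C i)"
        unfolding L using ij True X(2) by (simp add: shifted_mat_def P_def eigvec_def)
      have "(\<Sum>k<m. ?B $$ (i, k) * G $$ (k, j)) = 0" using True by (intro sum.neutral) (auto simp: G_def)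
      then have "(?B * G) $$ (i, j) = eigvec m w i * (\<zeta> - z)"
        unfolding R using ij True by (simp add: bordered_mat_def G_def)
      then show ?thesis unfolding l using ij by (auto simp: eigcol_def eigvec_def algebra_simps)
    qed
  qed (auto simp: shifted_mat_def bordered_mat_def P_def G_def)
  then have "Determinant.det ?S * Determinant.det P = Determinant.det ?B * Determinant.det G"
    using det_mult[of ?S "Suc m" P] det_mult[of ?B "Suc m" G]
    by (simp add: shifted_mat_def bordered_mat_def P_def G_def)
  then show ?thesis by (simp add: dP dG mult.commute)
qed

lemma continuous_det_bordered: "isCont (\<lambda>\<zeta>. Determinant.det (bordered_mat m \<zeta> w C)) z"
proof -
  have "isCont (\<lambda>\<zeta>. \<Sum>p | p permutes {0..<Suc m}. signof p * (\<Prod>i = 0..<Suc m. bordered_mat m \<zeta> w C $$ (i, p i))) z"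
  proof (intro continuous_sum continuous_mult continuous_const continuous_prod)
    fix p i assume "p \<in> {p. p permutes {0..<Suc m}}" "i \<in> {0..<Suc m}"
    then have "i < Suc m" "p i < Suc m" using permutes_in_image[of p "{0..<Suc m}" i] by auto
    then show "isCont (\<lambda>\<zeta>. bordered_mat m \<zeta> w C $$ (i, p i)) z"
      by (cases "p i < m"; cases "i = p i") (simp_all add: bordered_mat_def)
  qed
  then show ?thesis by (subst Determinant.det_def'[of _ "Suc m"]) (simp_all add: bordered_mat_def)
qed

text \<open>The entries outside the corner, assembled from the first columns \<open>C\<close> and
  the upper part \<open>b\<close> of the last one.\<close>

definition glue :: "nat \<Rightarrow> (nat \<times> nat \<Rightarrow> complex) \<Rightarrow> (nat \<Rightarrow> complex) \<Rightarrow> nat \<times> nat \<Rightarrow> complex" where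
  "glue m C b = merge (tall m) ({..<m} \<times> {m}) (C, \<lambda>e\<in>{..<m} \<times> {m}. b (fst e))"

lemma glue_simps:
  "i \<le> m \<Longrightarrow> j < m \<Longrightarrow> glue m C b (i, j) = C (i, j)" "i < m \<Longrightarrow> glue m C b (i, m) = b i"
  by (auto simp: glue_def merge_def)

text \<open>Substituting \<open>b = (z I - D) w\<close>, where \<open>D\<close> is the leading
  minor, makes \<open>(w, 1)\<close> an eigenvector to \<open>z\<close>. The characteristic
  polynomial then is \<open>\<zeta> - z\<close> times a bordered determinant, whose value at
  \<open>z\<close> is therefore its derivative there; this identifies the Jacobian of the corner
  entry, and the poles cancel against the Jacobian of the substitution.\<close>

lemma slice_density_glue:
  fixes m :: nat and C :: "nat \<times> nat \<Rightarrow> complex"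
  assumes nz: "Determinant.det (shifted_mat m z C) \<noteq> 0"
  shows "slice_density t m z (glue m C (mat_act m (shifted_mat m z C) w)) * ennreal ((norm (Determinant.det (shifted_mat m z C)))\<^sup>2)
    = incidence_weight t m z w C"
proof -
  define y where "y = glue m C (mat_act m (shifted_mat m z C) w)"
  define a where "a = eigcol m z w C m"
  let ?q = "minor_poly m y" and ?N = "full_poly m y" and ?X = "y((m, m) := a)"
  let ?\<beta> = "Determinant.det (bordered_mat m z w C)"
  have yC: "y (i, j) = C (i, j)" if "i \<le> m" "j < m" for i j
    using that by (simp add: y_def glue_simps)
  have yb: "y (i, m) = eigcol m z w C i" if i: "i < m" for i
  proof -
    have "y (i, m) = (\<Sum>j<m. ((if i = j then z else 0) - C (i, j)) * w j)"
      using i by (simp add: y_def glue_simps mat_act_def shifted_mat_def)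
    also have "\<dots> = (\<Sum>j<m. if i = j then z * w j else 0) - (\<Sum>j<m. C (i, j) * w j)"
      unfolding sum_subtractf[symmetric] by (intro sum.cong refl) (simp add: left_diff_distrib)
    also have "\<dots> = eigcol m z w C i" using i by (simp add: eigcol_def eigvec_def sum.delta')
    finally show ?thesis .
  qed
  have q: "poly ?q z = Determinant.det (shifted_mat m z C)"
  proof -
    have "shifted_mat m z y = shifted_mat m z C" by (rule eq_matI) (auto simp: shifted_mat_def yC)
    then show ?thesis by (simp add: minor_poly_def poly_char_poly_eq_det)
  qed
  let ?p = "?N - Polynomial.smult a ?q"
  have p: "poly ?p \<zeta> = (\<zeta> - z) * Determinant.det (bordered_mat m \<zeta> w C)" for \<zeta>
    unfolding char_poly_corner[symmetric] poly_char_poly_eq_det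
    by (rule det_planted_eigenvector) (auto simp: yC yb a_def le_less)
  have N: "poly ?N z = a * poly ?q z" using p[of z] by simp
  (* The difference quotient at z is the bordered determinant itself. *)
  have dp: "poly (pderiv ?p) z = ?\<beta>"
  proof -
    have "((\<lambda>h. (poly ?p (z + h) - poly ?p z) / h) \<longlongrightarrow> poly (pderiv ?p) z) (at 0)"
      using poly_DERIV[of ?p z] by (simp add: DERIV_def)
    moreover have "((\<lambda>h. (poly ?p (z + h) - poly ?p z) / h) \<longlongrightarrow> ?\<beta>) (at 0)"
    proof (rule Lim_transform_eventually)
      show "((\<lambda>h. Determinant.det (bordered_mat m (z + h) w C)) \<longlongrightarrow> ?\<beta>) (at 0)"
        using continuous_det_bordered[where m = m and w = w and C = C and z = z] by (simp add: isCont_iff)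
      show "eventually (\<lambda>h. Determinant.det (bordered_mat m (z + h) w C) = (poly ?p (z + h) - poly ?p z) / h) (at 0)"
        unfolding eventually_at_filter p by (rule always_eventually) simp
    qed
    ultimately show ?thesis by (rule tendsto_unique[rotated]) simp
  qed
  have W: "poly (wronskian m y) z = ?\<beta> * poly ?q z"
    unfolding dp[symmetric] by (simp add: wronskian_def N pderiv_diff pderiv_smult algebra_simps)
  have Wq: "(norm (poly (wronskian m y) z / (poly ?q z)\<^sup>2))\<^sup>2 * (norm (Determinant.det (shifted_mat m z C)))\<^sup>2 = (norm ?\<beta>)\<^sup>2"
    using nz unfolding W q by (simp add: norm_divide norm_mult power2_eq_square)
  have Nq: "poly ?N z / poly ?q z = a" using nz N q by simp
  have "corner_set m = tall m \<union> {..<m} \<times> {m}" by (auto simp: corner_set_def)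
  then have "(\<Sum>e\<in>corner_set m. (norm (y e))\<^sup>2) = (\<Sum>e\<in>tall m. (norm (y e))\<^sup>2) + (\<Sum>e\<in>{..<m} \<times> {m}. (norm (y e))\<^sup>2)"
    by (simp only:) (rule sum.union_disjoint, auto)
  also have "(\<Sum>e\<in>tall m. (norm (y e))\<^sup>2) = (\<Sum>e\<in>tall m. (norm (C e))\<^sup>2)"
    by (intro sum.cong refl) (auto simp: yC)
  also have "(\<Sum>e\<in>{..<m} \<times> {m}. (norm (y e))\<^sup>2) = (\<Sum>i<m. (norm (eigcol m z w C i))\<^sup>2)"
    by (rule sum.reindex_bij_witness[of _ "\<lambda>i. (i, m)" fst]) (auto simp: yb)
  finally have s: "(\<Sum>e\<in>corner_set m. (norm (y e))\<^sup>2) + (norm a)\<^sup>2 =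
     (\<Sum>e\<in>tall m. (norm (C e))\<^sup>2) + (\<Sum>i\<le>m. (norm (eigcol m z w C i))\<^sup>2)"
    by (simp add: a_def lessThan_Suc_atMost[symmetric])
  have "slice_density t m z y * ennreal ((norm (Determinant.det (shifted_mat m z C)))\<^sup>2) =
    (gauss_weight t (corner_set m) y * ennreal (exp (- (t * (norm a)\<^sup>2)))) *
    (ennreal ((norm (poly (wronskian m y) z / (poly ?q z)\<^sup>2))\<^sup>2) * ennreal ((norm (Determinant.det (shifted_mat m z C)))\<^sup>2))"
    by (simp add: slice_density_def Nq mult_ac)
  also have "ennreal ((norm (poly (wronskian m y) z / (poly ?q z)\<^sup>2))\<^sup>2) * ennreal ((norm (Determinant.det (shifted_mat m z C)))\<^sup>2) = ennreal ((norm ?\<beta>)\<^sup>2)"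
    by (subst ennreal_mult[symmetric]) (simp_all only: Wq zero_le_power2)
  also have "gauss_weight t (corner_set m) y * ennreal (exp (- (t * (norm a)\<^sup>2))) =
      ennreal (exp (- (t * ((\<Sum>e\<in>corner_set m. (norm (y e))\<^sup>2) + (norm a)\<^sup>2))))"
    unfolding gauss_weight_def by (subst ennreal_mult[symmetric]) (simp_all add: exp_add[symmetric] distrib_left)
  finally show ?thesis unfolding s by (simp add: incidence_weight_def y_def mult.commute)
qed

lemma incidence_weight_measurable:
  "(\<lambda>(w, C). incidence_weight t m z w C) \<in> borel_measurable (leb {..<m} \<Otimes>\<^sub>M leb (tall m))"
proof -
  let ?M = "leb {..<m} \<Otimes>\<^sub>M leb (tall m)"
  have w: "(\<lambda>x. fst x i) \<in> borel_measurable ?M" if "i < m" for i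
    using measurable_compose[OF measurable_fst measurable_component_singleton[of i "{..<m}" "\<lambda>_. lborel"]] that by simp
  have C: "(\<lambda>x. snd x (i, j)) \<in> borel_measurable ?M" if "i \<le> m" "j < m" for i j
    using measurable_compose[OF measurable_snd measurable_component_singleton[of "(i, j)" "tall m" "\<lambda>_. lborel"]] that by simp
  have v: "(\<lambda>x. eigvec m (fst x) i) \<in> borel_measurable ?M" for i
    unfolding eigvec_def by (cases "i < m") (simp_all add: w)
  have [measurable]: "(\<lambda>x. Determinant.det (bordered_mat m z (fst x) (snd x))) \<in> borel_measurable ?M"
  proof (rule measurable_det)
    fix i j assume "i < Suc m" "j < Suc m"
    then show "(\<lambda>x. bordered_mat m z (fst x) (snd x) $$ (i, j)) \<in> borel_measurable ?M"
      by (cases "j < m") (simp_all add: bordered_mat_def C v)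
  qed (simp add: bordered_mat_def)
  have ecol: "(\<lambda>x. eigcol m z (fst x) (snd x) i) \<in> borel_measurable ?M" if "i \<le> m" for i
    unfolding eigcol_def
    by (intro borel_measurable_diff borel_measurable_times borel_measurable_const borel_measurable_sum v)
       (auto intro: C w that)
  have [measurable]: "(\<lambda>x. \<Sum>i\<le>m. (norm (eigcol m z (fst x) (snd x) i))\<^sup>2) \<in> borel_measurable ?M"
    by (intro borel_measurable_sum borel_measurable_power measurable_compose[OF ecol borel_measurable_norm]) auto
  have [measurable]: "(\<lambda>x. \<Sum>e\<in>tall m. (norm (snd x e))\<^sup>2) \<in> borel_measurable ?M"
    by (intro borel_measurable_sum borel_measurable_power borel_measurable_norm) (auto intro: C)
  show ?thesis unfolding incidence_weight_def split_beta by measurable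
qed

text \<open>The substitution needs \<open>z I - D\<close> to be invertible, which fails only on a
  null set of \<open>C\<close>.\<close>

lemma nn_integral_slice_density:
  "(\<integral>\<^sup>+y. slice_density t m z y \<partial>leb (corner_set m)) = 
   (\<integral>\<^sup>+w. (\<integral>\<^sup>+C. incidence_weight t m z w C \<partial>leb (tall m)) \<partial>leb {..<m})"
proof -
  let ?col = "{..<m} \<times> {m}"
  have cs: "corner_set m = tall m \<union> ?col" and disj: "tall m \<inter> ?col = {}" by (auto simp: corner_set_def)
  interpret s1: sigma_finite_measure "leb {..<m}" by (rule lebesgue_product.sigma_finite) simp
  interpret s2: sigma_finite_measure "leb (tall m)" by (rule lebesgue_product.sigma_finite) simp
  interpret P: pair_sigma_finite "leb {..<m}" "leb (tall m)" ..
  have sm: "slice_density t m z \<in> borel_measurable (leb (tall m \<union> ?col))"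
    using measurable_compose[OF measurable_Pair2' slice_density_measurable[of t m], of z]
    by (simp add: cs)
  have mm: "(\<lambda>b. slice_density t m z (merge (tall m) ?col (C, b))) \<in> borel_measurable (leb ?col)" if "C \<in> space (leb (tall m))" for C
    using measurable_compose[OF measurable_Pair1'[OF that] measurable_compose[OF measurable_merge sm]] by simp
  have "(\<integral>\<^sup>+y. slice_density t m z y \<partial>leb (corner_set m)) =
    (\<integral>\<^sup>+C. (\<integral>\<^sup>+b. slice_density t m z (merge (tall m) ?col (C, b)) \<partial>leb ?col) \<partial>leb (tall m))"
    unfolding cs using sm disj by (intro lebesgue_product.product_nn_integral_fold) auto
  also have "\<dots> = (\<integral>\<^sup>+C. (\<integral>\<^sup>+w. incidence_weight t m z w C \<partial>leb {..<m}) \<partial>leb (tall m))"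
  proof (rule nn_integral_cong_AE)
    have "AE C in leb (tall m). Determinant.det (shifted_mat m z C) \<noteq> 0"
    proof (rule poly_fun_nonzero_AE)
      show "poly_fun (tall m) (\<lambda>C. Determinant.det (shifted_mat m z C))"
      proof (rule poly_fun_det[where n = m])
        fix i j assume "i < m" "j < m"
        then have "poly_fun (tall m) (\<lambda>C. (if i = j then z else 0) + (-1) * C (i, j))"
          by (intro poly_fun.add poly_fun.mult poly_fun.const poly_fun.coord) auto
        then show "poly_fun (tall m) (\<lambda>C. shifted_mat m z C $$ (i, j))"
          using \<open>i < m\<close> \<open>j < m\<close> by (simp add: shifted_mat_def)
      qed (simp add: shifted_mat_def)
      have "shifted_mat m z (\<lambda>e. if fst e = snd e then z - 1 else 0) = 1\<^sub>m m"
        by (rule eq_matI) (auto simp: shifted_mat_def)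
      then show "Determinant.det (shifted_mat m z (\<lambda>e. if fst e = snd e then z - 1 else 0)) \<noteq> 0" by simp
    qed simp
    then show "AE C in leb (tall m). (\<integral>\<^sup>+b. slice_density t m z (merge (tall m) ?col (C, b)) \<partial>leb ?col) =
       (\<integral>\<^sup>+w. incidence_weight t m z w C \<partial>leb {..<m})"
    proof (rule AE_mp, intro AE_I2 impI)
      fix C assume C: "C \<in> space (leb (tall m))" and nz: "Determinant.det (shifted_mat m z C) \<noteq> 0"
      have gm: "(\<lambda>b. slice_density t m z (glue m C b)) \<in> borel_measurable (leb {..<m})"
      proof -
        have "(\<lambda>b. \<lambda>e\<in>?col. b (fst e) :: complex) \<in> leb {..<m} \<rightarrow>\<^sub>M leb ?col"
          by (intro measurable_restrict measurable_component_singleton) auto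
        from measurable_compose[OF this mm[OF C]] show ?thesis by (simp add: glue_def)
      qed
      have "(\<integral>\<^sup>+b. slice_density t m z (merge (tall m) ?col (C, b)) \<partial>leb ?col) =
        (\<integral>\<^sup>+b. slice_density t m z (glue m C b) \<partial>leb {..<m})"
        unfolding glue_def by (rule nn_integral_leb_column[OF mm[OF C]])
      also have "\<dots> = (\<integral>\<^sup>+w. slice_density t m z (glue m C (mat_act m (shifted_mat m z C) w)) \<partial>leb {..<m}) *
          ennreal ((norm (Determinant.det (shifted_mat m z C)))\<^sup>2)"
        by (rule nn_integral_linear_substitution[OF _ nz gm]) (simp add: shifted_mat_def)
      also have "\<dots> = (\<integral>\<^sup>+w. slice_density t m z (glue m C (mat_act m (shifted_mat m z C) w)) *
          ennreal ((norm (Determinant.det (shifted_mat m z C)))\<^sup>2) \<partial>leb {..<m})"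
        by (rule nn_integral_multc[symmetric]) (rule measurable_compose[OF mat_act_measurable gm])
      also have "\<dots> = (\<integral>\<^sup>+w. incidence_weight t m z w C \<partial>leb {..<m})"
        by (simp only: slice_density_glue[OF nz])
      finally show "(\<integral>\<^sup>+b. slice_density t m z (merge (tall m) ?col (C, b)) \<partial>leb ?col) =
         (\<integral>\<^sup>+w. incidence_weight t m z w C \<partial>leb {..<m})" .
    qed
  qed
  also have "\<dots> = (\<integral>\<^sup>+w. (\<integral>\<^sup>+C. incidence_weight t m z w C \<partial>leb (tall m)) \<partial>leb {..<m})"
    by (rule P.Fubini') (rule incidence_weight_measurable)
  finally show ?thesis .
qed

lemma exp_neg_distrib: "exp (- (t * (a + b))) = exp (- (t * a)) * exp (- (t * b :: real))"
  by (simp add: exp_add[symmetric] distrib_left)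

text \<open>The last row of the rectangular matrix does not enter the determinant and integrates
  to a constant.\<close>

lemma nn_integral_det_gauss_weight:
  assumes t: "t > 0"
  shows "\<exists>\<kappa>. \<forall>z. (\<integral>\<^sup>+Z. ennreal ((norm (Determinant.det (shifted_mat m z Z)))\<^sup>2) * gauss_weight t (tall m) Z \<partial>leb (tall m)) =
    \<kappa> * ennreal (\<Sum>k\<le>m. (t * (norm z)\<^sup>2) ^ k / fact k)"
proof -
  let ?sq = "{..<m} \<times> {..<m}" and ?row = "{m} \<times> {..<m}"
  have tl: "tall m = ?sq \<union> ?row" and disj: "?sq \<inter> ?row = {}" by auto
  let ?d = "\<lambda>z Z. ennreal ((norm (Determinant.det (shifted_mat m z Z)))\<^sup>2)"
  let ?c = "(t / pi) ^ card ?sq"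
  have dm: "(\<lambda>Z. ?d z Z) \<in> borel_measurable (leb I)" if "?sq \<subseteq> I" for z I
  proof -
    have "(\<lambda>Z. Determinant.det (shifted_mat m z Z)) \<in> borel_measurable (leb I)"
    proof (rule measurable_det)
      fix i j assume ij: "i < m" "j < m"
      then have "(\<lambda>Z. Z (i, j)) \<in> borel_measurable (leb I)"
        using measurable_component_singleton[of "(i, j)" I "\<lambda>_. lborel"] that by auto
      then show "(\<lambda>Z. shifted_mat m z Z $$ (i, j)) \<in> borel_measurable (leb I)"
        using ij by (simp add: shifted_mat_def)
    qed (simp add: shifted_mat_def)
    then show ?thesis by measurable
  qed
  have "(\<integral>\<^sup>+Z. ?d z Z * gauss_weight t (tall m) Z \<partial>leb (tall m)) =
     (ennreal ((pi / t) ^ card ?row) * ennreal (1 / ?c * (fact m / t ^ m))) * ennreal (\<Sum>k\<le>m. (t * (norm z)\<^sup>2) ^ k / fact k)" for z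
  proof -
    have "(\<integral>\<^sup>+Z. ?d z Z * gauss_weight t (tall m) Z \<partial>leb (tall m)) =
      (\<integral>\<^sup>+x. (\<integral>\<^sup>+y. ?d z (merge ?sq ?row (x, y)) * gauss_weight t (tall m) (merge ?sq ?row (x, y)) \<partial>leb ?row) \<partial>leb ?sq)"
      unfolding tl using disj dm[of "?sq \<union> ?row" z] by (intro lebesgue_product.product_nn_integral_fold) auto
    also have "\<dots> = (\<integral>\<^sup>+x. (\<integral>\<^sup>+y. (?d z x * gauss_weight t ?sq x) * gauss_weight t ?row y \<partial>leb ?row) \<partial>leb ?sq)"
    proof (intro nn_integral_cong)
      fix x y :: "nat \<times> nat \<Rightarrow> complex"
      have "shifted_mat m z (merge ?sq ?row (x, y)) = shifted_mat m z x"
        by (rule eq_matI) (auto simp: shifted_mat_def merge_def)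
      moreover have "(\<Sum>i\<in>tall m. (norm (merge ?sq ?row (x, y) i))\<^sup>2) = (\<Sum>i\<in>?sq. (norm (x i))\<^sup>2) + (\<Sum>i\<in>?row. (norm (y i))\<^sup>2)"
        unfolding tl by (subst sum.union_disjoint) (auto simp: merge_def intro!: arg_cong2[where f = "(+)"] sum.cong)
      ultimately show "?d z (merge ?sq ?row (x, y)) * gauss_weight t (tall m) (merge ?sq ?row (x, y)) =
          (?d z x * gauss_weight t ?sq x) * gauss_weight t ?row y"
        unfolding gauss_weight_def
        by (simp only: exp_neg_distrib ennreal_mult'' exp_ge_zero mult.assoc)
    qed
    also have "\<dots> = ennreal ((pi / t) ^ card ?row) * (\<integral>\<^sup>+x. ?d z x * gauss_weight t ?sq x \<partial>leb ?sq)"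
    proof -
      have "(\<integral>\<^sup>+y. (?d z x * gauss_weight t ?sq x) * gauss_weight t ?row y \<partial>leb ?row) =
        (?d z x * gauss_weight t ?sq x) * ennreal ((pi / t) ^ card ?row)" for x
        using t by (subst nn_integral_cmult) (auto simp: nn_integral_gauss_weight)
      then have "(\<integral>\<^sup>+x. (\<integral>\<^sup>+y. (?d z x * gauss_weight t ?sq x) * gauss_weight t ?row y \<partial>leb ?row) \<partial>leb ?sq) =
        (\<integral>\<^sup>+x. (?d z x * gauss_weight t ?sq x) * ennreal ((pi / t) ^ card ?row) \<partial>leb ?sq)"
        by (simp only:)
      also have "\<dots> = (\<integral>\<^sup>+x. ?d z x * gauss_weight t ?sq x \<partial>leb ?sq) * ennreal ((pi / t) ^ card ?row)"
        by (intro nn_integral_multc borel_measurable_times_ennreal dm gauss_weight_measurable) auto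
      finally show ?thesis by (simp only: mult.commute)
    qed
    also have "(\<integral>\<^sup>+x. ?d z x * gauss_weight t ?sq x \<partial>leb ?sq) = ennreal (1 / ?c) * (\<integral>\<^sup>+x. ?d z x \<partial>PiM ?sq (\<lambda>_. gauss t))"
    proof -
      have "(\<integral>\<^sup>+x. ?d z x \<partial>PiM ?sq (\<lambda>_. gauss t)) = (\<integral>\<^sup>+x. (ennreal ?c * gauss_weight t ?sq x) * ?d z x \<partial>leb ?sq)"
        unfolding PiM_gauss[OF finite_cartesian_product[OF finite_lessThan finite_lessThan] t]
        by (intro nn_integral_density dm order_refl borel_measurable_times_ennreal borel_measurable_const gauss_weight_measurable)
      also have "\<dots> = (\<integral>\<^sup>+x. ennreal ?c * (?d z x * gauss_weight t ?sq x) \<partial>leb ?sq)"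
        by (simp only: mult_ac)
      also have "\<dots> = ennreal ?c * (\<integral>\<^sup>+x. ?d z x * gauss_weight t ?sq x \<partial>leb ?sq)"
        by (intro nn_integral_cmult dm order_refl borel_measurable_times_ennreal gauss_weight_measurable)
      finally have "ennreal (1 / ?c) * (\<integral>\<^sup>+x. ?d z x \<partial>PiM ?sq (\<lambda>_. gauss t)) = (ennreal (1 / ?c) * ennreal ?c) * (\<integral>\<^sup>+x. ?d z x * gauss_weight t ?sq x \<partial>leb ?sq)"
        by (simp only: mult.assoc)
      also have "ennreal (1 / ?c) * ennreal ?c = 1" using t by (subst ennreal_mult[symmetric]) auto
      finally show ?thesis by simp
    qed
    also have "(\<integral>\<^sup>+x. ?d z x \<partial>PiM ?sq (\<lambda>_. gauss t)) = ennreal (fact m / t ^ m * (\<Sum>k\<le>m. (t * (norm z)\<^sup>2) ^ k / fact k))"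
    proof -
      have "(\<Sum>k\<le>m. fact m / fact k * ((norm z)\<^sup>2) ^ k * (1 / t) ^ (m - k)) = fact m / t ^ m * (\<Sum>k\<le>m. (t * (norm z)\<^sup>2) ^ k / fact k)"
        unfolding sum_distrib_left
      proof (rule sum.cong[OF refl])
        fix k assume "k \<in> {..m}"
        then have "t ^ m = t ^ k * t ^ (m - k)" by (simp add: power_add[symmetric])
        then show "fact m / fact k * ((norm z)\<^sup>2) ^ k * (1 / t) ^ (m - k) = fact m / t ^ m * ((t * (norm z)\<^sup>2) ^ k / fact k)"
          using t by (simp add: power_mult_distrib power_divide field_simps)
      qed
      then show ?thesis by (simp add: nn_integral_det_gauss[OF t])
    qed
    also have "ennreal (1 / ?c) * ennreal (fact m / t ^ m * (\<Sum>k\<le>m. (t * (norm z)\<^sup>2) ^ k / fact k)) =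
       ennreal (1 / ?c * (fact m / t ^ m)) * ennreal (\<Sum>k\<le>m. (t * (norm z)\<^sup>2) ^ k / fact k)"
    proof -
      have "0 \<le> (\<Sum>k\<le>m. (t * (norm z)\<^sup>2) ^ k / fact k)" using t by (intro sum_nonneg) simp
      moreover have "0 \<le> fact m / t ^ m" "0 \<le> 1 / ?c" using t by simp_all
      ultimately show ?thesis by (simp only: ennreal_mult mult.assoc)
    qed
    finally show ?thesis by (simp only: mult.assoc)
  qed
  then show ?thesis by blast
qed

text \<open>Deflation makes the dependence on \<open>z\<close> the same for every
  \<open>w\<close>. Comparing with \<open>z = 0\<close>, where the profile equals 1, expresses the
  constants as a measurable function of \<open>w\<close>, so they can be integrated.\<close>

lemma nn_integral_slice_density_proportional:
  assumes t: "t > 0"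
  shows "\<exists>K. \<forall>z. (\<integral>\<^sup>+y. slice_density t m z y \<partial>leb (corner_set m)) = K * ennreal (poisson_cdf (Suc m) (t * (norm z)\<^sup>2))"
proof -
  obtain \<kappa> where \<kappa>: "\<And>z. (\<integral>\<^sup>+Z. ennreal ((norm (Determinant.det (shifted_mat m z Z)))\<^sup>2) * gauss_weight t (tall m) Z \<partial>leb (tall m)) =
    \<kappa> * ennreal (\<Sum>k\<le>m. (t * (norm z)\<^sup>2) ^ k / fact k)" using nn_integral_det_gauss_weight[OF t] by metis
  (* The value at z = 0 stands in for the unknown constant that depends on w. *)
  define \<Phi> where "\<Phi> w = (\<integral>\<^sup>+C. incidence_weight t m 0 w C \<partial>leb (tall m))" for w
  have pc: "ennreal (exp (- (t * (norm z)\<^sup>2))) * ennreal (\<Sum>k\<le>m. (t * (norm z)\<^sup>2) ^ k / fact k) = ennreal (poisson_cdf (Suc m) (t * (norm z)\<^sup>2))" for z :: complex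
    using t by (subst ennreal_mult[symmetric]) (auto simp: poisson_cdf_def lessThan_Suc_atMost intro!: sum_nonneg)
  have inc: "(\<integral>\<^sup>+C. incidence_weight t m z w C \<partial>leb (tall m)) = \<Phi> w * ennreal (poisson_cdf (Suc m) (t * (norm z)\<^sup>2))" for z w
  proof -
    obtain J where J: "\<And>c. (\<integral>\<^sup>+C. incidence_weight t m c w C \<partial>leb (tall m)) =
     J * ennreal (exp (- (t * (norm c)\<^sup>2))) *
     (\<integral>\<^sup>+Z. ennreal ((norm (Determinant.det (shifted_mat m c Z)))\<^sup>2) * gauss_weight t (tall m) Z \<partial>leb (tall m))"
      using incidence_weight_deflation[of m w] by blast
    have J': "(\<integral>\<^sup>+C. incidence_weight t m c w C \<partial>leb (tall m)) = J * \<kappa> * ennreal (poisson_cdf (Suc m) (t * (norm c)\<^sup>2))" for c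
      unfolding J \<kappa> pc[symmetric] by (simp add: mult_ac)
    have "poisson_cdf (Suc m) 0 = 1" by (simp add: poisson_cdf_def sum.lessThan_Suc_shift del: sum.lessThan_Suc)
    then have "\<Phi> w = J * \<kappa>" unfolding \<Phi>_def J' by simp
    then show ?thesis unfolding J' by simp
  qed
  have \<Phi>m: "\<Phi> \<in> borel_measurable (leb {..<m})"
  proof -
    interpret s2: sigma_finite_measure "leb (tall m)" by (rule lebesgue_product.sigma_finite) simp
    show ?thesis unfolding \<Phi>_def[abs_def] by (rule s2.borel_measurable_nn_integral) (rule incidence_weight_measurable)
  qed
  have "(\<integral>\<^sup>+y. slice_density t m z y \<partial>leb (corner_set m)) = (\<integral>\<^sup>+w. \<Phi> w \<partial>leb {..<m}) * ennreal (poisson_cdf (Suc m) (t * (norm z)\<^sup>2))" for z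
    unfolding nn_integral_slice_density inc by (rule nn_integral_multc[OF \<Phi>m])
  then show ?thesis by blast
qed

section \<open>The mean spectral density\<close>

lemma distr_lborel_Complex: "distr lborel borel (\<lambda>(x, y). Complex x y) = (lborel :: complex measure)"
proof (rule lborel_eqI[symmetric])
  have m [measurable]: "(\<lambda>(x, y). Complex x y) \<in> borel \<rightarrow>\<^sub>M borel"
    unfolding split_beta
    by (intro borel_measurable_continuous_onI continuous_on_Complex continuous_on_fst continuous_on_snd continuous_on_id)
  fix l u :: complex
  assume le: "\<And>b. b \<in> Basis \<Longrightarrow> l \<bullet> b \<le> u \<bullet> b"
  have le': "Re l \<le> Re u" "Im l \<le> Im u"
    using le[of 1] le[of \<i>] by (simp_all add: Basis_complex_def)
  have eq: "(\<lambda>(x, y). Complex x y) -` box l u = {Re l<..<Re u} \<times> {Im l<..<Im u}"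
    by (auto simp: in_box_complex_iff)
  have "emeasure (distr lborel borel (\<lambda>(x, y). Complex x y)) (box l u) = emeasure (lborel \<Otimes>\<^sub>M lborel) ({Re l<..<Re u} \<times> {Im l<..<Im u})"
    by (subst emeasure_distr) (simp_all add: eq lborel_prod m)
  also have "\<dots> = ennreal (Re u - Re l) * ennreal (Im u - Im l)"
    using le' by (subst lborel.emeasure_pair_measure_Times) simp_all
  also have "\<dots> = ennreal (prod ((\<bullet>) (u - l)) Basis)"
    using le' by (simp add: Basis_complex_def ennreal_mult)
  finally show "emeasure (distr lborel borel (\<lambda>(x, y). Complex x y)) (box l u) = ennreal (prod ((\<bullet>) (u - l)) Basis)" .
qed simp

lemma complex_gauss_eq: "complex_gauss = gauss 1"
proof -
  have m: "(\<lambda>(x, y). Complex x y) \<in> borel \<rightarrow>\<^sub>M borel"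
    unfolding split_beta
    by (intro borel_measurable_continuous_onI continuous_on_Complex continuous_on_fst continuous_on_snd continuous_on_id)
  have nd: "normal_density 0 (sqrt (1 / 2)) x = exp (- x\<^sup>2) / sqrt pi" for x
    by (simp add: normal_density_def)
  interpret R: prob_space real_gauss_half
    unfolding real_gauss_half_def by (rule prob_space_normal_density) simp
  have "real_gauss_half \<Otimes>\<^sub>M real_gauss_half =
    density (lborel \<Otimes>\<^sub>M lborel) (\<lambda>(x, y). ennreal (normal_density 0 (sqrt (1 / 2)) x) * ennreal (normal_density 0 (sqrt (1 / 2)) y))"
    unfolding real_gauss_half_def
    by (rule pair_measure_density) (auto simp: lborel.sigma_finite_measure_axioms R.sigma_finite_measure_axioms[unfolded real_gauss_half_def])
  also have "\<dots> = density lborel (\<lambda>z. ennreal (1 / pi * exp (- (1 * (norm ((\<lambda>(x, y). Complex x y) z))\<^sup>2))))"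
    unfolding lborel_prod
    by (intro arg_cong[where f = "density lborel"] ext)
       (auto simp: nd cmod_power2 ennreal_mult[symmetric] mult_exp_exp)
  finally have "complex_gauss = distr (density lborel (\<lambda>z. ennreal (1 / pi * exp (- (1 * (norm ((\<lambda>(x, y). Complex x y) z))\<^sup>2))))) borel (\<lambda>(x, y). Complex x y)"
    by (simp only: complex_gauss_def)
  also have "\<dots> = density (distr lborel borel (\<lambda>(x, y). Complex x y)) (\<lambda>z. ennreal (1 / pi * exp (- (1 * (norm z)\<^sup>2))))"
    using m by (intro density_distr[symmetric]) auto
  finally show ?thesis by (simp only: distr_lborel_Complex gauss_def)
qed

lemma ginibre_eq: "ginibre n = PiM ({..<n} \<times> {..<n}) (\<lambda>_. gauss 1)"
  by (simp add: ginibre_def complex_gauss_eq)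

lemma sets_ginibre: "sets (ginibre n) = sets (leb ({..<n} \<times> {..<n}))"
  unfolding ginibre_eq by (intro sets_PiM_cong) auto

definition rescale :: "nat \<Rightarrow> (nat \<times> nat \<Rightarrow> complex) \<Rightarrow> nat \<times> nat \<Rightarrow> complex" where
  "rescale n X = (\<lambda>e\<in>{..<n} \<times> {..<n}. complex_of_real (1 / sqrt (real n)) * X e)"

lemma emeasure_ginibre_esd:
  assumes "B \<in> sets borel"
  shows "emeasure (ginibre_esd n X) B = eig_count n B (rescale n X) / of_nat n"
proof -
  have "complex_of_real (1 / sqrt (real n)) \<cdot>\<^sub>m matrix_of n X = Matrix.mat n n (rescale n X)"
    by (rule eq_matI) (auto simp: matrix_of_def rescale_def)
  then show ?thesis using assms by (simp add: ginibre_esd_def emeasure_esd eig_count_def)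
qed

lemma rescale_measurable: "rescale n \<in> leb ({..<n} \<times> {..<n}) \<rightarrow>\<^sub>M leb ({..<n} \<times> {..<n})"
  unfolding rescale_def[abs_def] by (rule measurable_leb_componentwise) auto

lemma ginibre_esd_measurable:
  assumes B: "B \<in> sets borel"
  shows "(\<lambda>X. emeasure (ginibre_esd n X) B) \<in> borel_measurable (ginibre n)"
  unfolding emeasure_ginibre_esd[OF B] measurable_cong_sets[OF sets_ginibre refl]
  using measurable_compose[OF rescale_measurable eig_count_measurable[OF B]] by measurable

text \<open>Rescaling by \<open>sqrt n\<close> is itself an additive bijection and turns the
  weight with parameter 1 into the weight with parameter \<open>n\<close>.\<close>

lemma mean_esd_proportional:
  assumes n: "n \<ge> 1"
  shows "\<exists>K. \<forall>B\<in>sets borel. emeasure (mean_esd n) B = K * (\<integral>\<^sup>+z. ennreal (poisson_cdf n (real n * (norm z)\<^sup>2)) * indicator B z \<partial>lborel)"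
proof -
  let ?I = "{..<n} \<times> {..<n}" and ?t = "real n"
  obtain m where m: "n = Suc m" using n by (cases n) auto
  obtain K where K: "\<And>z. (\<integral>\<^sup>+y. slice_density ?t m z y \<partial>leb (corner_set m)) = K * ennreal (poisson_cdf (Suc m) (?t * (norm z)\<^sup>2))"
    using nn_integral_slice_density_proportional[of ?t m] n by auto
  let ?c = "ennreal ((1 / pi) ^ card ?I)"
  let ?J = "(\<integral>\<^sup>+x. gauss_weight 1 ?I (rescale n x) \<partial>leb ?I) / ennreal (pi ^ card ?I)"
  have gw: "gauss_weight 1 ?I X = gauss_weight ?t ?I (rescale n X)" for X
  proof -
    have "(\<Sum>e\<in>?I. (norm (rescale n X e))\<^sup>2) = (\<Sum>e\<in>?I. (norm (X e))\<^sup>2 / ?t)"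
      using n by (intro sum.cong refl) (simp add: rescale_def norm_mult power_mult_distrib norm_divide power_divide)
    then have "?t * (\<Sum>e\<in>?I. (norm (rescale n X e))\<^sup>2) = (\<Sum>e\<in>?I. (norm (X e))\<^sup>2)"
      using n by (simp add: sum_divide_distrib[symmetric])
    then show ?thesis by (simp add: gauss_weight_def)
  qed
  have "emeasure (mean_esd n) B = (?c * ?J * K / of_nat n) * (\<integral>\<^sup>+z. ennreal (poisson_cdf n (?t * (norm z)\<^sup>2)) * indicator B z \<partial>lborel)"
    if B [measurable]: "B \<in> sets borel" for B
  proof -
    let ?f = "\<lambda>Y. eig_count n B Y * gauss_weight ?t ?I Y"
    have fm: "?f \<in> borel_measurable (leb ?I)" using eig_count_measurable[OF B, of n] by measurable
    have em: "(\<lambda>X. eig_count n B (rescale n X) / of_nat n) \<in> borel_measurable (leb ?I)"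
      using measurable_compose[OF rescale_measurable eig_count_measurable[OF B]] by measurable
    have "emeasure (mean_esd n) B = (\<integral>\<^sup>+X. eig_count n B (rescale n X) / of_nat n \<partial>ginibre n)"
      using emeasure_mean_esd[OF ginibre_esd_measurable B] by (simp add: emeasure_ginibre_esd[OF B])
    also have "\<dots> = (\<integral>\<^sup>+X. (?c * gauss_weight 1 ?I X) * (eig_count n B (rescale n X) / of_nat n) \<partial>leb ?I)"
      unfolding ginibre_eq using em by (subst PiM_gauss) (simp_all add: nn_integral_density)
    also have "\<dots> = (\<integral>\<^sup>+X. (?c / of_nat n) * ?f (rescale n X) \<partial>leb ?I)"
      unfolding gw by (intro nn_integral_cong) (simp add: divide_ennreal_def mult_ac)
    also have "\<dots> = (?c / of_nat n) * (\<integral>\<^sup>+X. ?f (rescale n X) \<partial>leb ?I)"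
      by (rule nn_integral_cmult) (rule measurable_compose[OF rescale_measurable fm])
    also have "(\<integral>\<^sup>+X. ?f (rescale n X) \<partial>leb ?I) = ?J * (\<integral>\<^sup>+X. ?f X \<partial>leb ?I)"
    proof (rule nn_integral_additive_bijection[OF _ rescale_measurable _ _ fm])
      show "rescale n (\<lambda>e\<in>?I. x e + y e) = (\<lambda>e\<in>?I. rescale n x e + rescale n y e)" for x y
        by (rule ext) (simp add: rescale_def distrib_left add_divide_distrib)
      fix y assume y: "y \<in> space (leb ?I)"
      have "rescale n (\<lambda>e\<in>?I. complex_of_real (sqrt ?t) * y e) = y"
        using y n by (intro extensionalityI[of _ ?I]) (auto simp: rescale_def space_PiM PiE_def)
      then show "\<exists>z\<in>space (leb ?I). rescale n z = y"
        by (intro bexI[of _ "\<lambda>e\<in>?I. complex_of_real (sqrt ?t) * y e"]) (auto simp: space_PiM)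
    qed simp
    also have "(\<integral>\<^sup>+X. ?f X \<partial>leb ?I) = (\<integral>\<^sup>+z. (K * ennreal (poisson_cdf n (?t * (norm z)\<^sup>2))) * indicator B z \<partial>lborel)"
      using eig_count_slices[OF B, of m ?t] unfolding K by (simp add: m)
    also have "\<dots> = K * (\<integral>\<^sup>+z. ennreal (poisson_cdf n (?t * (norm z)\<^sup>2)) * indicator B z \<partial>lborel)"
      using B by (simp add: mult.assoc nn_integral_cmult)
    finally show ?thesis by (simp add: divide_ennreal_def mult_ac)
  qed
  then show ?thesis by blast
qed

lemma nn_integral_poisson_cdf_scaled:
  assumes n: "n \<ge> 1" and B [measurable]: "B \<in> sets borel"
  shows "(\<integral>\<^sup>+(z::complex). ennreal (poisson_cdf n (real n * (norm z)\<^sup>2)) * indicator B ((norm z)\<^sup>2) \<partial>lborel) =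
    ennreal (pi / real n) * (\<integral>\<^sup>+x. ennreal (poisson_cdf n x) * indicator B (x / real n) * indicator {0..} x \<partial>lborel)"
proof -
  let ?X = "\<integral>\<^sup>+s. ennreal (poisson_cdf n (real n * s)) * indicator B s * indicator {0..} s \<partial>lborel"
  have A: "(\<integral>\<^sup>+(z::complex). ennreal (poisson_cdf n (real n * (norm z)\<^sup>2)) * indicator B ((norm z)\<^sup>2) \<partial>lborel) = ennreal pi * ?X"
    by (intro nn_integral_radial) measurable
  have S: "(\<integral>\<^sup>+x. ennreal (poisson_cdf n x) * indicator B (x / real n) * indicator {0..} x \<partial>lborel) = ennreal (real n) * ?X"
    using n by (subst nn_integral_real_affine[where c = "real n" and t = 0])
      (auto intro!: arg_cong2[where f = "(*)"] nn_integral_cong simp: indicator_def zero_le_mult_iff)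
  have "ennreal (pi / real n) * ennreal (real n) = ennreal pi"
    using n by (subst ennreal_mult[symmetric]) auto
  then show ?thesis by (simp only: A S mult.assoc[symmetric])
qed

text \<open>Both sides have total mass 1, which fixes the constant left open so far.\<close>

lemma emeasure_mean_esd_density:
  assumes n: "n \<ge> 1" and B [measurable]: "B \<in> sets borel"
  shows "emeasure (mean_esd n) B = (\<integral>\<^sup>+z. ennreal (poisson_cdf n (real n * (norm z)\<^sup>2) / pi) * indicator B z \<partial>lborel)"
proof -
  let ?p = "\<lambda>z::complex. ennreal (poisson_cdf n (real n * (norm z)\<^sup>2))"
  obtain K where K: "\<And>B. B \<in> sets borel \<Longrightarrow> emeasure (mean_esd n) B = K * (\<integral>\<^sup>+z. ?p z * indicator B z \<partial>lborel)"
    using mean_esd_proportional[OF n] by auto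
  have tot: "(\<integral>\<^sup>+z. ?p z \<partial>lborel) = ennreal pi"
  proof -
    have "(\<integral>\<^sup>+x. ennreal (poisson_cdf n x) * indicator {0..} x \<partial>lborel) = ennreal (real n)"
      using nn_integral_poisson_cdf_atLeast[of n 0] n by (simp add: poisson_cdf_int_0)
    then have "(\<integral>\<^sup>+z. ?p z \<partial>lborel) = ennreal (pi / real n) * ennreal (real n)"
      using nn_integral_poisson_cdf_scaled[OF n, of UNIV] by simp
    also have "\<dots> = ennreal pi" using n by (subst ennreal_mult[symmetric]) auto
    finally show ?thesis .
  qed
  have "emeasure (mean_esd n) UNIV = 1"
  proof -
    have deg: "degree (char_poly (Matrix.mat n n X)) = n" for X :: "nat \<times> nat \<Rightarrow> complex"
      by (rule degree_monic_char_poly[THEN conjunct1]) simp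
    have "eig_count n UNIV X = of_nat n" for X
      by (simp add: eig_count_def size_proots_complex deg)
    then have "emeasure (ginibre_esd n X) UNIV = 1" for X
      using n by (simp add: emeasure_ginibre_esd ennreal_of_nat_eq_real_of_nat ennreal_divide_self)
    moreover have "prob_space (ginibre n)"
      unfolding ginibre_eq by (intro prob_space_PiM prob_space_gauss) simp
    ultimately show ?thesis
      using emeasure_mean_esd[OF ginibre_esd_measurable, of UNIV n] by (simp add: prob_space.emeasure_space_1)
  qed
  then have "K * ennreal pi = 1" using K[of UNIV] tot by simp
  then have "K * (ennreal pi * ennreal (1 / pi)) = ennreal (1 / pi)" by (simp only: mult.assoc[symmetric]) simp
  also have "ennreal pi * ennreal (1 / pi) = 1" by (subst ennreal_mult[symmetric]) auto
  finally have K': "K = ennreal (1 / pi)" by simp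
  have "emeasure (mean_esd n) B = (\<integral>\<^sup>+z. ennreal (1 / pi) * (?p z * indicator B z) \<partial>lborel)"
    unfolding K[OF B] K' using B by (intro nn_integral_cmult[symmetric]) measurable
  also have "\<dots> = (\<integral>\<^sup>+z. ennreal (poisson_cdf n (real n * (norm z)\<^sup>2) / pi) * indicator B z \<partial>lborel)"
    by (intro nn_integral_cong) (simp add: mult.assoc[symmetric] ennreal_mult[symmetric] poisson_cdf_nonneg)
  finally show ?thesis .
qed

section \<open>Stirling's formula\<close>

text \<open>Converges to \<open>sqrt (2 * pi)\<close>, which is Stirling's formula.\<close>

definition stirling_ratio :: "nat \<Rightarrow> real" where
  "stirling_ratio n = fact n * exp (real n) / (real n ^ n * sqrt (real n))"

text \<open>The midpoint and trapezoidal bounds for the increment of the logarithm show that the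
  logarithm of the ratio decreases, by steps dominated by a telescoping series.\<close>

lemma stirling_ratio_convergent: "\<exists>L>0. stirling_ratio \<longlonglongrightarrow> L"
proof -
  (* Indices are shifted by one to avoid the logarithm of 0. *)
  define b where "b n = ln (fact (Suc n)) + real (Suc n) - (real (Suc n) + 1 / 2) * ln (real (Suc n))" for n
  have diff: "b n - b (Suc n) = (real (Suc n) + 1 / 2) * (ln (real (Suc n) + 1) - ln (real (Suc n))) - 1" for n
  proof -
    have "ln (fact (Suc (Suc n)) :: real) = ln (real (Suc n) + 1) + ln (fact (Suc n))"
      unfolding fact_Suc[of "Suc n"] by (subst ln_mult) (simp_all add: add_ac)
    moreover have r: "real (Suc (Suc n)) = real (Suc n) + 1" by simp
    ultimately show ?thesis unfolding b_def r by (simp add: algebra_simps del: fact_Suc of_nat_Suc)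
  qed
  have lower: "b (Suc n) \<le> b n" for n
  proof -
    define x where "x = real (Suc n)"
    have x: "x > 0" by (simp add: x_def)
    have "x + (x + 1) = 2 * x + 1" "2 * (x + 1 - x) = 2" by simp_all
    then have "2 / (2 * x + 1) \<le> ln (x + 1) - ln x"
      using ln_inverse_approx_ge[of x "x + 1"] x by (simp only: less_add_one)
    then have "(x + 1 / 2) * (2 / (2 * x + 1)) \<le> (x + 1 / 2) * (ln (x + 1) - ln x)"
      by (rule mult_left_mono) (use x in simp)
    moreover have "(x + 1 / 2) * (2 / (2 * x + 1)) = 1"
    proof -
      have "x + 1 / 2 = (2 * x + 1) / 2" by (simp add: add_divide_distrib)
      moreover have "(2 * x + 1) / 2 * (2 / (2 * x + 1)) = 1" using x by simp
      ultimately show ?thesis by (simp only:)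
    qed
    ultimately show ?thesis using diff[of n] unfolding x_def[symmetric] by linarith
  qed
  have upper: "b n - b (Suc n) \<le> 1 / (4 * real (Suc n)) - 1 / (4 * real (Suc (Suc n)))" for n
  proof -
    define x where "x = real (Suc n)"
    have x: "x > 0" and x1: "real (Suc (Suc n)) = x + 1" by (simp_all add: x_def)
    have "ln (x + 1) - ln x \<le> 1 * (inverse x + inverse (x + 1)) / 2"
      using x by (intro ln_inverse_approx_le) simp_all
    then have "(x + 1 / 2) * (ln (x + 1) - ln x) \<le> (x + 1 / 2) * (1 * (inverse x + inverse (x + 1)) / 2)"
      by (rule mult_left_mono) (use x in simp)
    also have "inverse x + inverse (x + 1) = (2 * x + 1) / (x * (x + 1))"
      using add_frac_eq[of x "x + 1" 1 1] x by (simp add: inverse_eq_divide)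
    also have "x + 1 / 2 = (2 * x + 1) / 2" by (simp add: add_divide_distrib)
    also have "s / 2 * (1 * (s / y) / 2) = s\<^sup>2 / (4 * y)" for s y :: real
      by (simp add: power2_eq_square)
    also have "(2 * x + 1)\<^sup>2 = 4 * (x * (x + 1)) + 1" by (simp add: power2_eq_square algebra_simps)
    also have "(4 * (x * (x + 1)) + 1) / (4 * (x * (x + 1))) = 1 + 1 / (4 * (x * (x + 1)))"
      using x by (simp add: add_divide_distrib)
    also have "1 / (4 * (x * (x + 1))) = 1 / (4 * x) - 1 / (4 * (x + 1))"
      using x by (simp add: divide_simps)
    finally have "(2 * x + 1) / 2 * (ln (x + 1) - ln x) \<le> 1 + (1 / (4 * x) - 1 / (4 * (x + 1)))" .
    moreover have "x + 1 / 2 = (2 * x + 1) / 2" by (simp add: add_divide_distrib)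
    ultimately have "(x + 1 / 2) * (ln (x + 1) - ln x) \<le> 1 + (1 / (4 * x) - 1 / (4 * (x + 1)))"
      by (simp only:)
    then show ?thesis using diff[of n] unfolding x1 x_def[symmetric] by linarith
  qed
  have low: "b n \<ge> b 0 - 1 / 4 + 1 / (4 * real (Suc n))" for n
  proof (induction n)
    case (Suc n)
    then show ?case using upper[of n] by linarith
  qed simp
  have bound: "\<forall>i. b 0 - 1 / 4 \<le> b i"
  proof
    fix i
    have "0 \<le> 1 / (4 * real (Suc i))" by simp
    then show "b 0 - 1 / 4 \<le> b i" using low[of i] by linarith
  qed
  have "decseq b" using lower by (rule decseq_SucI)
  from decseq_convergent[OF this bound] obtain l where l: "b \<longlonglongrightarrow> l" by blast
  have "stirling_ratio (Suc n) = exp (b n)" for n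
  proof -
    let ?x = "real (Suc n)"
    have "exp (b n) = exp (ln (fact (Suc n))) * exp ?x / (exp (?x * ln ?x) * exp (ln ?x / 2))"
      by (simp only: b_def exp_diff exp_add[symmetric]) (simp add: algebra_simps)
    also have "exp (?x * ln ?x) = ?x ^ Suc n" by (subst exp_of_nat_mult) simp
    also have "exp (ln ?x / 2) = sqrt ?x" by (subst ln_sqrt[symmetric]) simp_all
    also have "exp (ln (fact (Suc n) :: real)) = fact (Suc n)" by (rule exp_ln) simp
    finally show ?thesis by (simp only: stirling_ratio_def)
  qed
  then have "(\<lambda>n. stirling_ratio (Suc n)) \<longlonglongrightarrow> exp l" using tendsto_exp[OF l] by simp
  then have "stirling_ratio \<longlonglongrightarrow> exp l" by (rule LIMSEQ_imp_Suc)
  then show ?thesis by (intro exI[of _ "exp l"]) simp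
qed

lemma wallis_partial_product:
  "(\<Prod>k=1..n. (4 * real k ^ 2) / (4 * real k ^ 2 - 1)) = fact n ^ 4 * 16 ^ n / ((fact (2 * n))\<^sup>2 * (2 * real n + 1))"
proof (induction n)
  case (Suc n)
  let ?x = "real n"
  have f: "fact (2 * Suc n) = (2 * ?x + 2) * (2 * ?x + 1) * (fact (2 * n) :: real)"
    by (simp add: algebra_simps)
  have d: "4 * (?x + 1)\<^sup>2 - 1 = (2 * ?x + 1) * (2 * ?x + 3)" by (simp add: power2_eq_square algebra_simps)
  have nz: "2 * ?x + 1 \<noteq> 0" "2 * ?x + 3 \<noteq> 0" "?x + 1 \<noteq> 0" "(fact (2 * n) :: real) \<noteq> 0" by (simp_all add: add_eq_0_iff)
  have alg: "F ^ 4 * E / (G\<^sup>2 * a) * (4 * y\<^sup>2 / (a * c)) = (y * F) ^ 4 * (16 * E) / ((2 * y * a * G)\<^sup>2 * c)"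
    if "a \<noteq> 0" "c \<noteq> 0" "y \<noteq> 0" "G \<noteq> 0" for F E G a c y :: real
    using that by (simp add: field_simps power2_eq_square power4_eq_xxxx)
  have "(\<Prod>k=1..Suc n. (4 * real k ^ 2) / (4 * real k ^ 2 - 1)) =
     fact n ^ 4 * 16 ^ n / ((fact (2 * n))\<^sup>2 * (2 * ?x + 1)) * (4 * (?x + 1)\<^sup>2 / ((2 * ?x + 1) * (2 * ?x + 3)))"
  proof -
    have "(\<Prod>k=1..Suc n. g k) = (\<Prod>k=1..n. g k) * g (Suc n)" for g :: "nat \<Rightarrow> real"
      by (simp add: prod.nat_ivl_Suc' mult.commute)
    moreover have "real (Suc n) = ?x + 1" by simp
    ultimately show ?thesis by (simp only: Suc.IH d)
  qed
  also have "\<dots> = ((?x + 1) * fact n) ^ 4 * (16 * 16 ^ n) / ((2 * (?x + 1) * (2 * ?x + 1) * fact (2 * n))\<^sup>2 * (2 * ?x + 3))"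
    using nz by (intro alg)
  also have "(?x + 1) * fact n = fact (Suc n)" by (simp add: add.commute)
  also have "2 * (?x + 1) * (2 * ?x + 1) * fact (2 * n) = (fact (2 * Suc n) :: real)" unfolding f by (simp add: algebra_simps)
  also have "2 * ?x + 3 = 2 * real (Suc n) + 1" by simp
  finally show ?case by (simp only: power_Suc)
qed simp

text \<open>In this combination all exponentials cancel and the partial product of Wallis remains;
  it identifies the limit.\<close>

lemma stirling_ratio_square:
  assumes n: "n > 0"
  shows "((stirling_ratio n)\<^sup>2 / stirling_ratio (2 * n))\<^sup>2 =
    2 * (\<Prod>k=1..n. (4 * real k ^ 2) / (4 * real k ^ 2 - 1)) * ((2 * real n + 1) / real n)"
proof -
  let ?x = "real n" and ?f = "fact n :: real" and ?g = "fact (2 * n) :: real"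
  have alg: "((F * E / (P * s))\<^sup>2 / (G * (E * E) / (((4 ^ n) * (P * P)) * (q * s))))\<^sup>2 = 2 * (F ^ 4 * 16 ^ n / (G\<^sup>2 * c)) * (c / x)"
    if "E \<noteq> 0" "P \<noteq> 0" "G \<noteq> 0" "s\<^sup>2 = x" "q\<^sup>2 = 2" "x \<noteq> 0" "c \<noteq> 0" "s \<noteq> 0" "q \<noteq> 0" for F E P G s q x c :: real
  proof -
    have "(F * E / (P * s))\<^sup>2 / (G * (E * E) / (((4 ^ n) * (P * P)) * (q * s))) = F\<^sup>2 * 4 ^ n * q / (G * s)"
      using that by (simp add: field_simps power2_eq_square)
    then have "((F * E / (P * s))\<^sup>2 / (G * (E * E) / (((4 ^ n) * (P * P)) * (q * s))))\<^sup>2 = (F\<^sup>2)\<^sup>2 * (4 ^ n)\<^sup>2 * q\<^sup>2 / (G\<^sup>2 * s\<^sup>2)"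
      by (simp add: power_mult_distrib power_divide)
    also have "(F\<^sup>2)\<^sup>2 = F ^ 4" by simp
    also have "((4::real) ^ n)\<^sup>2 = 16 ^ n" by (simp add: power2_eq_square power_mult_distrib[symmetric])
    finally show ?thesis using that by (simp add: field_simps)
  qed
  have s2: "stirling_ratio (2 * n) = ?g * (exp ?x * exp ?x) / (((4 ^ n) * (?x ^ n * ?x ^ n)) * (sqrt 2 * sqrt ?x))"
  proof -
    have "real (2 * n) ^ (2 * n) = (4 ^ n) * (?x ^ n * ?x ^ n)"
      by (simp add: power_mult power_mult_distrib power2_eq_square)
    moreover have "exp (real (2 * n)) = exp ?x * exp ?x" by (simp add: exp_add[symmetric])
    moreover have "sqrt (real (2 * n)) = sqrt 2 * sqrt ?x" by (simp add: real_sqrt_mult)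
    ultimately show ?thesis by (simp only: stirling_ratio_def)
  qed
  show ?thesis unfolding s2 wallis_partial_product unfolding stirling_ratio_def
    by (rule alg) (use n in \<open>auto simp: add_eq_0_iff\<close>)
qed

lemma stirling_ratio_tendsto: "stirling_ratio \<longlonglongrightarrow> sqrt (2 * pi)"
proof -
  obtain L where L: "L > 0" "stirling_ratio \<longlonglongrightarrow> L" using stirling_ratio_convergent by blast
  have "strict_mono (\<lambda>n::nat. 2 * n)" by (auto intro: strict_monoI)
  from LIMSEQ_subseq_LIMSEQ[OF L(2) this] have L2: "(\<lambda>n. stirling_ratio (2 * n)) \<longlonglongrightarrow> L" by (simp add: o_def)
  have "(\<lambda>n. ((stirling_ratio n)\<^sup>2 / stirling_ratio (2 * n))\<^sup>2) \<longlonglongrightarrow> (L\<^sup>2 / L)\<^sup>2"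
    using L L2 by (intro tendsto_intros) auto
  moreover have "(\<lambda>n. ((stirling_ratio n)\<^sup>2 / stirling_ratio (2 * n))\<^sup>2) \<longlonglongrightarrow> 2 * (pi / 2) * 2"
  proof (rule Lim_transform_eventually)
    have "(\<lambda>n. (2 * real n + 1) / real n) \<longlonglongrightarrow> 2" by real_asymp
    then show "(\<lambda>n. 2 * (\<Prod>k=1..n. (4 * real k ^ 2) / (4 * real k ^ 2 - 1)) * ((2 * real n + 1) / real n)) \<longlonglongrightarrow> 2 * (pi / 2) * 2"
      by (intro tendsto_intros wallis)
    show "eventually (\<lambda>n. 2 * (\<Prod>k=1..n. (4 * real k ^ 2) / (4 * real k ^ 2 - 1)) * ((2 * real n + 1) / real n) =
       ((stirling_ratio n)\<^sup>2 / stirling_ratio (2 * n))\<^sup>2) sequentially"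
      using eventually_gt_at_top[of 0] by eventually_elim (rule stirling_ratio_square[symmetric])
  qed
  ultimately have "(L\<^sup>2 / L)\<^sup>2 = 2 * (pi / 2) * 2" by (rule LIMSEQ_unique)
  then have "L\<^sup>2 = 2 * pi" using L(1) by (simp add: power2_eq_square)
  then have "L = sqrt (2 * pi)" using L(1) by (metis real_sqrt_unique less_imp_le)
  with L show ?thesis by simp
qed

section \<open>Discrepancy from the uniform law on the disc\<close>

lemma sets_mean_esd [simp]: "sets (mean_esd n) = sets borel"
  by (simp add: mean_esd_def space_borel[symmetric] del: space_borel)

lemma space_mean_esd [simp]: "space (mean_esd n) = UNIV"
  using sets_eq_imp_space_eq[OF sets_mean_esd] by simp

lemma sets_unif_disc [simp]: "sets unif_disc = sets borel"
  by (simp add: unif_disc_def)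

lemma space_unif_disc [simp]: "space unif_disc = UNIV"
  by (simp add: unif_disc_def)

lemma emeasure_unif_disc:
  assumes "B \<in> sets borel"
  shows "emeasure unif_disc B = (\<integral>\<^sup>+z. ennreal (1 / pi * indicator (ball 0 1) z) * indicator B z \<partial>lborel)"
  unfolding unif_disc_def
proof (rule emeasure_density)
  have [measurable]: "ball (0 :: complex) 1 \<in> sets borel" by simp
  show "(\<lambda>z::complex. ennreal (1 / pi * indicator (ball 0 1) z)) \<in> borel_measurable lborel" by measurable
qed (use assms in simp)

text \<open>The mass outside a disc is an increment of the antiderivative
  \<open>poisson_cdf_int\<close>.\<close>

lemma emeasure_mean_esd_outside:
  assumes n: "n \<ge> 1" and r: "r \<ge> 0"
  shows "emeasure (mean_esd n) (- ball 0 r) = ennreal ((real n - poisson_cdf_int n (real n * r\<^sup>2)) / real n)"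
proof -
  have ind: "indicator (- ball 0 r) z = (indicator {r\<^sup>2..} ((norm z)\<^sup>2) :: ennreal)" for z :: complex
    using r by (auto simp: indicator_def abs_le_square_iff[symmetric])
  have nn: "real n - poisson_cdf_int n (real n * r\<^sup>2) \<ge> 0"
  proof -
    have "ennreal (poisson_cdf_int n x - poisson_cdf_int n 0) \<le> ennreal (real n)" if "x \<ge> 0" for x
    proof -
      have "ennreal (poisson_cdf_int n x - poisson_cdf_int n 0) = (\<integral>\<^sup>+y. ennreal (poisson_cdf n y) * indicator {0..x} y \<partial>lborel)"
        using n that by (intro nn_integral_poisson_cdf_Icc[symmetric]) auto
      also have "\<dots> \<le> (\<integral>\<^sup>+y. ennreal (poisson_cdf n y) * indicator {0..} y \<partial>lborel)"
        by (intro nn_integral_mono) (auto simp: indicator_def)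
      also have "\<dots> = ennreal (real n)" using n by (simp add: nn_integral_poisson_cdf_atLeast poisson_cdf_int_0)
      finally show ?thesis .
    qed
    from this[of "real n * r\<^sup>2"] show ?thesis using n by (simp add: poisson_cdf_int_0)
  qed
  have "emeasure (mean_esd n) (- ball 0 r) = (\<integral>\<^sup>+(z::complex). ennreal (1 / pi) * (ennreal (poisson_cdf n (real n * (norm z)\<^sup>2)) * indicator {r\<^sup>2..} ((norm z)\<^sup>2)) \<partial>lborel)"
    using n by (subst emeasure_mean_esd_density)
      (auto intro!: nn_integral_cong simp: ind mult.assoc[symmetric] ennreal_mult[symmetric] poisson_cdf_nonneg)
  also have "\<dots> = ennreal (1 / pi) * (ennreal (pi / real n) * (\<integral>\<^sup>+x. ennreal (poisson_cdf n x) * indicator {r\<^sup>2..} (x / real n) * indicator {0..} x \<partial>lborel))"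
    using n by (subst nn_integral_cmult) (measurable, simp add: nn_integral_poisson_cdf_scaled)
  also have "(\<integral>\<^sup>+x. ennreal (poisson_cdf n x) * indicator {r\<^sup>2..} (x / real n) * indicator {0..} x \<partial>lborel) =
     (\<integral>\<^sup>+x. ennreal (poisson_cdf n x) * indicator {real n * r\<^sup>2..} x \<partial>lborel)"
  proof (intro nn_integral_cong)
    fix x
    have "r\<^sup>2 \<le> x / real n \<and> 0 \<le> x \<longleftrightarrow> real n * r\<^sup>2 \<le> x"
    proof
      assume "real n * r\<^sup>2 \<le> x"
      moreover have "0 \<le> real n * r\<^sup>2" by simp
      ultimately have "0 \<le> x" "r\<^sup>2 * real n \<le> x" by (linarith, simp add: mult.commute)
      then show "r\<^sup>2 \<le> x / real n \<and> 0 \<le> x" using n by (simp add: pos_le_divide_eq)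
    qed (use n in \<open>simp add: field_simps\<close>)
    then show "ennreal (poisson_cdf n x) * indicator {r\<^sup>2..} (x / real n) * indicator {0..} x = ennreal (poisson_cdf n x) * indicator {real n * r\<^sup>2..} x"
      by (auto simp: indicator_def)
  qed
  also have "\<dots> = ennreal (real n - poisson_cdf_int n (real n * r\<^sup>2))"
    using n by (intro nn_integral_poisson_cdf_atLeast) auto
  also have "ennreal (1 / pi) * (ennreal (pi / real n) * \<dots>) = ennreal ((real n - poisson_cdf_int n (real n * r\<^sup>2)) / real n)"
    using n nn by (simp add: ennreal_mult[symmetric])
  finally show ?thesis .
qed

lemma prob_space_mean_esd: assumes "n \<ge> 1" shows "prob_space (mean_esd n)"
proof
  show "emeasure (mean_esd n) (space (mean_esd n)) = 1"
    using emeasure_mean_esd_outside[OF assms, of 0] assms by (simp add: poisson_cdf_int_0)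
qed

lemma emeasure_unif_disc_ball:
  assumes "0 \<le> r" "r \<le> 1" shows "emeasure unif_disc (ball 0 r) = ennreal (r\<^sup>2)"
proof -
  have "emeasure unif_disc (ball 0 r) = (\<integral>\<^sup>+z. ennreal (1 / pi) * indicator (ball (0::complex) r) z \<partial>lborel)"
    using assms by (subst emeasure_unif_disc) (auto intro!: nn_integral_cong simp: indicator_def)
  also have "\<dots> = ennreal (1 / pi) * ennreal (pi * r\<^sup>2)"
    using assms by (subst nn_integral_cmult_indicator) (auto simp: emeasure_ball unit_ball_vol_2)
  also have "\<dots> = ennreal (r\<^sup>2)" by (subst ennreal_mult[symmetric]) auto
  finally show ?thesis .
qed

lemma prob_space_unif_disc: "prob_space unif_disc"
proof
  have "emeasure unif_disc UNIV = emeasure unif_disc (ball 0 1)"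
    by (auto simp: emeasure_unif_disc indicator_def intro!: nn_integral_cong)
  then show "emeasure unif_disc (space unif_disc) = 1" using emeasure_unif_disc_ball[of 1] by simp
qed

lemma emeasure_unif_disc_outside:
  assumes "B \<in> sets borel" "B \<subseteq> - ball 0 1" shows "emeasure unif_disc B = 0"
proof -
  have "emeasure unif_disc B = (\<integral>\<^sup>+(z::complex). 0 \<partial>lborel)"
    unfolding emeasure_unif_disc[OF assms(1)] using assms by (intro nn_integral_cong) (auto simp: indicator_def)
  then show ?thesis by simp
qed

text \<open>Inside the unit disc the mean density \<open>poisson_cdf n (n * (norm z)\<^sup>2) /
  pi\<close> is at most \<open>1 / pi\<close>.\<close>

lemma mean_esd_le_unif_disc:
  assumes n: "n \<ge> 1" and B: "B \<in> sets borel" "B \<subseteq> ball 0 1"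
  shows "emeasure (mean_esd n) B \<le> emeasure unif_disc B"
  unfolding emeasure_mean_esd_density[OF n B(1)] emeasure_unif_disc[OF B(1)]
  using B(2) by (intro nn_integral_mono)
    (auto simp: indicator_def poisson_cdf_le_1 intro!: ennreal_leI divide_right_mono)

text \<open>The left side is at most \<open>exp (- n * (s - 1 - ln s))\<close>, and \<open>s - 1 -
  ln s = 2 * e + e\<^sup>2 - 2 * ln (1 + e)\<close> is at least \<open>e\<^sup>2\<close>. The same
  estimate serves outside the unit disc with positive \<open>e\<close> and inside with negative
  \<open>e\<close>.\<close>

lemma poisson_tail_bound:
  assumes n: "n \<ge> 1" and s: "s = (1 + e)\<^sup>2" and e: "1 + e \<ge> 0"
  shows "exp (- (real n * s)) * (real n * s) ^ n / fact n \<le> exp (- (real n * e\<^sup>2))"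
proof -
  have "(1 + e) ^ n \<le> exp e ^ n" using e exp_ge_add_one_self[of e] by (intro power_mono) auto
  then have "((1 + e) ^ n)\<^sup>2 \<le> (exp e ^ n)\<^sup>2" using e by (intro power_mono) auto
  also have "(exp e ^ n)\<^sup>2 = exp (2 * real n * e)" by (simp add: exp_of_nat_mult[symmetric] power2_eq_square exp_add[symmetric])
  also have "((1 + e) ^ n)\<^sup>2 = s ^ n" unfolding s by (simp add: power_mult[symmetric] mult.commute)
  finally have sn: "s ^ n \<le> exp (2 * real n * e)" .
  have nf: "real n ^ n / fact n \<le> exp (real n)" by (rule exp_ge_power_div_fact) simp
  have "exp (- (real n * s)) * (real n * s) ^ n / fact n = exp (- (real n * s)) * (real n ^ n / fact n * s ^ n)"
    by (simp add: power_mult_distrib)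
  also have "\<dots> \<le> exp (- (real n * s)) * (exp (real n) * exp (2 * real n * e))"
    using sn nf s by (intro mult_left_mono mult_mono) auto
  also have "\<dots> = exp (- (real n * e\<^sup>2))"
    unfolding s by (simp add: exp_add[symmetric] power2_eq_square algebra_simps)
  finally show ?thesis .
qed

context
  fixes n :: nat assumes n: "n \<ge> 1"
begin

interpretation \<mu>: prob_space "mean_esd n" by (rule prob_space_mean_esd[OF n])
interpretation \<nu>: prob_space unif_disc by (rule prob_space_unif_disc)

lemma measure_mean_esd_outside:
  assumes r: "r \<ge> 0"
  shows "measure (mean_esd n) (- ball 0 r) = (1 - r\<^sup>2) * poisson_cdf n (real n * r\<^sup>2) + exp (- (real n * r\<^sup>2)) * (real n * r\<^sup>2) ^ n / fact n"
proof -
  have eq: "(real n - poisson_cdf_int n (real n * r\<^sup>2)) / real n =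
     (1 - r\<^sup>2) * poisson_cdf n (real n * r\<^sup>2) + exp (- (real n * r\<^sup>2)) * (real n * r\<^sup>2) ^ n / fact n"
  proof -
    have alg: "(real n - real n * r\<^sup>2) * p + real n * w = real n * ((1 - r\<^sup>2) * p + w)" for p w by (simp add: algebra_simps)
    have n0: "n > 0" using n by simp
    have "real n - poisson_cdf_int n (real n * r\<^sup>2) =
      real n * ((1 - r\<^sup>2) * poisson_cdf n (real n * r\<^sup>2) + exp (- (real n * r\<^sup>2)) * (real n * r\<^sup>2) ^ n / fact n)"
      by (simp only: poisson_cdf_int_eq[OF n0] alg)
    then show ?thesis using n by simp
  qed
  have le1: "emeasure (mean_esd n) (- ball 0 r) \<le> 1" by (rule \<mu>.emeasure_le_1)
  have "0 \<le> (real n - poisson_cdf_int n (real n * r\<^sup>2)) / real n"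
  proof -
    have "poisson_cdf_int n (real n * r\<^sup>2) \<le> real n"
    proof (rule tendsto_lowerbound[OF poisson_cdf_int_at_top])
      show "eventually (\<lambda>x. poisson_cdf_int n (real n * r\<^sup>2) \<le> poisson_cdf_int n x) at_top"
        using eventually_ge_at_top[of "real n * r\<^sup>2"]
      proof eventually_elim
        fix x assume x: "real n * r\<^sup>2 \<le> x"
        show "poisson_cdf_int n (real n * r\<^sup>2) \<le> poisson_cdf_int n x"
        proof (rule DERIV_nonneg_imp_nondecreasing[OF x])
          fix y assume "real n * r\<^sup>2 \<le> y"
          moreover have "0 \<le> real n * r\<^sup>2" by simp
          ultimately have "0 \<le> y" by linarith
          then show "\<exists>z. (poisson_cdf_int n has_real_derivative z) (at y) \<and> 0 \<le> z"
            using n DERIV_poisson_cdf_int[of n y] poisson_cdf_nonneg[of y n] by auto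
        qed
      qed
    qed (use n in auto)
    then show ?thesis by simp
  qed
  then have "measure (mean_esd n) (- ball 0 r) = (real n - poisson_cdf_int n (real n * r\<^sup>2)) / real n"
    using emeasure_mean_esd_outside[OF n r] by (simp add: measure_def)
  then show ?thesis by (simp only: eq)
qed

text \<open>Only the part of \<open>B\<close> outside the unit disc can carry an excess of the
  mean spectral distribution.\<close>

lemma measure_mean_minus_unif_le:
  assumes B: "B \<in> sets borel"
  shows "measure (mean_esd n) B - measure unif_disc B \<le> measure (mean_esd n) (- ball 0 1)"
proof -
  have b: "ball (0::complex) 1 \<in> sets borel" "- ball (0::complex) 1 \<in> sets borel" by auto
  have "measure (mean_esd n) B = measure (mean_esd n) (B \<inter> ball 0 1) + measure (mean_esd n) (B - ball 0 1)"
    using B b \<mu>.finite_measure_Union[of "B \<inter> ball 0 1" "B - ball 0 1"] by (simp add: Int_Diff_Un Int_Diff_disjoint)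
  moreover have "measure (mean_esd n) (B - ball 0 1) \<le> measure (mean_esd n) (- ball 0 1)"
    using B b by (intro \<mu>.finite_measure_mono) auto
  moreover have "measure (mean_esd n) (B \<inter> ball 0 1) \<le> measure unif_disc (B \<inter> ball 0 1)"
    using mean_esd_le_unif_disc[OF n, of "B \<inter> ball 0 1"] B b
    by (simp add: \<mu>.emeasure_eq_measure \<nu>.emeasure_eq_measure)
  moreover have "measure unif_disc (B \<inter> ball 0 1) \<le> measure unif_disc B"
    using B by (intro \<nu>.finite_measure_mono) auto
  ultimately show ?thesis by linarith
qed

text \<open>Both measures have mass 1, so passing to the complement turns a deficit into an
  excess.\<close>

lemma abs_measure_diff_le:
  assumes B: "B \<in> sets borel"
  shows "\<bar>measure (mean_esd n) B - measure unif_disc B\<bar> \<le> measure (mean_esd n) (- ball 0 1)"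
proof -
  have "measure (mean_esd n) (- B) = 1 - measure (mean_esd n) B" "measure unif_disc (- B) = 1 - measure unif_disc B"
    using \<mu>.prob_compl[of B] \<nu>.prob_compl[of B] B by (simp_all add: Compl_eq_Diff_UNIV)
  then show ?thesis using measure_mean_minus_unif_le[OF B] measure_mean_minus_unif_le[of "- B"] B by (simp add: abs_if)
qed

text \<open>The unit disc attains the bound valid for all Borel sets; the mass outside it is the
  probability that a Poisson variable of mean \<open>n\<close> equals \<open>n\<close>.\<close>

lemma D_mean_esd: "D (mean_esd n) unif_disc = exp (- real n) * real n ^ n / fact n"
proof -
  have b: "ball (0::complex) 1 \<in> sets borel" by auto
  have "measure (mean_esd n) (ball 0 1) = 1 - measure (mean_esd n) (- ball 0 1)"
    using \<mu>.prob_compl[of "- ball 0 1"] b by (simp add: Compl_eq_Diff_UNIV Diff_Diff_Int)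
  moreover have "measure unif_disc (ball 0 1) = 1" using emeasure_unif_disc_ball[of 1] by (simp add: measure_def)
  ultimately have at: "\<bar>measure (mean_esd n) (ball 0 1) - measure unif_disc (ball 0 1)\<bar> = measure (mean_esd n) (- ball 0 1)" by simp
  have "D (mean_esd n) unif_disc = measure (mean_esd n) (- ball 0 1)"
    unfolding D_def ball_discrepancy_def
  proof (rule cSup_eq_maximum)
    show "measure (mean_esd n) (- ball 0 1) \<in> (\<lambda>(z0, R). \<bar>measure (mean_esd n) (ball z0 R) - measure unif_disc (ball z0 R)\<bar>) ` {(z0, R). R > 0}"
      using at by (intro image_eqI[of _ _ "(0, 1)"]) auto
    fix x assume "x \<in> (\<lambda>(z0, R). \<bar>measure (mean_esd n) (ball z0 R) - measure unif_disc (ball z0 R)\<bar>) ` {(z0, R). R > 0}"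
    then show "x \<le> measure (mean_esd n) (- ball 0 1)" by (auto intro!: abs_measure_diff_le)
  qed
  then show ?thesis using measure_mean_esd_outside[of 1] by simp
qed

lemma outside_bound:
  assumes e: "e > 0" and B: "B \<in> sets borel" "B \<subseteq> - ball 0 (1 + e)"
  shows "\<bar>measure (mean_esd n) B - measure unif_disc B\<bar> \<le> exp (- (real n * e\<^sup>2))"
proof -
  have "- ball 0 (1 + e) \<subseteq> - ball (0::complex) 1" using e by auto
  from emeasure_unif_disc_outside[OF B(1) order_trans[OF B(2) this]]
  have "measure unif_disc B = 0" by (simp add: measure_def)
  moreover have "measure (mean_esd n) B \<le> measure (mean_esd n) (- ball 0 (1 + e))"
    using B by (intro \<mu>.finite_measure_mono) auto
  moreover have "measure (mean_esd n) (- ball 0 (1 + e)) \<le> exp (- (real n * (1 + e)\<^sup>2)) * (real n * (1 + e)\<^sup>2) ^ n / fact n"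
  proof -
    have "1 \<le> (1 + e)\<^sup>2" using e by simp
    moreover have "0 \<le> poisson_cdf n (real n * (1 + e)\<^sup>2)" by (rule poisson_cdf_nonneg) simp
    ultimately have "(1 - (1 + e)\<^sup>2) * poisson_cdf n (real n * (1 + e)\<^sup>2) \<le> 0" by (intro mult_nonpos_nonneg) auto
    then show ?thesis using measure_mean_esd_outside[of "1 + e"] e by simp
  qed
  moreover have "exp (- (real n * (1 + e)\<^sup>2)) * (real n * (1 + e)\<^sup>2) ^ n / fact n \<le> exp (- (real n * e\<^sup>2))"
    using poisson_tail_bound[OF n refl, of e] e by simp
  ultimately show ?thesis by simp
qed

text \<open>Inside the unit disc the deficit of the mean spectral distribution is monotone in the
  set, so the largest admissible disc is the worst case.\<close>

lemma inside_bound: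
  assumes e: "e > 0" "e \<le> 1" and B: "B \<in> sets borel" "B \<subseteq> ball 0 (1 - e)"
  shows "\<bar>measure (mean_esd n) B - measure unif_disc B\<bar> \<le> exp (- (real n * e\<^sup>2))"
proof -
  let ?B = "ball (0::complex) (1 - e)" and ?s = "(1 - e)\<^sup>2"
  have sub: "?B \<subseteq> ball 0 1" using e by auto
  have le: "measure (mean_esd n) A \<le> measure unif_disc A" if "A \<in> sets borel" "A \<subseteq> ?B" for A
    using mean_esd_le_unif_disc[OF n that(1)] that sub by (auto simp: \<mu>.emeasure_eq_measure \<nu>.emeasure_eq_measure)
  have split: "measure M ?B = measure M B + measure M (?B - B)" if "finite_measure M" "sets M = sets borel" for M
    using finite_measure.finite_measure_Union[OF that(1), of B "?B - B"] B that(2) by (simp add: Un_absorb1)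
  have s\<mu>: "measure (mean_esd n) ?B = measure (mean_esd n) B + measure (mean_esd n) (?B - B)"
    by (rule split) (simp_all add: \<mu>.finite_measure_axioms)
  have s\<nu>: "measure unif_disc ?B = measure unif_disc B + measure unif_disc (?B - B)"
    by (rule split) (simp_all add: \<nu>.finite_measure_axioms)
  have "measure (mean_esd n) (?B - B) \<le> measure unif_disc (?B - B)" using B by (intro le) auto
  then have "\<bar>measure (mean_esd n) B - measure unif_disc B\<bar> \<le> measure unif_disc ?B - measure (mean_esd n) ?B"
    using le[OF B] s\<mu> s\<nu> by simp
  also have "measure unif_disc ?B = ?s" using emeasure_unif_disc_ball[of "1 - e"] e by (simp add: measure_def)
  also have "measure (mean_esd n) ?B = 1 - measure (mean_esd n) (- ?B)"
    using \<mu>.prob_compl[of "- ?B"] by (simp add: Compl_eq_Diff_UNIV Diff_Diff_Int)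
  also have "?s - (1 - measure (mean_esd n) (- ?B)) = - ((1 - ?s) * (1 - poisson_cdf n (real n * ?s))) + exp (- (real n * ?s)) * (real n * ?s) ^ n / fact n"
    using measure_mean_esd_outside[of "1 - e"] e by (simp add: algebra_simps)
  also have "\<dots> \<le> exp (- (real n * ?s)) * (real n * ?s) ^ n / fact n"
  proof -
    have "?s \<le> 1" using e by (simp add: power_le_one)
    then have "0 \<le> (1 - ?s) * (1 - poisson_cdf n (real n * ?s))"
      by (intro mult_nonneg_nonneg) (simp_all add: poisson_cdf_le_1)
    then show ?thesis by linarith
  qed
  also have "\<dots> \<le> exp (- (real n * e\<^sup>2))"
    using poisson_tail_bound[OF n, of ?s "- e"] e by simp
  finally show ?thesis .
qed

end

theorem lemma1:
  shows "(\<lambda>n. D (mean_esd n) unif_disc) \<sim>[sequentially] (\<lambda>n. 1 / sqrt (2 * pi * real n))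
    \<and> (\<exists>C::real. C > 0 \<and> (\<forall>n::nat. n \<ge> 1 \<longrightarrow> (\<forall>\<epsilon>::real. \<epsilon> > 0 \<longrightarrow>
          ball_discrepancy
            {(z0, R). R > 0 \<and> (ball z0 R \<subseteq> - ball 0 (1 + \<epsilon>) \<or> ball z0 R \<subseteq> ball 0 (1 - \<epsilon>))}
            (mean_esd n) unif_disc
          \<le> C * exp (- (real n * \<epsilon>\<^sup>2)))))"
proof (intro conjI exI[of _ "1::real"] allI impI)
  have "(\<lambda>n. sqrt (2 * pi) / stirling_ratio n) \<longlonglongrightarrow> sqrt (2 * pi) / sqrt (2 * pi)"
    by (intro tendsto_intros stirling_ratio_tendsto) auto
  then have lim: "(\<lambda>n. sqrt (2 * pi) / stirling_ratio n) \<longlonglongrightarrow> 1" by simp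
  show "(\<lambda>n. D (mean_esd n) unif_disc) \<sim>[sequentially] (\<lambda>n. 1 / sqrt (2 * pi * real n))"
  proof (rule asymp_equivI', rule Lim_transform_eventually[OF lim])
    show "eventually (\<lambda>n. sqrt (2 * pi) / stirling_ratio n = D (mean_esd n) unif_disc / (1 / sqrt (2 * pi * real n))) sequentially"
      using eventually_ge_at_top[of 1]
    proof eventually_elim
      fix n :: nat assume n: "n \<ge> 1"
      show "sqrt (2 * pi) / stirling_ratio n = D (mean_esd n) unif_disc / (1 / sqrt (2 * pi * real n))"
        unfolding D_mean_esd[OF n] stirling_ratio_def real_sqrt_mult exp_minus using n by (simp add: field_simps)
    qed
  qed
next
  show "(1::real) > 0" by simp
next
  fix n :: nat and \<epsilon> :: real assume n: "1 \<le> n" and e: "0 < \<epsilon>"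
  let ?S = "{(z0 :: complex, R). R > 0 \<and> (ball z0 R \<subseteq> - ball 0 (1 + \<epsilon>) \<or> ball z0 R \<subseteq> ball 0 (1 - \<epsilon>))}"
  let ?f = "\<lambda>(z0, R). \<bar>measure (mean_esd n) (ball z0 R) - measure unif_disc (ball z0 R)\<bar>"
  have "ball (complex_of_real (2 + \<epsilon>)) 1 \<subseteq> - ball 0 (1 + \<epsilon>)"
  proof
    fix z assume "z \<in> ball (complex_of_real (2 + \<epsilon>)) 1"
    then have "norm (complex_of_real (2 + \<epsilon>) - z) < 1" by (simp add: dist_norm)
    moreover have "norm (complex_of_real (2 + \<epsilon>)) \<le> norm (complex_of_real (2 + \<epsilon>) - z) + norm z"
      using norm_triangle_ineq[of "complex_of_real (2 + \<epsilon>) - z" z] by simp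
    ultimately show "z \<in> - ball 0 (1 + \<epsilon>)" using e by (simp only: norm_of_real) simp
  qed
  then have "(complex_of_real (2 + \<epsilon>), 1) \<in> ?S" by simp
  then have ne: "?f ` ?S \<noteq> {}" by blast
  show "ball_discrepancy ?S (mean_esd n) unif_disc \<le> 1 * exp (- (real n * \<epsilon>\<^sup>2))"
    unfolding ball_discrepancy_def
  proof (rule cSup_least[OF ne])
    fix x assume "x \<in> ?f ` ?S"
    then obtain z0 R where R: "R > 0" "ball z0 R \<subseteq> - ball 0 (1 + \<epsilon>) \<or> ball z0 R \<subseteq> ball 0 (1 - \<epsilon>)"
      and x: "x = \<bar>measure (mean_esd n) (ball z0 R) - measure unif_disc (ball z0 R)\<bar>" by auto
    from R(2) have "x \<le> exp (- (real n * \<epsilon>\<^sup>2))"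
    proof
      assume "ball z0 R \<subseteq> - ball 0 (1 + \<epsilon>)"
      then show ?thesis unfolding x by (intro outside_bound[OF n e]) auto
    next
      assume sub: "ball z0 R \<subseteq> ball 0 (1 - \<epsilon>)"
      have "z0 \<in> ball z0 R" using R(1) by simp
      from subsetD[OF sub this] have "norm z0 < 1 - \<epsilon>" by (simp add: dist_norm)
      then have "\<epsilon> \<le> 1" using norm_ge_zero[of z0] by linarith
      with sub show ?thesis unfolding x by (intro inside_bound[OF n e]) auto
    qed
    then show "x \<le> 1 * exp (- (real n * \<epsilon>\<^sup>2))" by simp
  qed
qed

end
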